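(* There exist discrete arrays $h_1,h_0:\mathbb{Z}^3\to\mathbb{Z}$ such that for all integers $m\ge1$, $n\ge1$, \[ U^{(1)}\!\left(\frac{y^m}{(1+5y)^n}\right)=\frac{1}{(1+5y)^{5n-4}}\sum_{r\ge\lceil m/5\rceil}h_1(m,n,r)\,5^{\pi_1(m,r)}\,y^r, \] \[ U^{(0)}\!\left(\frac{y^m}{(1+5y)^n}\right)=\frac{1}{(1+5y)^{5n-2}}\sum_{r\ge\lceil (m+2)/5\rceil}h_0(m,n,r)\,5^{\pi_0(m,r)}\,y^r. \]
   Context: $q=e^{2\pi i\tau}$, $E_2(\tau)=1-24\sum_{n\ge1}\frac{nq^n}{1-q^n}$, $F(\tau)=\frac1{24}(50E_2(10\tau)-25E_2(5\tau)-2E_2(2\tau)+E_2(\tau))$, $Z(\tau)=q^2\prod_{m\ge1}\frac{1-q^{50m}}{1-q^{2m}}$, $y=y(\tau)=q\prod_{m\ge1}\frac{(1-q^{2m})(1-q^{10m})^3}{(1-q^m)^3(1-q^{5m})}$. For $f=\sum_{m\ge M}a(m)q^m$, $U_5(f)=\sum_{5m\ge M}a(5m)q^m$; $U^{(1)}(f)=U_5(Ff)/F$, $U^{(0)}(f)=U_5(FZf)/F$. A function $s:\mathbb{Z}\to\mathbb{Z}$ is discrete if $s(r)=0$ for all sufficiently large $r$; $h:\mathbb{Z}^3\to\mathbb{Z}$ is a discrete array if $r\mapsto h(a,b,r)$ is discrete for every fixed $(a,b)$. For $m,r\ge1$: $\pi_1(m,r)=0$ if $m\in\{1,2\}, r=1$;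 $=3$ if $m\in\{1,2\},r=3$; $=\lfloor\frac{5r+1}{6}\rfloor$ if $m\in\{1,2\}$, $r\ge2$, $r\ne3$; $=2$ if $m=3,r=2$; $=\lfloor\frac{5r-2}{6}\rfloor$ if $m=3,r\ne2$; $=\lfloor\frac{5r-m+1}{6}\rfloor$ if $m\ge4$. $\pi_0(m,r)=\lfloor\frac{5r+1}{6}\rfloor$ if $m=1$, or if $m=2$ and $r\notin\{3,4,5\}$; $=\lfloor\frac{5r-5}{6}\rfloor$ if $m=2$ and $3\le r\le5$; $=\lfloor\frac{5r-m-2}{6}\rfloor$ if $m\ge3$. *)

theory Defs
  imports "HOL-Analysis.Analysis" "HOL-Computational_Algebra.Computational_Algebra"
begin

text \<open>
  Functions of \<open>\<tau>\<close> are represented by their expansions in \<open>q = exp (2 * pi * \<i> * \<tau>)\<close>, i.e. by formal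
  power or Laurent series over the complex numbers in the variable \<open>fps_X\<close> resp. \<open>fls_X\<close>, which
  plays the role of \<open>q\<close>. The replacement \<open>\<tau> \<mapsto> k * \<tau>\<close> becomes composition with \<open>fps_X ^ k\<close>.
  Infinite sums and products are limits in the \<open>fps_X\<close>-adic topology; products and sums over
  \<open>m \<ge> 1\<close> are indexed by \<open>Suc m\<close> with \<open>m \<ge> 0\<close>.
\<close>

definition E2 :: "complex fps" where
  "E2 = 1 - 24 * (\<Sum>n. of_nat (Suc n) * fps_X ^ Suc n / (1 - fps_X ^ Suc n))"

definition Fq :: "complex fls" where
  "Fq = fps_to_fls (fps_const (1 / 24) *
     (50 * (E2 oo fps_X ^ 10) - 25 * (E2 oo fps_X ^ 5) - 2 * (E2 oo fps_X ^ 2) + E2))"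

definition Zq :: "complex fls" where
  "Zq = fps_to_fls (fps_X ^ 2 *
     (\<Prod>m. (1 - fps_X ^ (50 * Suc m)) / (1 - fps_X ^ (2 * Suc m))))"

definition yq :: "complex fls" where
  "yq = fps_to_fls (fps_X *
     (\<Prod>m. ((1 - fps_X ^ (2 * Suc m)) * (1 - fps_X ^ (10 * Suc m)) ^ 3) /
          ((1 - fps_X ^ Suc m) ^ 3 * (1 - fps_X ^ (5 * Suc m)))))"

lift_definition U5 :: "'a::zero fls \<Rightarrow> 'a fls" is
  "\<lambda>(a :: int \<Rightarrow> 'a) m. a (5 * m)"
proof -
  fix a :: "int \<Rightarrow> 'a"
  assume "\<forall>\<^sub>\<infinity>n. a (- int n) = 0"
  then obtain N where N: "\<forall>n>N. a (- int n) = 0"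
    by (auto simp: MOST_nat)
  have "a (5 * - int n) = 0" if "n > N" for n
    using N[rule_format, of "5 * n"] that by simp
  thus "\<forall>\<^sub>\<infinity>n. a (5 * - int n) = 0"
    by (auto simp: MOST_nat)
qed

definition U1 :: "complex fls \<Rightarrow> complex fls" where
  "U1 f = U5 (Fq * f) / Fq"

definition U0 :: "complex fls \<Rightarrow> complex fls" where
  "U0 f = U5 (Fq * Zq * f) / Fq"

text \<open>
  For discrete \<open>s\<close> and any lower bound \<open>a\<close>, the set \<open>{r. r \<ge> a \<and> s r \<noteq> 0}\<close> is finite, so the formally
  infinite sum over \<open>r \<ge> a\<close> of terms \<open>s r * c r\<close> is the finite sum over this set.
\<close>

definition discrete :: "(int \<Rightarrow> int) \<Rightarrow> bool" where
  "discrete s \<longleftrightarrow> (\<exists>R. \<forall>r\<ge>R. s r = 0)"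

definition discrete_array :: "(int \<Rightarrow> int \<Rightarrow> int \<Rightarrow> int) \<Rightarrow> bool" where
  "discrete_array h \<longleftrightarrow> (\<forall>a b. discrete (h a b))"

text \<open>The values of \<open>pi1\<close> and \<open>pi0\<close> are meaningful only for \<open>m \<ge> 1\<close> and \<open>r \<ge> 1\<close>.\<close>

definition pi1 :: "int \<Rightarrow> int \<Rightarrow> int" where
  "pi1 m r =
     (if m \<in> {1, 2} then
        if r = 1 then 0
        else if r = 3 then 3
        else \<lfloor>real_of_int (5 * r + 1) / 6\<rfloor>
      else if m = 3 then
        if r = 2 then 2
        else \<lfloor>real_of_int (5 * r - 2) / 6\<rfloor>
      else \<lfloor>real_of_int (5 * r - m + 1) / 6\<rfloor>)"

definition pi0 :: "int \<Rightarrow> int \<Rightarrow> int" where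
  "pi0 m r =
     (if m = 1 \<or> m = 2 \<and> r \<notin> {3, 4, 5} then \<lfloor>real_of_int (5 * r + 1) / 6\<rfloor>
      else if m = 2 then \<lfloor>real_of_int (5 * r - 5) / 6\<rfloor>
      else \<lfloor>real_of_int (5 * r - m - 2) / 6\<rfloor>)"

text \<open>The infinite sum and products above converge, and the division by \<open>Fq\<close> is a genuine one.\<close>

lemma E2_summable:
  "summable (\<lambda>n. of_nat (Suc n) * fps_X ^ Suc n / (1 - fps_X ^ Suc n) :: complex fps)"
proof -
  let ?f = "\<lambda>n. of_nat (Suc n) * fps_X ^ Suc n / (1 - fps_X ^ Suc n) :: complex fps"
  have eq: "?f n = fps_X ^ Suc n * (of_nat (Suc n) * inverse (1 - fps_X ^ Suc n))" for n
    by (subst fps_divide_unit) (auto simp: algebra_simps)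
  have zero: "fps_nth (?f n) k = 0" if "k < Suc n" for n k
    unfolding eq fps_X_power_mult_nth using that by simp
  have "(\<lambda>N. \<Sum>n<N. ?f n) \<longlonglongrightarrow> Abs_fps (\<lambda>k. \<Sum>n<k. fps_nth (?f n) k)"
  proof (rule tendsto_fpsI)
    fix k
    show "\<forall>\<^sub>F N in sequentially. fps_nth (\<Sum>n<N. ?f n) k =
            fps_nth (Abs_fps (\<lambda>k. \<Sum>n<k. fps_nth (?f n) k)) k"
      using eventually_ge_at_top[of k]
    proof eventually_elim
      case (elim N)
      have "(\<Sum>n<N. fps_nth (?f n) k) = (\<Sum>n<k. fps_nth (?f n) k)"
        by (rule sum.mono_neutral_right) (use elim zero in auto)
      thus ?case by (simp add: fps_sum_nth)
    qed
  qed
  thus ?thesis by (auto simp: summable_def sums_def)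
qed

lemma convergent_prod_fps:
  fixes f :: "nat \<Rightarrow> complex fps"
  assumes "\<And>m. fps_X ^ Suc m dvd f m - 1"
  shows "convergent_prod f"
proof -
  have nth: "fps_nth (f m) k = fps_nth 1 k" if "k \<le> m" for m k
  proof -
    obtain g where "f m - 1 = fps_X ^ Suc m * g" using assms[of m] by (auto elim!: dvdE)
    hence "fps_nth (f m - 1) k = 0" unfolding \<open>f m - 1 = _\<close> fps_X_power_mult_nth using that by simp
    thus ?thesis by simp
  qed
  let ?P = "Abs_fps (\<lambda>k. fps_nth (\<Prod>i\<le>k. f i) k)"
  have S: "fps_nth (\<Prod>i\<le>N. f i) k = fps_nth (\<Prod>i\<le>k. f i) k" if "k \<le> N" for N k
    using that
  proof (induction N rule: dec_induct)
    case (step N)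
    have "fps_nth (\<Prod>i\<le>Suc N. f i) k = fps_nth ((\<Prod>i\<le>N. f i) * f (Suc N)) k" by simp
    also have "\<dots> = fps_nth ((\<Prod>i\<le>N. f i) * 1) k"
      unfolding fps_mult_nth by (rule sum.cong) (use nth step in auto)
    finally show ?case using step by simp
  qed simp
  have "(\<lambda>N. \<Prod>i\<le>N. f i) \<longlonglongrightarrow> ?P"
  proof (rule tendsto_fpsI)
    fix k show "\<forall>\<^sub>F N in sequentially. fps_nth (\<Prod>i\<le>N. f i) k = fps_nth ?P k"
      by (rule eventually_sequentiallyI[of k]) (subst fps_nth_Abs_fps, rule S)
  qed
  moreover have "fps_nth ?P 0 = 1" using nth[of 0 0] by simp
  hence "?P \<noteq> 0" using fps_zero_nth[of 0] zero_neq_one by force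
  ultimately show ?thesis
    unfolding convergent_prod_def raw_has_prod_def by (intro exI[of _ 0] exI[of _ ?P]) simp
qed

lemma dvd1_mult: "d dvd a * b - 1" if "d dvd a - 1" "d dvd b - 1" for d a b :: "complex fps"
proof -
  have "a * b - 1 = (a - 1) * b + (b - 1)" by (simp add: algebra_simps)
  thus ?thesis using that by (simp only: dvd_add dvd_mult2)
qed

lemma dvd1_power: "d dvd a ^ n - 1" if "d dvd a - 1" for d a :: "complex fps"
  by (induction n) (use that in \<open>auto intro: dvd1_mult\<close>)

lemma dvd1_divide: "d dvd a / b - 1" if "d dvd a - 1" "d dvd b - 1" "fps_nth b 0 = 1" for d a b :: "complex fps"
proof -
  have "a / b - 1 = ((a - 1) - (b - 1)) * inverse b"
    using that(3) inverse_mult_eq_1'[of b] by (simp add: fps_divide_unit algebra_simps)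
  thus ?thesis using that by (simp only: dvd_diff dvd_mult2)
qed

lemma dvd1: "fps_X ^ Suc m dvd (1 - fps_X ^ k) - (1 :: complex fps)" if "k \<ge> Suc m"
  using le_imp_power_dvd[OF that, of "fps_X :: complex fps"] by simp

lemma Zq_convergent_prod:
  "convergent_prod (\<lambda>m. (1 - fps_X ^ (50 * Suc m)) / (1 - fps_X ^ (2 * Suc m)) :: complex fps)"
  by (intro convergent_prod_fps dvd1_divide dvd1) auto

lemma yq_convergent_prod:
  "convergent_prod (\<lambda>m. ((1 - fps_X ^ (2 * Suc m)) * (1 - fps_X ^ (10 * Suc m)) ^ 3) /
          ((1 - fps_X ^ Suc m) ^ 3 * (1 - fps_X ^ (5 * Suc m))) :: complex fps)"
  by (intro convergent_prod_fps dvd1_divide dvd1_mult dvd1_power dvd1) (auto simp: fps_mult_nth_0 fps_power_zeroth)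

lemma Fq_nonzero: "Fq \<noteq> 0"
proof -
  let ?f = "\<lambda>n. of_nat (Suc n) * fps_X ^ Suc n / (1 - fps_X ^ Suc n) :: complex fps"
  have "(\<lambda>N. \<Sum>n<N. ?f n) \<longlonglongrightarrow> suminf ?f" using E2_summable summable_sums sums_def by blast
  hence "\<forall>\<^sub>F N in sequentially. fps_nth (\<Sum>n<N. ?f n) 0 = fps_nth (suminf ?f) 0" by (simp add: tendsto_fps_iff)
  then obtain N where "fps_nth (\<Sum>n<N. ?f n) 0 = fps_nth (suminf ?f) 0" by (auto simp: eventually_sequentially)
  moreover have "fps_nth (?f n) 0 = 0" for n by (subst fps_divide_unit) (auto)
  ultimately have "fps_nth (suminf ?f) 0 = 0" by (simp add: fps_sum_nth)
  hence e: "fps_nth E2 0 = 1" by (simp add: E2_def)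
  have "fls_nth Fq 0 = 1" unfolding Fq_def by (simp add: e numeral_fps_const)
  thus ?thesis by auto
qed

end

theory Submission
  imports Defs
begin

text \<open>
  All identities are proved for formal series, without modular forms. The operator \<open>V5\<close>, i.e.
  \<open>q \<mapsto> q\<^sup>5\<close>, satisfies \<open>U5 (V5 f * g) = f * U5 g\<close>. The Jacobi triple product together with two dissections of
  products of theta functions modulo 5 gives two eta identities of level 10. These identities at
  \<open>\<tau>\<close> and \<open>5\<tau>\<close> imply all relations that are needed at level 50: the equation of degree 5 of \<open>y\<close> over
  \<open>Y = y(5\<tau>)\<close>, the expression of \<open>Z\<close> through \<open>y\<close> and \<open>Y\<close>, and, since \<open>F\<close> is the logarithmic derivative of
  an eta quotient, \<open>F = q y' / (y (1 + 4 y))\<close>. Differentiating the equation of degree 5 writes \<open>F y\<close> and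
  \<open>F Z y\<close> as \<open>F(5\<tau>)\<close> times a polynomial in \<open>y\<close> and \<open>Y\<close> over \<open>P'(y)\<close>, so Euler's trace formula evaluates
  \<open>U1 (y ^ m)\<close> and \<open>U0 (y ^ m)\<close>.

  The equations of \<open>y\<close> and of \<open>w = 1 + 5 y\<close> over \<open>Y\<close> give recurrences of order 5 in \<open>m\<close> and \<open>n\<close> for the images
  of \<open>y ^ m / w ^ n\<close>. The bounds on the powers of 5 hold for \<open>m, n \<in> {1..5}\<close> by computation and
  propagate along both recurrences, because \<open>5 ^ \<lfloor>(5 i + j) / 6\<rfloor>\<close> divides the coefficient of
  \<open>Y ^ i * y ^ j\<close> in the first equation and the coefficient of \<open>y ^ i\<close> in the recurrence in \<open>n\<close> is
  divisible by \<open>5 ^ i\<close> and, for \<open>1 \<le> i \<le> 4\<close>, even by \<open>5 ^ (i + 1)\<close>.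
\<close>

section \<open>Formal limits and Gaussian binomials\<close>

text \<open>Three points shape the argument. Integrality: F y and F Z y are 5 F(5\<tau>) / P'(y)
  times integer polynomials in y and Y. This 5 cancels the fifth in \<open>U5\<close>, and
  F(5\<tau>) leaves \<open>U5\<close> as F, which the division by F removes; so the images of the
  powers of y are integer polynomials in y. Denominators: the norm of w = 1 + 5 y over the series in
  q^5 is w(5\<tau>)^5, hence \<open>U1\<close> and \<open>U0\<close> turn w^(-n) into w^(-5 n) at
  worst. The surplus factors w^4 and w^2 are found in the base cases and survive because the
  recurrences are linear. Exponents: \<open>pi1\<close> and \<open>pi0\<close> are irregular only
  for m \<le> 3. The recurrence in n is therefore used only for m \<le> 5, with m fixed, and the
  recurrence in m only to reach m \<ge> 6, where the exponents follow one formula.\<close>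

lemma fps_X_power_dvd_iff:
  fixes f :: "'a::field fps"
  shows "fps_X ^ n dvd f \<longleftrightarrow> (\<forall>k<n. fps_nth f k = 0)"
proof
  assume "fps_X ^ n dvd f"
  then show "\<forall>k<n. fps_nth f k = 0" by (auto elim!: dvdE simp: fps_X_power_mult_nth)
next
  assume *: "\<forall>k<n. fps_nth f k = 0"
  have "f = fps_X ^ n * fps_shift n f"
    by (rule fps_ext) (use * in \<open>auto simp: fps_X_power_mult_nth\<close>)
  then show "fps_X ^ n dvd f" by (metis dvd_triv_left)
qed

text \<open>Convergence with a fixed rate: the n-th term is correct modulo X^n. Products, powers, X
  times the derivative and substitution of X^d keep this rate, so limits of identities between
  finite products need no choice of indices.\<close>

definition fps_approx :: "(nat \<Rightarrow> 'a::field fps) \<Rightarrow> 'a fps \<Rightarrow> bool" where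
  "fps_approx f g \<longleftrightarrow> (\<forall>n. fps_X ^ n dvd f n - g)"

lemma fps_approx_const [intro]: "fps_approx (\<lambda>_. c) c"
  by (simp add: fps_approx_def)

lemma fps_approx_mult:
  assumes "fps_approx f g" "fps_approx f' g'"
  shows "fps_approx (\<lambda>n. f n * f' n) (g * g')"
  unfolding fps_approx_def
proof
  fix n
  have "f n * f' n - g * g' = (f n - g) * f' n + g * (f' n - g')" by (simp add: algebra_simps)
  then show "fps_X ^ n dvd f n * f' n - g * g'"
    using assms unfolding fps_approx_def by (metis dvd_add dvd_mult dvd_mult2)
qed

lemma fps_approx_power: "fps_approx f g \<Longrightarrow> fps_approx (\<lambda>n. f n ^ k) (g ^ k)"
  by (induction k) (auto intro: fps_approx_mult)

lemma fps_approx_unique: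
  assumes "fps_approx f g" "fps_approx f g'"
  shows "g = g'"
proof (rule fps_ext)
  fix k
  have "fps_X ^ Suc k dvd (f (Suc k) - g') - (f (Suc k) - g)"
    using assms unfolding fps_approx_def by (blast intro: dvd_diff)
  then have "fps_X ^ Suc k dvd g - g'" by simp
  then show "fps_nth g k = fps_nth g' k" unfolding fps_X_power_dvd_iff by force
qed

lemma fps_approx_subseq:
  assumes "fps_approx f g" "\<And>n. n \<le> r n"
  shows "fps_approx (\<lambda>n. f (r n)) g"
  unfolding fps_approx_def
  by (metis assms fps_approx_def dvd_trans le_imp_power_dvd)

lemma fps_approx_cong: "fps_approx f g \<Longrightarrow> (\<And>n. f n = f' n) \<Longrightarrow> fps_approx f' g"
  by (simp add: fps_approx_def)

text \<open>Facts on convergent infinite products assume continuous multiplication. It holds since a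
  coefficient of a product depends on finitely many coefficients of the factors.\<close>

instance fps :: (comm_ring_1) topological_semigroup_mult
proof
  fix a b :: "'a fps"
  show "((\<lambda>x. fst x * snd x) \<longlongrightarrow> a * b) (nhds a \<times>\<^sub>F nhds b)"
    unfolding tendsto_fps_iff
  proof
    fix n
    have *: "\<forall>\<^sub>F x in nhds c. \<forall>i\<in>{..n}. fps_nth x i = fps_nth c i" for c :: "'a fps"
      using filterlim_ident[of "nhds c"] unfolding tendsto_fps_iff
      by (subst eventually_ball_finite_distrib) auto
    have "\<forall>\<^sub>F x in nhds a \<times>\<^sub>F nhds b.
        (\<forall>i\<in>{..n}. fps_nth (fst x) i = fps_nth a i) \<and> (\<forall>i\<in>{..n}. fps_nth (snd x) i = fps_nth b i)"
      by (rule eventually_prodI[OF * *])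
    then show "\<forall>\<^sub>F x in nhds a \<times>\<^sub>F nhds b. fps_nth (fst x * snd x) n = fps_nth (a * b) n"
      by eventually_elim (auto simp: fps_mult_nth intro!: sum.cong)
  qed
qed

lemma prodinf_approx:
  fixes f :: "nat \<Rightarrow> complex fps"
  assumes "\<And>m. fps_X ^ Suc m dvd f m - 1"
  shows "fps_approx (\<lambda>n. \<Prod>m<n. f m) (prodinf f)"
  unfolding fps_approx_def fps_X_power_dvd_iff
proof (intro allI impI)
  fix n k :: nat assume k: "k < n"
  \<comment> \<open>No factor vanishes, so the infinite product is the limit of the partial products
    from index 0 on.\<close>
  have nz: "f i \<noteq> 0" for i
  proof
    assume "f i = 0"
    then have "(fps_X :: complex fps) ^ 1 dvd 1"
      using assms[of i] by (metis diff_0 dvd_minus_iff dvd_trans le_imp_power_dvd One_nat_def le_add1 plus_1_eq_Suc)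
    then show False unfolding fps_X_power_dvd_iff by auto
  qed
  have "convergent_prod f" by (rule convergent_prod_fps) fact
  from convergent_prod_offset_0[OF this nz] obtain p where "f has_prod p"
    unfolding has_prod_def by blast
  then have "f has_prod prodinf f" using has_prod_unique by blast
  then have lim: "(\<lambda>n. \<Prod>m<n. f m) \<longlonglongrightarrow> prodinf f" by (rule has_prod_imp_tendsto')
  then have "\<forall>\<^sub>F N in sequentially. fps_nth (\<Prod>m<N. f m) k = fps_nth (prodinf f) k"
    by (simp add: tendsto_fps_iff)
  then obtain N where N: "N \<ge> n" "fps_nth (\<Prod>m<N. f m) k = fps_nth (prodinf f) k"
    unfolding eventually_sequentially by (metis nle_le)
  have "fps_nth (\<Prod>m<N. f m) k = fps_nth (\<Prod>m<n. f m) k"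
    using N(1)
  proof (induction N rule: dec_induct)
    case (step N)
    have "fps_X ^ Suc k dvd (\<Prod>m<N. f m) * (f N - 1)"
      using assms[of N] k step.hyps by (meson dvd_mult dvd_trans le_imp_power_dvd Suc_leI less_le_trans Suc_le_mono le_SucI)
    then have "fps_nth ((\<Prod>m<N. f m) * (f N - 1)) k = 0" unfolding fps_X_power_dvd_iff by blast
    then show ?case using step.IH by (simp add: algebra_simps)
  qed simp
  then show "fps_nth ((\<Prod>m<n. f m) - prodinf f) k = 0" using N by simp
qed

definition euler :: "nat \<Rightarrow> complex fps" where
  "euler k = (\<Prod>m. 1 - fps_X ^ (k * Suc m))"

lemma euler_dvd: "k > 0 \<Longrightarrow> fps_X ^ Suc m dvd (1 - fps_X ^ (k * Suc m) :: complex fps) - 1"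
  by (rule dvd1) (cases k; simp)

lemma euler_approx: "k > 0 \<Longrightarrow> fps_approx (\<lambda>n. \<Prod>m<n. 1 - fps_X ^ (k * Suc m)) (euler k)"
  unfolding euler_def by (rule prodinf_approx, rule euler_dvd)

lemma euler_nth_0 [simp]: assumes "k > 0" shows "fps_nth (euler k) 0 = 1"
proof -
  have "fps_X ^ 1 dvd (\<Prod>m<1. 1 - fps_X ^ (k * Suc m)) - euler k"
    using euler_approx[OF assms] unfolding fps_approx_def by blast
  then have "fps_nth ((\<Prod>m<1. 1 - fps_X ^ (k * Suc m)) - euler k) 0 = 0"
    unfolding fps_X_power_dvd_iff by blast
  then show ?thesis using assms by simp
qed

fun qbinom :: "'a::comm_ring_1 \<Rightarrow> nat \<Rightarrow> nat \<Rightarrow> 'a" where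
  "qbinom Q N 0 = 1"
| "qbinom Q 0 (Suc k) = 0"
| "qbinom Q (Suc N) (Suc k) = qbinom Q N (Suc k) + Q ^ (N - k) * qbinom Q N k"

lemma qbinom_eq_0: "N < k \<Longrightarrow> qbinom Q N k = 0"
  by (induction Q N k rule: qbinom.induct) auto

lemma qbinom_self [simp]: "qbinom Q N N = 1"
  by (induction N) (auto simp: qbinom_eq_0)

text \<open>The second Pascal rule. In the finite triple product it serves the factors with exponent
  b, the defining rule those with exponent a.\<close>

lemma qbinom_Suc_Suc':
  "qbinom Q (Suc N) (Suc k) = qbinom Q N k + Q ^ Suc k * qbinom Q N (Suc k)"
proof (induction N arbitrary: k)
  case 0
  show ?case by (cases k) auto
next
  case (Suc N)
  consider "k > Suc N" | "k = Suc N" | "k \<le> N" by linarith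
  then show ?case
  proof cases
    case 3
    show ?thesis
    proof (cases k)
      case 0
      have "Q * (qbinom Q N (Suc 0) + Q ^ N) = Q * (1 + Q * qbinom Q N (Suc 0))"
        using Suc.IH[of 0] by simp
      then show ?thesis using 0 Suc.IH[of 0] by (simp add: algebra_simps)
    next
      case (Suc k')
      have "qbinom Q (Suc (Suc N)) (Suc k) =
              qbinom Q (Suc N) (Suc k) + Q ^ (N - k') * qbinom Q (Suc N) (Suc k')"
        using Suc by simp
      also have "\<dots> = (qbinom Q N k + Q ^ Suc k * qbinom Q N (Suc k))
                 + Q ^ (N - k') * (qbinom Q N k' + Q ^ Suc k' * qbinom Q N (Suc k'))"
        by (simp only: Suc.IH)
      also have "Q ^ (N - k') * (qbinom Q N k' + Q ^ Suc k' * qbinom Q N (Suc k')) =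
           Q ^ (N - k') * qbinom Q N k' + Q ^ Suc k * (Q ^ (N - k) * qbinom Q N k)"
      proof -
        have "Q ^ (N - k') * Q ^ Suc k' = Q ^ Suc k * Q ^ (N - k)"
          unfolding power_add[symmetric] using 3 Suc by (intro arg_cong[of _ _ "\<lambda>n. Q ^ n"]) auto
        then have "Q ^ (N - k') * (Q ^ Suc k' * qbinom Q N k) = Q ^ Suc k * Q ^ (N - k) * qbinom Q N k"
          by (metis mult.assoc)
        then show ?thesis using Suc by (simp only: distrib_left mult.assoc)
      qed
      also have "(qbinom Q N k + Q ^ Suc k * qbinom Q N (Suc k)) + (Q ^ (N - k') * qbinom Q N k' + Q ^ Suc k * (Q ^ (N - k) * qbinom Q N k))
        = qbinom Q (Suc N) k + Q ^ Suc k * qbinom Q (Suc N) (Suc k)"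
        using Suc by (simp add: algebra_simps)
      finally show ?thesis .
    qed
  qed (simp_all add: qbinom_eq_0)
qed

lemma qbinom_mult:
  assumes "k \<le> N"
  shows "qbinom Q N k * ((\<Prod>m<k. 1 - Q ^ Suc m) * (\<Prod>m<N - k. 1 - Q ^ Suc m)) =
         (\<Prod>m<N. 1 - Q ^ Suc m)"
  using assms
proof (induction N arbitrary: k)
  case (Suc N)
  let ?p = "\<lambda>n. \<Prod>m<n. 1 - Q ^ Suc m"
  show ?case
  proof (cases k)
    case 0 then show ?thesis by simp
  next
    case k: (Suc k')
    show ?thesis
    proof (cases "k' = N")
      case True then show ?thesis using k by (simp add: qbinom_eq_0)
    next
      case False
      then have l: "Suc k' \<le> N" "k' \<le> N" using Suc.prems k by auto
      then obtain d where d: "N = k' + Suc d" by (metis add_Suc_right less_iff_Suc_add Suc_le_lessD)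
      have 1: "qbinom Q N (Suc k') * (?p (Suc k') * ?p d) = ?p N"
        using Suc.IH[OF l(1)] d by simp
      have 2: "qbinom Q N k' * (?p k' * ?p (Suc d)) = ?p N"
        using Suc.IH[OF l(2)] d by simp
      have "qbinom Q (Suc N) (Suc k') * (?p (Suc k') * ?p (Suc d)) =
         qbinom Q N (Suc k') * (?p (Suc k') * ?p d) * (1 - Q ^ Suc d) +
         Q ^ Suc d * (1 - Q ^ Suc k') * (qbinom Q N k' * (?p k' * ?p (Suc d)))"
        by (simp add: d algebra_simps)
      also have "\<dots> = ?p N * (1 - Q ^ Suc d * Q ^ Suc k')"
        unfolding 1 2 by (simp add: algebra_simps)
      also have "Q ^ Suc d * Q ^ Suc k' = Q ^ Suc N"
        unfolding power_add[symmetric] by (simp add: d add.commute)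
      finally show ?thesis using k d by simp
    qed
  qed
qed simp

section \<open>The Jacobi triple product\<close>

text \<open>The exponent \<open>((a + b) j\<^sup>2 + (a - b) j) / 2\<close> of Ramanujan's theta function \<open>f(q\<^sup>a, q\<^sup>b)\<close>.\<close>

definition theta_exp :: "nat \<Rightarrow> nat \<Rightarrow> int \<Rightarrow> nat" where
  "theta_exp a b j = nat (int (a + b) * (j * (j - 1) div 2) + int a * j)"

text \<open>The truncation by \<open>nat\<close> is harmless: the exponent is a * j (j + 1) / 2 + b
  * j (j - 1) / 2, a nonnegative combination of triangular numbers.\<close>

lemma int_theta_exp: "int (theta_exp a b j) = int (a + b) * (j * (j - 1) div 2) + int a * j"
proof -
  have even: "2 * (j * (j - 1) div 2) = j * (j - 1)" by simp
  have "0 \<le> int (a + b) * (j * (j - 1) div 2) + int a * j"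
  proof (cases "j \<ge> 0")
    case True
    then have "j * (j - 1) \<ge> 0" by (cases "j = 0") auto
    then show ?thesis using True by (auto intro!: add_nonneg_nonneg mult_nonneg_nonneg)
  next
    case False
    have "(j - 1) * (j + 2) + 2 = j * (j - 1) + 2 * j" by (simp add: algebra_simps)
    moreover have "j * (j + 1) \<ge> 0" using False by (auto intro: mult_nonpos_nonpos)
    then have "j * (j - 1) div 2 + j \<ge> 0" using even by (simp add: algebra_simps)
    moreover have "j * (j - 1) \<ge> 0" using False by (auto intro: mult_nonpos_nonpos)
    ultimately have "0 \<le> int a * (j * (j - 1) div 2 + j) + int b * (j * (j - 1) div 2)"
      by (auto intro!: add_nonneg_nonneg mult_nonneg_nonneg)
    then show ?thesis by (simp add: algebra_simps)
  qed
  then show ?thesis by (simp add: theta_exp_def)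
qed

lemma theta_exp_succ: "int (theta_exp a b (j + 1)) = int (theta_exp a b j) + int (a + b) * j + int a"
proof -
  have "(j + 1) * j = j * (j - 1) + 2 * j" by (simp add: algebra_simps)
  then have "(j + 1) * (j + 1 - 1) div 2 = j * (j - 1) div 2 + j" by simp
  then show ?thesis unfolding int_theta_exp by (simp add: algebra_simps)
qed

definition theta_term :: "complex \<Rightarrow> nat \<Rightarrow> nat \<Rightarrow> int \<Rightarrow> complex fps" where
  "theta_term \<epsilon> a b j = fps_const (\<epsilon> powi j) * fps_X ^ theta_exp a b j"

lemma theta_term_succ:
  assumes "\<epsilon> * \<epsilon> = 1" "int k = int (a + b) * int n + int a" "int l = int (a + b) * (int n - j)"
  shows "fps_const \<epsilon> * fps_X ^ k * theta_term \<epsilon> a b j = fps_X ^ l * theta_term \<epsilon> a b (j + 1)"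
proof -
  have "\<epsilon> \<noteq> 0" using assms(1) by auto
  have "int (k + theta_exp a b j) = int (l + theta_exp a b (j + 1))"
    using assms(2,3) theta_exp_succ[of a b j] by (simp add: algebra_simps)
  then have "k + theta_exp a b j = l + theta_exp a b (j + 1)" by linarith
  then have "(fps_X :: complex fps) ^ k * fps_X ^ theta_exp a b j = fps_X ^ l * fps_X ^ theta_exp a b (j + 1)"
    by (metis power_add)
  moreover have "fps_const \<epsilon> * fps_const (\<epsilon> powi j) = fps_const (\<epsilon> powi (j + 1))"
    using \<open>\<epsilon> \<noteq> 0\<close> by (simp add: power_int_add)
  moreover have "fps_const \<epsilon> * fps_X ^ k * (fps_const (\<epsilon> powi j) * fps_X ^ theta_exp a b j) =
      (fps_const \<epsilon> * fps_const (\<epsilon> powi j)) * (fps_X ^ k * fps_X ^ theta_exp a b j)"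
    by (simp only: ac_simps)
  ultimately show ?thesis unfolding theta_term_def by (simp only: ac_simps)
qed

lemma theta_term_pred:
  assumes "\<epsilon> * \<epsilon> = 1" "int k = int (a + b) * int n + int b" "int l = int (a + b) * (int n + j)"
  shows "fps_const \<epsilon> * fps_X ^ k * theta_term \<epsilon> a b j = fps_X ^ l * theta_term \<epsilon> a b (j - 1)"
proof -
  have "\<epsilon> \<noteq> 0" using assms(1) by auto
  have "int (k + theta_exp a b j) = int (l + theta_exp a b (j - 1))"
    using assms(2,3) theta_exp_succ[of a b "j - 1"] by (simp add: algebra_simps)
  then have "k + theta_exp a b j = l + theta_exp a b (j - 1)" by linarith
  then have "(fps_X :: complex fps) ^ k * fps_X ^ theta_exp a b j = fps_X ^ l * fps_X ^ theta_exp a b (j - 1)"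
    by (metis power_add)
  moreover have "\<epsilon> * \<epsilon> powi j = \<epsilon> powi (j - 1)"
    using \<open>\<epsilon> \<noteq> 0\<close> assms(1) by (simp add: power_int_diff eq_divide_eq ac_simps)
  then have "fps_const \<epsilon> * fps_const (\<epsilon> powi j) = fps_const (\<epsilon> powi (j - 1))" by simp
  moreover have "fps_const \<epsilon> * fps_X ^ k * (fps_const (\<epsilon> powi j) * fps_X ^ theta_exp a b j) =
      (fps_const \<epsilon> * fps_const (\<epsilon> powi j)) * (fps_X ^ k * fps_X ^ theta_exp a b j)"
    by (simp only: ac_simps)
  ultimately show ?thesis unfolding theta_term_def by (simp only: ac_simps)
qed

text \<open>Keeping the two factors of independent lengths makes each induction step a single Pascal rule.\<close>

lemma finite_triple_product:
  assumes "\<epsilon> * \<epsilon> = 1"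
  shows "(\<Prod>k<n. 1 + fps_const \<epsilon> * fps_X ^ ((a + b) * k + a)) *
         (\<Prod>k<n'. 1 + fps_const \<epsilon> * fps_X ^ ((a + b) * k + b)) =
         (\<Sum>k\<le>n + n'. qbinom (fps_X ^ (a + b)) (n + n') k * theta_term \<epsilon> a b (int k - int n'))"
proof (induction n)
  case 0
  let ?Q = "fps_X ^ (a + b) :: complex fps"
  let ?t = "theta_term \<epsilon> a b"
  show ?case
  proof (induction n')
    case 0
    show ?case by (simp add: theta_term_def theta_exp_def)
  next
    case (Suc n')
    have step: "fps_const \<epsilon> * fps_X ^ ((a + b) * n' + b) * ?t (int k - int n') =
                 ?Q ^ k * ?t (int k - int (Suc n'))" for k
    proof -
      have e: "int k - int (Suc n') = int k - int n' - 1" by simp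
      show ?thesis unfolding power_mult[symmetric] e
        by (rule theta_term_pred[where n = n']) (use assms in \<open>simp_all add: algebra_simps\<close>)
    qed
    have "(\<Prod>k<Suc n'. 1 + fps_const \<epsilon> * fps_X ^ ((a + b) * k + b)) =
        (\<Sum>k\<le>n'. qbinom ?Q n' k * ?t (int k - int n')) * (1 + fps_const \<epsilon> * fps_X ^ ((a + b) * n' + b))"
      using Suc.IH by simp
    also have "\<dots> = (\<Sum>k\<le>n'. qbinom ?Q n' k * ?t (int k - int n')) +
        (\<Sum>k\<le>n'. qbinom ?Q n' k * (fps_const \<epsilon> * fps_X ^ ((a + b) * n' + b) * ?t (int k - int n')))"
      by (simp only: distrib_left mult_1_right sum_distrib_right) (simp only: ac_simps)
    also have "\<dots> = (\<Sum>k\<le>n'. qbinom ?Q n' k * ?t (int (Suc k) - int (Suc n'))) +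
        (\<Sum>k\<le>Suc n'. ?Q ^ k * qbinom ?Q n' k * ?t (int k - int (Suc n')))"
      unfolding step by (simp add: algebra_simps qbinom_eq_0)
    also have "\<dots> = ?t (- int (Suc n')) + (\<Sum>k\<le>n'. (qbinom ?Q n' k + ?Q ^ Suc k * qbinom ?Q n' (Suc k)) * ?t (int (Suc k) - int (Suc n')))"
      by (subst sum.atMost_Suc_shift) (simp add: algebra_simps sum.distrib)
    also have "\<dots> = (\<Sum>k\<le>Suc n'. qbinom ?Q (Suc n') k * ?t (int k - int (Suc n')))"
      unfolding qbinom_Suc_Suc'[symmetric] by (subst sum.atMost_Suc_shift) simp
    finally show ?case by simp
  qed
next
  case (Suc n)
  let ?Q = "fps_X ^ (a + b) :: complex fps"
  let ?t = "theta_term \<epsilon> a b"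
  let ?N = "n + n'"
  have step: "fps_const \<epsilon> * fps_X ^ ((a + b) * n + a) * ?t (int k - int n') =
               ?Q ^ (?N - k) * ?t (int (Suc k) - int n')" if "k \<le> ?N" for k
  proof -
    have e: "int (Suc k) - int n' = int k - int n' + 1" by simp
    show ?thesis unfolding power_mult[symmetric] e
    proof (rule theta_term_succ[where n = n])
      have "int (?N - k) = int n - (int k - int n')" using that by (simp add: of_nat_diff)
      then show "int ((a + b) * (?N - k)) = int (a + b) * (int n - (int k - int n'))"
        by (simp only: of_nat_mult)
    qed (use assms in simp_all)
  qed
  have "(\<Prod>k<Suc n. 1 + fps_const \<epsilon> * fps_X ^ ((a + b) * k + a)) *
         (\<Prod>k<n'. 1 + fps_const \<epsilon> * fps_X ^ ((a + b) * k + b)) =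
      (\<Sum>k\<le>?N. qbinom ?Q ?N k * ?t (int k - int n')) * (1 + fps_const \<epsilon> * fps_X ^ ((a + b) * n + a))"
    unfolding Suc.IH[symmetric] by (simp add: algebra_simps)
  also have "\<dots> = (\<Sum>k\<le>Suc ?N. qbinom ?Q ?N k * ?t (int k - int n')) +
      (\<Sum>k\<le>?N. qbinom ?Q ?N k * (fps_const \<epsilon> * fps_X ^ ((a + b) * n + a) * ?t (int k - int n')))"
    by (simp only: distrib_left mult_1_right sum_distrib_right) (simp add: ac_simps qbinom_eq_0)
  also have "(\<Sum>k\<le>?N. qbinom ?Q ?N k * (fps_const \<epsilon> * fps_X ^ ((a + b) * n + a) * ?t (int k - int n'))) =
      (\<Sum>k\<le>?N. ?Q ^ (?N - k) * qbinom ?Q ?N k * ?t (int (Suc k) - int n'))"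
    by (rule sum.cong[OF refl], subst step) (simp_all only: ac_simps atMost_iff)
  also have "(\<Sum>k\<le>Suc ?N. qbinom ?Q ?N k * ?t (int k - int n')) + \<dots> =
     ?t (- int n') + (\<Sum>k\<le>?N. (qbinom ?Q ?N (Suc k) + ?Q ^ (?N - k) * qbinom ?Q ?N k) * ?t (int (Suc k) - int n'))"
    by (subst sum.atMost_Suc_shift) (simp add: algebra_simps sum.distrib)
  also have "\<dots> = (\<Sum>k\<le>Suc ?N. qbinom ?Q (Suc ?N) k * ?t (int k - int n'))"
    unfolding qbinom.simps(3)[symmetric] by (subst sum.atMost_Suc_shift) simp
  finally show ?case by simp
qed

text \<open>Linear growth of the exponents suffices both for finite fibres and for the error
  estimate in the triple product.\<close>

lemma theta_exp_ge: "int (theta_exp a b j) \<ge> int (a + b) * (\<bar>j\<bar> - 1)"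
proof -
  define i where "i = \<bar>j\<bar>"
  have i: "i * (i - 1) div 2 \<ge> i - 1" "i \<ge> 0"
  proof -
    show "i \<ge> 0" by (simp add: i_def)
    have "(i - 1) * (i - 2) \<ge> 0"
      by (cases "i \<ge> 2") (use \<open>i \<ge> 0\<close> in \<open>auto intro: mult_nonpos_nonpos mult_nonneg_nonneg\<close>)
    moreover have "2 * (i * (i - 1) div 2) = i * (i - 1)" by simp
    ultimately show "i * (i - 1) div 2 \<ge> i - 1" by (simp add: algebra_simps)
  qed
  show ?thesis
  proof (cases "j \<ge> 0")
    case True
    then have "int (a + b) * (j * (j - 1) div 2) \<ge> int (a + b) * (\<bar>j\<bar> - 1)" "int a * j \<ge> 0"
      using i by (auto simp: i_def intro!: mult_left_mono simp del: of_nat_add)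
    then show ?thesis unfolding int_theta_exp by linarith
  next
    case False
    then have "j * (j - 1) = i * (i - 1) + 2 * i" by (simp add: i_def algebra_simps)
    then have e: "j * (j - 1) div 2 = i * (i - 1) div 2 + i" by simp
    have "int (a + b) * (i * (i - 1) div 2 + i) \<ge> int (a + b) * (i - 1 + i)"
      using i by (intro mult_left_mono) auto
    moreover have "int (a + b) * (i - 1 + i) + int a * j = int (a + b) * (i - 1) + int b * i"
      using False by (simp add: i_def algebra_simps)
    moreover have "int b * i \<ge> 0" using i by simp
    ultimately show ?thesis unfolding int_theta_exp e i_def by linarith
  qed
qed

text \<open>The products of lengths k, N - k and N all agree with the infinite product E up to order
  r, so the binomial is close to E / (E * E). The estimate is made for
  \<open>E * (E * b - 1)\<close>, and the unit E is cancelled afterwards.\<close>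

lemma qbinom_approx:
  assumes "r \<le> k" "r \<le> N - k" "k \<le> N" "M > 0"
  shows "fps_X ^ r dvd euler M * qbinom (fps_X ^ M) N k - 1"
proof -
  let ?p = "\<lambda>n. \<Prod>m<n. 1 - (fps_X ^ M :: complex fps) ^ Suc m"
  let ?E = "euler M" and ?b = "qbinom (fps_X ^ M) N k :: complex fps"
  have ap: "fps_X ^ r dvd ?p n - ?E" if "r \<le> n" for n
    using euler_approx[OF assms(4)] that unfolding fps_approx_def power_mult[symmetric]
    by (meson dvd_trans le_imp_power_dvd)
  have "?b * (?p k * ?p (N - k)) = ?p N" by (rule qbinom_mult) fact
  then have "?E * (?E * ?b - 1) = (?p N - ?E) - ?b * (?p k * (?p (N - k) - ?E) + (?p k - ?E) * ?E)"
    by (simp add: algebra_simps)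
  also have "fps_X ^ r dvd \<dots>"
    using assms(1-3) by (intro dvd_diff ap dvd_mult[OF dvd_add[OF dvd_mult[OF ap] dvd_mult2[OF ap]]]) simp_all
  finally have "fps_X ^ r dvd inverse ?E * (?E * (?E * ?b - 1))" by (rule dvd_mult)
  moreover have "inverse ?E * ?E = 1" using assms(4) by (simp add: inverse_mult_eq_1)
  ultimately show ?thesis by (simp add: mult.assoc[symmetric])
qed

section \<open>Generating series of weighted index sets\<close>

definition wt_series :: "'i set \<Rightarrow> ('i \<Rightarrow> nat) \<Rightarrow> ('i \<Rightarrow> complex) \<Rightarrow> complex fps" where
  "wt_series S N w = Abs_fps (\<lambda>d. \<Sum>s | s \<in> S \<and> N s = d. w s)"

text \<open>Without finite fibres the coefficients of \<open>wt_series\<close> would be meaningless,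
  since a sum over an infinite set is 0 by convention.\<close>

definition fin_fibres :: "'i set \<Rightarrow> ('i \<Rightarrow> nat) \<Rightarrow> bool" where
  "fin_fibres S N \<longleftrightarrow> (\<forall>d. finite {s. s \<in> S \<and> N s = d})"

lemma wt_series_Union:
  assumes "finite I" "fin_fibres (\<Union>i\<in>I. S i) N" "disjoint_family_on S I"
  shows "wt_series (\<Union>i\<in>I. S i) N w = (\<Sum>i\<in>I. wt_series (S i) N w)"
proof (rule fps_ext)
  fix d
  have eq: "{s. s \<in> (\<Union>i\<in>I. S i) \<and> N s = d} = (\<Union>i\<in>I. {s. s \<in> S i \<and> N s = d})" by auto
  have fin: "finite {s. s \<in> S i \<and> N s = d}" if "i \<in> I" for i
  proof (rule finite_subset)
    show "finite {s. s \<in> (\<Union>i\<in>I. S i) \<and> N s = d}" using assms(2) unfolding fin_fibres_def by blast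
    show "{s. s \<in> S i \<and> N s = d} \<subseteq> {s. s \<in> (\<Union>i\<in>I. S i) \<and> N s = d}" using that by blast
  qed
  have "(\<Sum>s\<in>(\<Union>i\<in>I. {s. s \<in> S i \<and> N s = d}). w s) = (\<Sum>i\<in>I. \<Sum>s | s \<in> S i \<and> N s = d. w s)"
  proof (rule sum.UNION_disjoint)
    show "\<forall>i\<in>I. \<forall>j\<in>I. i \<noteq> j \<longrightarrow> {s. s \<in> S i \<and> N s = d} \<inter> {s. s \<in> S j \<and> N s = d} = {}"
      using assms(3) unfolding disjoint_family_on_def by blast
  qed (use assms(1) fin in auto)
  then show "fps_nth (wt_series (\<Union>i\<in>I. S i) N w) d = fps_nth (\<Sum>i\<in>I. wt_series (S i) N w) d"
    unfolding wt_series_def fps_sum_nth fps_nth_Abs_fps eq .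
qed

lemma wt_series_reindex:
  assumes "inj_on f S"
  shows "wt_series (f ` S) N w = wt_series S (\<lambda>s. N (f s)) (\<lambda>s. w (f s))"
proof -
  have "(\<Sum>s | s \<in> f ` S \<and> N s = d. w s) = (\<Sum>s | s \<in> S \<and> N (f s) = d. w (f s))" for d
    by (rule sum.reindex_cong[of f]) (use assms in \<open>auto simp: inj_on_def\<close>)
  then show ?thesis by (simp add: wt_series_def)
qed

lemma wt_series_shift: "wt_series S (\<lambda>s. N s + c) w = fps_X ^ c * wt_series S N w"
proof (rule fps_ext)
  fix d
  have "{s. s \<in> S \<and> N s + c = d} = (if d < c then {} else {s. s \<in> S \<and> N s = d - c})" by auto
  then show "fps_nth (wt_series S (\<lambda>s. N s + c) w) d = fps_nth (fps_X ^ c * wt_series S N w) d"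
    by (simp add: wt_series_def fps_X_power_mult_nth)
qed

lemma wt_series_scale: "wt_series S N (\<lambda>s. c * w s) = fps_const c * wt_series S N w"
  by (rule fps_ext) (simp add: wt_series_def sum_distrib_left)

lemma wt_series_mult:
  assumes "fin_fibres S N" "fin_fibres S' N'"
  shows "wt_series S N w * wt_series S' N' w' =
           wt_series (S \<times> S') (\<lambda>p. N (fst p) + N' (snd p)) (\<lambda>p. w (fst p) * w' (snd p))"
proof (rule fps_ext)
  fix d
  have fin: "finite {s. s \<in> S \<and> N s = i}" "finite {s. s \<in> S' \<and> N' s = i}" for i
    using assms by (auto simp: fin_fibres_def)
  have "fps_nth (wt_series S N w * wt_series S' N' w') d =
     (\<Sum>i=0..d. \<Sum>p\<in>{s. s \<in> S \<and> N s = i} \<times> {s. s \<in> S' \<and> N' s = d - i}. w (fst p) * w' (snd p))"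
    by (simp add: fps_mult_nth wt_series_def sum_product sum.cartesian_product case_prod_beta)
  also have "\<dots> = (\<Sum>p\<in>(\<Union>i\<in>{0..d}. {s. s \<in> S \<and> N s = i} \<times> {s. s \<in> S' \<and> N' s = d - i}). w (fst p) * w' (snd p))"
    by (rule sum.UNION_disjoint[symmetric]) (use fin in auto)
  also have "(\<Union>i\<in>{0..d}. {s. s \<in> S \<and> N s = i} \<times> {s. s \<in> S' \<and> N' s = d - i}) =
       {p. p \<in> S \<times> S' \<and> N (fst p) + N' (snd p) = d}"
    by auto
  finally show "fps_nth (wt_series S N w * wt_series S' N' w') d =
     fps_nth (wt_series (S \<times> S') (\<lambda>p. N (fst p) + N' (snd p)) (\<lambda>p. w (fst p) * w' (snd p))) d"
    by (simp add: wt_series_def)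
qed

lemma fin_fibres_Times:
  assumes "fin_fibres S N" "fin_fibres S' N'"
  shows "fin_fibres (S \<times> S') (\<lambda>p. N (fst p) + N' (snd p))"
  unfolding fin_fibres_def
proof
  fix d
  have "{p. p \<in> S \<times> S' \<and> N (fst p) + N' (snd p) = d} \<subseteq>
     (\<Union>i\<in>{0..d}. {s. s \<in> S \<and> N s = i} \<times> {s. s \<in> S' \<and> N' s = d - i})" by auto
  then show "finite {p. p \<in> S \<times> S' \<and> N (fst p) + N' (snd p) = d}"
    by (rule finite_subset) (use assms in \<open>auto simp: fin_fibres_def\<close>)
qed

definition theta :: "complex \<Rightarrow> nat \<Rightarrow> nat \<Rightarrow> complex fps" where
  "theta \<epsilon> a b = wt_series UNIV (theta_exp a b) (\<lambda>j. \<epsilon> powi j)"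

lemma theta_exp_fibre:
  assumes "a + b > 0"
  shows "{j. theta_exp a b j = d} \<subseteq> {- int (Suc d)..int (Suc d)}"
proof
  fix j assume "j \<in> {j. theta_exp a b j = d}"
  then have "int d \<ge> int (a + b) * (\<bar>j\<bar> - 1)" using theta_exp_ge[of a b j] by simp
  moreover have "int (a + b) * (\<bar>j\<bar> - 1) \<ge> 1 * (\<bar>j\<bar> - 1)" if "\<bar>j\<bar> \<ge> 1"
    using that assms by (intro mult_right_mono) auto
  ultimately have "\<bar>j\<bar> \<le> int (Suc d)" by force
  then show "j \<in> {- int (Suc d)..int (Suc d)}" by auto
qed

lemma theta_fin_fibres: "a + b > 0 \<Longrightarrow> fin_fibres UNIV (theta_exp a b)"
  unfolding fin_fibres_def using finite_subset[OF theta_exp_fibre finite_atLeastAtMost_int] by simp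

theorem jacobi_triple_product:
  assumes "\<epsilon> * \<epsilon> = 1" "a + b > 0"
  shows "fps_approx (\<lambda>n. euler (a + b) *
           ((\<Prod>k<Suc n. 1 + fps_const \<epsilon> * fps_X ^ ((a + b) * k + a)) *
            (\<Prod>k<Suc n. 1 + fps_const \<epsilon> * fps_X ^ ((a + b) * k + b)))) (theta \<epsilon> a b)"
  unfolding fps_approx_def
proof
  fix n
  let ?N = "Suc n + Suc n"
  let ?b = "qbinom (fps_X ^ (a + b)) ?N :: nat \<Rightarrow> complex fps"
  let ?t = "\<lambda>k. theta_term \<epsilon> a b (int k - int (Suc n))"
  have "fps_X ^ n dvd (euler (a + b) * ?b k - 1) * ?t k" if k: "k \<le> ?N" for k
  proof -
    define j where "j = int k - int (Suc n)"
    \<comment> \<open>The binomial is accurate only to order n + 1 - |j|, which is poor near the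
      ends of the sum; there the theta term itself supplies the missing order |j| - 1.\<close>
    define r where "r = nat (int (Suc n) - \<bar>j\<bar>)"
    have r: "r \<le> k" "r \<le> ?N - k" "int r = int (Suc n) - \<bar>j\<bar>" using k by (auto simp: r_def j_def)
    have "int (theta_exp a b j) \<ge> \<bar>j\<bar> - 1"
      using theta_exp_ge[of a b j] mult_right_mono[of 1 "int (a + b)" "\<bar>j\<bar> - 1"] assms(2) by (cases "j = 0") force+
    then have "n \<le> r + theta_exp a b j" using r(3) by linarith
    moreover have "fps_X ^ r * fps_X ^ theta_exp a b j dvd (euler (a + b) * ?b k - 1) * ?t k"
      by (rule mult_dvd_mono[OF qbinom_approx]) (use r k assms in \<open>auto simp: theta_term_def j_def\<close>)
    ultimately show ?thesis
      unfolding power_add[symmetric] by (meson dvd_trans le_imp_power_dvd)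
  qed
  then have "fps_X ^ n dvd (\<Sum>k\<le>?N. (euler (a + b) * ?b k - 1) * ?t k)" by (intro dvd_sum) auto
  moreover have "fps_X ^ n dvd (\<Sum>k\<le>?N. ?t k) - theta \<epsilon> a b"
    unfolding fps_X_power_dvd_iff
  proof (intro allI impI)
    fix d assume d: "d < n"
    have "(\<Sum>k\<le>?N. fps_nth (?t k) d) = (\<Sum>j\<in>{- int (Suc n)..int (Suc n)}. fps_nth (theta_term \<epsilon> a b j) d)"
      by (rule sum.reindex_bij_witness[of _ "\<lambda>j. nat (j + int (Suc n))" "\<lambda>k. int k - int (Suc n)"]) auto
    also have "\<dots> = (\<Sum>j\<in>{- int (Suc n)..int (Suc n)}. if theta_exp a b j = d then \<epsilon> powi j else 0)"
      by (rule sum.cong) (auto simp: theta_term_def)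
    also have "\<dots> = (\<Sum>j\<in>{j\<in>{- int (Suc n)..int (Suc n)}. theta_exp a b j = d}. \<epsilon> powi j)"
      by (rule sum.inter_filter[symmetric]) simp
    also have "{j\<in>{- int (Suc n)..int (Suc n)}. theta_exp a b j = d} = {j. theta_exp a b j = d}"
      using theta_exp_fibre[OF assms(2), of d] d by fastforce
    finally show "fps_nth ((\<Sum>k\<le>?N. ?t k) - theta \<epsilon> a b) d = 0"
      by (simp add: theta_def wt_series_def fps_sum_nth)
  qed
  ultimately have "fps_X ^ n dvd (\<Sum>k\<le>?N. (euler (a + b) * ?b k - 1) * ?t k) + ((\<Sum>k\<le>?N. ?t k) - theta \<epsilon> a b)"
    by (rule dvd_add)
  also have "\<dots> = euler (a + b) * (\<Sum>k\<le>?N. ?b k * ?t k) - theta \<epsilon> a b"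
    by (simp only: left_diff_distrib sum_subtractf sum_distrib_left mult.assoc) simp
  finally show "fps_X ^ n dvd euler (a + b) *
           ((\<Prod>k<Suc n. 1 + fps_const \<epsilon> * fps_X ^ ((a + b) * k + a)) *
            (\<Prod>k<Suc n. 1 + fps_const \<epsilon> * fps_X ^ ((a + b) * k + b))) - theta \<epsilon> a b"
    unfolding finite_triple_product[OF assms(1)] .
qed

section \<open>Theta functions and their dissections modulo 5\<close>

definition euler_part :: "nat \<Rightarrow> nat \<Rightarrow> complex fps" where
  "euler_part k n = (\<Prod>m<n. 1 - fps_X ^ (k * Suc m))"

lemma euler_part_approx: "k > 0 \<Longrightarrow> (\<And>n. n \<le> r n) \<Longrightarrow> fps_approx (\<lambda>n. euler_part k (r n)) (euler k)"
  unfolding euler_part_def by (rule fps_approx_subseq[OF euler_approx])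

lemma euler_part_0 [simp]: "euler_part k 0 = 1"
  and euler_part_Suc: "euler_part k (Suc n) = euler_part k n * (1 - fps_X ^ (k * Suc n))"
  by (simp_all add: euler_part_def)

lemma euler_nonzero [simp]: "k > 0 \<Longrightarrow> euler k \<noteq> 0"
  using euler_nth_0[of k] by (metis fps_zero_nth zero_neq_one)

lemma one_plus_fps_const_minus [simp]: "1 + fps_const (- 1) * f = 1 - (f :: complex fps)"
  by (simp flip: fps_const_neg)

text \<open>f(1, q^c) = 2 psi(q^c); the 2 is the factor 1 + X^0 with k = 0 of the triple
  product.\<close>

lemma theta_psi:
  assumes "c > 0"
  shows "theta 1 0 c * euler c = 2 * euler (2 * c) ^ 2"
proof -
  define r where "r n = (\<Prod>k<n. 1 + fps_X ^ (c * Suc k) :: complex fps)" for n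
  have r: "r n * euler_part c n = euler_part (2 * c) n" for n
  proof (induction n)
    case (Suc n)
    define u where "u = (fps_X :: complex fps) ^ (c * Suc n)"
    have "fps_X ^ (2 * c * Suc n) = u\<^sup>2" unfolding u_def power_mult[symmetric] by (simp add: ac_simps)
    then have "r (Suc n) * euler_part c (Suc n) = r n * euler_part c n * (1 - fps_X ^ (2 * c * Suc n))"
      unfolding euler_part_Suc u_def[symmetric] by (simp add: r_def u_def power2_eq_square algebra_simps del: mult_Suc_right)
    then show ?case using Suc by (simp add: euler_part_Suc)
  qed (simp add: r_def)
  have "fps_approx (\<lambda>n. euler c * ((\<Prod>k<Suc n. 1 + fps_X ^ (c * k)) * (\<Prod>k<Suc n. 1 + fps_X ^ (c * k + c)))
      * (euler_part c n * euler_part c (Suc n)))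
      (theta 1 0 c * (euler c * euler c))"
    using jacobi_triple_product[of 1 0 c] assms
    by (intro fps_approx_mult euler_part_approx) simp_all
  moreover have "euler c * ((\<Prod>k<Suc n. 1 + fps_X ^ (c * k)) * (\<Prod>k<Suc n. 1 + fps_X ^ (c * k + c)))
      * (euler_part c n * euler_part c (Suc n)) = euler c * 2 * (euler_part (2 * c) n * euler_part (2 * c) (Suc n))" for n
  proof -
    have "(\<Prod>k<Suc n. 1 + fps_X ^ (c * k)) = 2 * r n"
      unfolding r_def prod.lessThan_Suc_shift by simp
    moreover have "(\<Prod>k<Suc n. 1 + fps_X ^ (c * k + c)) = r (Suc n)"
      unfolding r_def by (simp add: add.commute)
    ultimately show ?thesis unfolding r[symmetric] by (simp only: ac_simps)
  qed
  ultimately have "fps_approx (\<lambda>n. euler c * 2 * (euler_part (2 * c) n * euler_part (2 * c) (Suc n))) (theta 1 0 c * (euler c * euler c))" by (rule fps_approx_cong)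
  moreover have "fps_approx (\<lambda>n. euler c * 2 * (euler_part (2 * c) n * euler_part (2 * c) (Suc n))) (euler c * 2 * (euler (2 * c) * euler (2 * c)))"
    using assms by (intro fps_approx_mult fps_approx_const euler_part_approx) simp_all
  ultimately have "theta 1 0 c * (euler c * euler c) = euler c * 2 * (euler (2 * c) * euler (2 * c))"
    by (rule fps_approx_unique)
  then have "euler c * (theta 1 0 c * euler c) = euler c * (2 * euler (2 * c) ^ 2)"
    by (simp add: power2_eq_square ac_simps)
  then show ?thesis using assms by simp
qed

lemma theta_phi:
  assumes "c > 0"
  shows "theta (-1) c c * euler (2 * c) = euler c ^ 2"
proof -
  define o1 where "o1 n = (\<Prod>k<n. 1 - fps_X ^ ((c + c) * k + c) :: complex fps)" for n
  have o1: "o1 n * euler_part (2 * c) n = euler_part c (2 * n)" for n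
  proof (induction n)
    case (Suc n)
    have "2 * Suc n = Suc (Suc (2 * n))" by simp
    moreover have "(c + c) * n + c = c * Suc (2 * n)" "2 * c * Suc n = c * Suc (Suc (2 * n))" by (simp_all add: algebra_simps)
    ultimately have "o1 (Suc n) * euler_part (2 * c) (Suc n) =
      o1 n * euler_part (2 * c) n * (1 - fps_X ^ (c * Suc (2 * n))) * (1 - fps_X ^ (c * Suc (Suc (2 * n))))"
      "euler_part c (2 * Suc n) = euler_part c (2 * n) * (1 - fps_X ^ (c * Suc (2 * n))) * (1 - fps_X ^ (c * Suc (Suc (2 * n))))"
      unfolding o1_def by (simp_all only: prod.lessThan_Suc euler_part_Suc ac_simps)
    then show ?case using Suc by simp
  qed (simp add: o1_def)
  have "fps_approx (\<lambda>n. euler (2 * c) * (o1 (Suc n) * o1 (Suc n)) * (euler_part (2 * c) (Suc n) * euler_part (2 * c) (Suc n)))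
      (theta (-1) c c * (euler (2 * c) * euler (2 * c)))"
    using jacobi_triple_product[of "-1" c c] assms unfolding o1_def
    by (intro fps_approx_mult euler_part_approx) (simp_all add: mult_2)
  moreover have "euler (2 * c) * (o1 (Suc n) * o1 (Suc n)) * (euler_part (2 * c) (Suc n) * euler_part (2 * c) (Suc n))
     = euler (2 * c) * (euler_part c (2 * Suc n) * euler_part c (2 * Suc n))" for n
    unfolding o1[symmetric] by (simp only: ac_simps)
  ultimately have "fps_approx (\<lambda>n. euler (2 * c) * (euler_part c (2 * Suc n) * euler_part c (2 * Suc n)))
      (theta (-1) c c * (euler (2 * c) * euler (2 * c)))" by (rule fps_approx_cong)
  moreover have "fps_approx (\<lambda>n. euler (2 * c) * (euler_part c (2 * Suc n) * euler_part c (2 * Suc n)))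
      (euler (2 * c) * (euler c * euler c))"
    using assms by (intro fps_approx_mult fps_approx_const euler_part_approx) simp_all
  ultimately have "theta (-1) c c * (euler (2 * c) * euler (2 * c)) = euler (2 * c) * (euler c * euler c)"
    by (rule fps_approx_unique)
  then have "euler (2 * c) * (theta (-1) c c * euler (2 * c)) = euler (2 * c) * euler c ^ 2"
    by (simp add: power2_eq_square ac_simps)
  then show ?thesis using assms by simp
qed

text \<open>Neither theta function is an eta quotient by itself. Together they run over all residues
  prime to 5, and (1 + u) (1 - u) = 1 - u^2 turns the product of 1 + q^k over these k into Euler
  products.\<close>

lemma theta_14_23:
  "theta 1 1 4 * theta 1 2 3 * (euler 10 * euler 1) = euler 5 ^ 3 * euler 2"
proof -
  define r where "r a n = (\<Prod>k<n. 1 + fps_X ^ (5 * k + a) :: complex fps)" for a n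
  have r: "r 1 n * r 4 n * (r 2 n * r 3 n) * (euler_part 10 n * euler_part 1 (5 * n)) = euler_part 2 (5 * n) * euler_part 5 n" for n
  proof (induction n)
    case (Suc n)
    have 5: "5 * Suc n = Suc (Suc (Suc (Suc (Suc (5 * n)))))" by simp
    define u where "u i = (fps_X :: complex fps) ^ (5 * n + i)" for i
    have x: "fps_X ^ (1 * Suc (5 * n)) = u 1"
      "fps_X ^ (1 * Suc (Suc (5 * n))) = u 2"
      "fps_X ^ (1 * Suc (Suc (Suc (5 * n)))) = u 3"
      "fps_X ^ (1 * Suc (Suc (Suc (Suc (5 * n))))) = u 4"
      "fps_X ^ (1 * Suc (Suc (Suc (Suc (Suc (5 * n)))))) = u 5"
      "fps_X ^ (2 * Suc (5 * n)) = u 1 * u 1"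
      "fps_X ^ (2 * Suc (Suc (5 * n))) = u 2 * u 2"
      "fps_X ^ (2 * Suc (Suc (Suc (5 * n)))) = u 3 * u 3"
      "fps_X ^ (2 * Suc (Suc (Suc (Suc (5 * n))))) = u 4 * u 4"
      "fps_X ^ (2 * Suc (Suc (Suc (Suc (Suc (5 * n)))))) = u 5 * u 5"
      "fps_X ^ (5 * Suc n) = u 5"
      "fps_X ^ (10 * Suc n) = u 5 * u 5"
      unfolding u_def power_add[symmetric] by (rule arg_cong[where f = "\<lambda>i. fps_X ^ i"], simp)+
    have e: "euler_part 1 (5 * Suc n) = euler_part 1 (5 * n) * (1 - u 1) * (1 - u 2) * (1 - u 3) * (1 - u 4) * (1 - u 5)"
      "euler_part 2 (5 * Suc n) = euler_part 2 (5 * n) * (1 - u 1 * u 1) * (1 - u 2 * u 2) * (1 - u 3 * u 3) * (1 - u 4 * u 4) * (1 - u 5 * u 5)"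
      by (simp_all only: 5 euler_part_Suc x)
    have e': "euler_part 5 (Suc n) = euler_part 5 n * (1 - u 5)"
      "euler_part 10 (Suc n) = euler_part 10 n * (1 - u 5 * u 5)"
      by (simp_all only: euler_part_Suc x)
    have s: "r a (Suc n) = r a n * (1 + u a)" for a by (simp add: r_def u_def)
    have "r 1 (Suc n) * r 4 (Suc n) * (r 2 (Suc n) * r 3 (Suc n)) * (euler_part 10 (Suc n) * euler_part 1 (5 * Suc n)) =
      r 1 n * r 4 n * (r 2 n * r 3 n) * (euler_part 10 n * euler_part 1 (5 * n)) *
      (((1 + u 1) * (1 - u 1)) * ((1 + u 2) * (1 - u 2)) * ((1 + u 3) * (1 - u 3)) * ((1 + u 4) * (1 - u 4)) * (1 - u 5) * (1 - u 5 * u 5))"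
      unfolding e e' s by (simp only: ac_simps)
    also have "\<dots> = r 1 n * r 4 n * (r 2 n * r 3 n) * (euler_part 10 n * euler_part 1 (5 * n)) *
      ((1 - u 1 * u 1) * (1 - u 2 * u 2) * (1 - u 3 * u 3) * (1 - u 4 * u 4) * (1 - u 5) * (1 - u 5 * u 5))"
    proof -
      have "(1 + v) * (1 - v) = 1 - v * v" for v :: "complex fps" by (simp add: algebra_simps)
      then show ?thesis by (simp only:)
    qed
    also note Suc
    also have "euler_part 2 (5 * n) * euler_part 5 n * ((1 - u 1 * u 1) * (1 - u 2 * u 2) * (1 - u 3 * u 3) * (1 - u 4 * u 4) * (1 - u 5) * (1 - u 5 * u 5))
       = euler_part 2 (5 * Suc n) * euler_part 5 (Suc n)"
      unfolding e e' by (simp only: ac_simps)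
    finally show ?case .
  qed (simp add: r_def)
  have "fps_approx (\<lambda>n. (euler 5 * (r 1 (Suc n) * r 4 (Suc n))) * (euler 5 * (r 2 (Suc n) * r 3 (Suc n))) *
      (euler_part 10 (Suc n) * euler_part 1 (5 * Suc n))) (theta 1 1 4 * theta 1 2 3 * (euler 10 * euler 1))"
    using jacobi_triple_product[of 1 1 4] jacobi_triple_product[of 1 2 3] unfolding r_def
    by (intro fps_approx_mult euler_part_approx) simp_all
  moreover have "(euler 5 * (r 1 (Suc n) * r 4 (Suc n))) * (euler 5 * (r 2 (Suc n) * r 3 (Suc n))) *
      (euler_part 10 (Suc n) * euler_part 1 (5 * Suc n)) = euler 5 * euler 5 * (euler_part 2 (5 * Suc n) * euler_part 5 (Suc n))" for n
    unfolding r[symmetric] by (simp only: ac_simps)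
  ultimately have "fps_approx (\<lambda>n. euler 5 * euler 5 * (euler_part 2 (5 * Suc n) * euler_part 5 (Suc n)))
     (theta 1 1 4 * theta 1 2 3 * (euler 10 * euler 1))" by (rule fps_approx_cong)
  moreover have "fps_approx (\<lambda>n. euler 5 * euler 5 * (euler_part 2 (5 * Suc n) * euler_part 5 (Suc n)))
     (euler 5 * euler 5 * (euler 2 * euler 5))"
    by (intro fps_approx_mult fps_approx_const euler_part_approx) simp_all
  ultimately have "theta 1 1 4 * theta 1 2 3 * (euler 10 * euler 1) = euler 5 * euler 5 * (euler 2 * euler 5)"
    by (rule fps_approx_unique)
  then show ?thesis by (simp add: power3_eq_cube ac_simps)
qed

text \<open>The residues 1, 3, 7, 9 are the units modulo 10; removing the multiples of 2 and of 5
  from all k and restoring those of 10 gives the Euler products.\<close>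

lemma theta_19_37:
  "theta (-1) 1 9 * theta (-1) 3 7 * (euler 5 * euler 2) = euler 10 ^ 3 * euler 1"
proof -
  define r where "r a n = (\<Prod>k<n. 1 - fps_X ^ (10 * k + a) :: complex fps)" for a n
  have r: "r 1 n * r 9 n * (r 3 n * r 7 n) * (euler_part 5 (2 * n) * euler_part 2 (5 * n)) = euler_part 1 (10 * n) * euler_part 10 n" for n
  proof (induction n)
    case (Suc n)
    have 10: "2 * Suc n = Suc (Suc (2 * n))" "5 * Suc n = Suc (Suc (Suc (Suc (Suc (5 * n)))))"
      "10 * Suc n = Suc (Suc (Suc (Suc (Suc (Suc (Suc (Suc (Suc (Suc (10 * n))))))))))" by simp_all
    define u where "u i = (fps_X :: complex fps) ^ (10 * n + i)" for i
    have x: "fps_X ^ (1 * Suc (10 * n)) = u 1"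
      "fps_X ^ (1 * Suc (Suc (10 * n))) = u 2"
      "fps_X ^ (1 * Suc (Suc (Suc (10 * n)))) = u 3"
      "fps_X ^ (1 * Suc (Suc (Suc (Suc (10 * n))))) = u 4"
      "fps_X ^ (1 * Suc (Suc (Suc (Suc (Suc (10 * n)))))) = u 5"
      "fps_X ^ (1 * Suc (Suc (Suc (Suc (Suc (Suc (10 * n))))))) = u 6"
      "fps_X ^ (1 * Suc (Suc (Suc (Suc (Suc (Suc (Suc (10 * n)))))))) = u 7"
      "fps_X ^ (1 * Suc (Suc (Suc (Suc (Suc (Suc (Suc (Suc (10 * n))))))))) = u 8"
      "fps_X ^ (1 * Suc (Suc (Suc (Suc (Suc (Suc (Suc (Suc (Suc (10 * n)))))))))) = u 9"
      "fps_X ^ (1 * Suc (Suc (Suc (Suc (Suc (Suc (Suc (Suc (Suc (Suc (10 * n))))))))))) = u 10"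
      "fps_X ^ (2 * Suc (5 * n)) = u 2"
      "fps_X ^ (2 * Suc (Suc (5 * n))) = u 4"
      "fps_X ^ (2 * Suc (Suc (Suc (5 * n)))) = u 6"
      "fps_X ^ (2 * Suc (Suc (Suc (Suc (5 * n))))) = u 8"
      "fps_X ^ (2 * Suc (Suc (Suc (Suc (Suc (5 * n)))))) = u 10"
      "fps_X ^ (5 * Suc (2 * n)) = u 5"
      "fps_X ^ (5 * Suc (Suc (2 * n))) = u 10"
      "fps_X ^ (10 * Suc n) = u 10"
      unfolding u_def by (rule arg_cong[where f = "\<lambda>i. fps_X ^ i"], simp)+
    have e: "euler_part 1 (10 * Suc n) = euler_part 1 (10 * n) * (1 - u 1) * (1 - u 2) * (1 - u 3) * (1 - u 4) * (1 - u 5)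
         * (1 - u 6) * (1 - u 7) * (1 - u 8) * (1 - u 9) * (1 - u 10)"
      "euler_part 2 (5 * Suc n) = euler_part 2 (5 * n) * (1 - u 2) * (1 - u 4) * (1 - u 6) * (1 - u 8) * (1 - u 10)"
      "euler_part 5 (2 * Suc n) = euler_part 5 (2 * n) * (1 - u 5) * (1 - u 10)"
      by (simp_all only: 10 euler_part_Suc x)
    have e': "euler_part 10 (Suc n) = euler_part 10 n * (1 - u 10)"
      by (simp only: euler_part_Suc x)
    have s: "r a (Suc n) = r a n * (1 - u a)" for a by (simp add: r_def u_def)
    have "r 1 (Suc n) * r 9 (Suc n) * (r 3 (Suc n) * r 7 (Suc n)) * (euler_part 5 (2 * Suc n) * euler_part 2 (5 * Suc n)) =
      (r 1 n * r 9 n * (r 3 n * r 7 n) * (euler_part 5 (2 * n) * euler_part 2 (5 * n))) *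
      ((1 - u 1) * (1 - u 2) * (1 - u 3) * (1 - u 4) * (1 - u 5)
         * (1 - u 6) * (1 - u 7) * (1 - u 8) * (1 - u 9) * (1 - u 10) * (1 - u 10))"
      unfolding e e' s by (simp only: ac_simps)
    also note Suc
    finally show ?case unfolding e e' by (simp only: ac_simps)
  qed (simp add: r_def)
  have "fps_approx (\<lambda>n. (euler 10 * (r 1 (Suc n) * r 9 (Suc n))) * (euler 10 * (r 3 (Suc n) * r 7 (Suc n))) *
      (euler_part 5 (2 * Suc n) * euler_part 2 (5 * Suc n))) (theta (-1) 1 9 * theta (-1) 3 7 * (euler 5 * euler 2))"
    using jacobi_triple_product[of "-1" 1 9] jacobi_triple_product[of "-1" 3 7] unfolding r_def
    by (intro fps_approx_mult euler_part_approx) simp_all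
  moreover have "(euler 10 * (r 1 (Suc n) * r 9 (Suc n))) * (euler 10 * (r 3 (Suc n) * r 7 (Suc n))) *
      (euler_part 5 (2 * Suc n) * euler_part 2 (5 * Suc n)) = euler 10 * euler 10 * (euler_part 1 (10 * Suc n) * euler_part 10 (Suc n))" for n
    unfolding r[symmetric] by (simp only: ac_simps)
  ultimately have "fps_approx (\<lambda>n. euler 10 * euler 10 * (euler_part 1 (10 * Suc n) * euler_part 10 (Suc n)))
     (theta (-1) 1 9 * theta (-1) 3 7 * (euler 5 * euler 2))" by (rule fps_approx_cong)
  moreover have "fps_approx (\<lambda>n. euler 10 * euler 10 * (euler_part 1 (10 * Suc n) * euler_part 10 (Suc n)))
     (euler 10 * euler 10 * (euler 1 * euler 10))"
    by (intro fps_approx_mult fps_approx_const euler_part_approx) simp_all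
  ultimately have "theta (-1) 1 9 * theta (-1) 3 7 * (euler 5 * euler 2) = euler 10 * euler 10 * (euler 1 * euler 10)"
    by (rule fps_approx_unique)
  then show ?thesis by (simp add: power3_eq_cube ac_simps)
qed

text \<open>A map of order four permuting four of the five residue classes of \<open>f\<close> cyclically, here
  multiplication by \<open>\<i>\<close> on Gaussian integers modulo \<open>2 \<plusminus> \<i>\<close>.\<close>

lemma wt_series_five_classes:
  fixes f :: "int \<times> int \<Rightarrow> int" and R :: "int \<times> int \<Rightarrow> int \<times> int"
  assumes "fin_fibres UNIV N" "bij R" "\<And>p. N (R p) = N p" "\<And>p. w (R p) = w p"
    and cyc: "distinct [c0, c1, c2, c3, c4]" "{c0, c1, c2, c3, c4} = {0..4}"
    and R: "\<And>p. f (R p) mod 5 = c2 \<longleftrightarrow> f p mod 5 = c1" "\<And>p. f (R p) mod 5 = c3 \<longleftrightarrow> f p mod 5 = c2"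
      "\<And>p. f (R p) mod 5 = c4 \<longleftrightarrow> f p mod 5 = c3"
  shows "wt_series UNIV N w = wt_series {p. f p mod 5 = c0} N w + 4 * wt_series {p. f p mod 5 = c1} N w"
proof -
  let ?S = "\<lambda>c. {p. f p mod 5 = c}"
  let ?W = "\<lambda>c. wt_series (?S c) N w"
  have "f p mod 5 \<in> {c0, c1, c2, c3, c4}" for p unfolding cyc(2) by simp
  then have U: "UNIV = (\<Union>c\<in>{c0, c1, c2, c3, c4}. ?S c)" by blast
  have "wt_series UNIV N w = (\<Sum>c\<in>{c0, c1, c2, c3, c4}. ?W c)"
    using wt_series_Union[of "{c0, c1, c2, c3, c4}" ?S N w] assms(1) unfolding U[symmetric]
    by (simp add: disjoint_family_on_def) blast
  also have "\<dots> = ?W c0 + ?W c1 + ?W c2 + ?W c3 + ?W c4"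
    using cyc(1) by (simp add: ac_simps)
  finally have total: "wt_series UNIV N w = ?W c0 + ?W c1 + ?W c2 + ?W c3 + ?W c4" .
  have rot: "?W d = ?W c" if cd: "\<And>p. f (R p) mod 5 = d \<longleftrightarrow> f p mod 5 = c" for c d
  proof -
    have "R ` ?S c = ?S d"
    proof (intro set_eqI iffI)
      fix p assume "p \<in> R ` ?S c" then show "p \<in> ?S d" using cd by blast
    next
      fix p assume p: "p \<in> ?S d"
      obtain p' where p': "p = R p'" using \<open>bij R\<close> by (metis bij_pointE)
      then have "p' \<in> ?S c" using p cd by blast
      then show "p \<in> R ` ?S c" using p' by blast
    qed
    moreover have "inj_on R (?S c)" using \<open>bij R\<close> bij_is_inj inj_on_subset by blast
    then have "wt_series (R ` ?S c) N w = ?W c"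
      by (simp only: wt_series_reindex assms(3,4))
    ultimately show ?thesis by simp
  qed
  have "?W c2 = ?W c1" "?W c3 = ?W c2" "?W c4 = ?W c3" by (rule rot, rule R)+
  then show ?thesis using total by simp
qed

lemma double_theta_exp: "2 * int (theta_exp a b j) = int (a + b) * (j * (j - 1)) + 2 * (int a * j)"
proof -
  have "2 * (j * (j - 1) div 2) = j * (j - 1)" by simp
  moreover have "2 * int (theta_exp a b j) = int (a + b) * (2 * (j * (j - 1) div 2)) + 2 * (int a * j)"
    unfolding int_theta_exp by (simp only: distrib_left ac_simps)
  ultimately show ?thesis by (simp only:)
qed

lemma theta_mult_theta:
  assumes "a + b > 0" "a' + b' > 0"
  shows "theta \<epsilon> a b * theta \<epsilon>' a' b' = wt_series UNIV (\<lambda>p. theta_exp a b (fst p) + theta_exp a' b' (snd p))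
           (\<lambda>p. \<epsilon> powi fst p * \<epsilon>' powi snd p)"
  unfolding theta_def using wt_series_mult[OF theta_fin_fibres[OF assms(1)] theta_fin_fibres[OF assms(2)]] by simp

theorem psi_square_dissection:
  "theta 1 0 1 ^ 2 = fps_X * theta 1 0 5 ^ 2 + 4 * (theta 1 1 4 * theta 1 2 3)"
proof -
  define N :: "int \<times> int \<Rightarrow> nat" where "N p = theta_exp 0 1 (fst p) + theta_exp 0 1 (snd p)" for p
  have N: "2 * int (N (a, b)) = a * (a - 1) + b * (b - 1)" for a b
    unfolding N_def of_nat_add distrib_left double_theta_exp by simp
  let ?f = "\<lambda>p. 2 * fst p + snd p :: int"
  \<comment> \<open>The quarter turn about (1/2, 1/2), the centre of symmetry of N. It maps the
    residue of f to 3 f + 2 modulo 5, which fixes 4 and permutes 0, 2, 3, 1 cyclically.\<close>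
  let ?R = "\<lambda>p. (1 - snd p, fst p) :: int \<times> int"
  have "fin_fibres UNIV N"
    unfolding N_def using fin_fibres_Times[OF theta_fin_fibres theta_fin_fibres, of 0 1 0 1] by simp
  moreover have "bij ?R" by (rule bij_betw_byWitness[where f' = "\<lambda>p. (snd p, 1 - fst p)"]) auto
  moreover have "N (?R p) = N p" for p
  proof -
    have "2 * int (N (?R p)) = 2 * int (N (fst p, snd p))" unfolding N by (simp add: algebra_simps)
    then show ?thesis by simp
  qed
  moreover have "(2 * (1 - b) + a) mod 5 = 2 \<longleftrightarrow> (2 * a + b) mod 5 = 0" "(2 * (1 - b) + a) mod 5 = 3 \<longleftrightarrow> (2 * a + b) mod 5 = 2"
    "(2 * (1 - b) + a) mod 5 = 1 \<longleftrightarrow> (2 * a + b) mod 5 = 3" for a b :: int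
    by presburger+
  moreover have "distinct [4, 0, 2, 3, 1 :: int]" "{4, 0, 2, 3, 1} = {0..4 :: int}" by auto
  ultimately have *: "wt_series UNIV N (\<lambda>_. 1) =
      wt_series {p. ?f p mod 5 = 4} N (\<lambda>_. 1) + 4 * wt_series {p. ?f p mod 5 = 0} N (\<lambda>_. 1)"
    by (intro wt_series_five_classes[where R = ?R and ?c2.0 = 2 and ?c3.0 = 3 and ?c4.0 = 1])
      (simp_all only: fst_conv snd_conv)
  have "theta 1 0 1 ^ 2 = wt_series UNIV N (\<lambda>_. 1)"
    unfolding power2_eq_square by (subst theta_mult_theta) (simp_all add: N_def[abs_def])
  moreover have "wt_series {p. ?f p mod 5 = 4} N (\<lambda>_. 1) = fps_X * theta 1 0 5 ^ 2"
  proof -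
    \<comment> \<open>Multiplication of Gaussian integers by 2 + \<i>, translated by -\<i>; its
      image is the fixed class. The untranslated map below parametrises class 0 and separates N into
      two different theta exponents.\<close>
    let ?g = "\<lambda>p. (2 * fst p - snd p, 2 * snd p + fst p - 1) :: int \<times> int"
    have "?g ` UNIV = {p. ?f p mod 5 = 4}"
    proof (intro set_eqI iffI)
      fix p assume "p \<in> ?g ` UNIV" then show "p \<in> {p. ?f p mod 5 = 4}" by clarsimp presburger
    next
      fix p :: "int \<times> int" assume "p \<in> {p. ?f p mod 5 = 4}"
      then have "5 dvd ?f p + 1" unfolding mem_Collect_eq by presburger
      then obtain c where "?f p + 1 = 5 * c" by (auto elim: dvdE)
      then have "p = ?g (c, 2 * c - fst p)" by (cases p) simp
      then show "p \<in> ?g ` UNIV" by blast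
    qed
    moreover have "inj ?g" by (auto simp: inj_def)
    moreover have "N (?g p) = theta_exp 0 5 (fst p) + theta_exp 0 5 (snd p) + 1" for p
    proof -
      have "2 * int (N (?g p)) = 2 * int (theta_exp 0 5 (fst p) + theta_exp 0 5 (snd p) + 1)"
        unfolding N of_nat_add distrib_left double_theta_exp by (simp add: algebra_simps)
      then show ?thesis by simp
    qed
    ultimately have "wt_series {p. ?f p mod 5 = 4} N (\<lambda>_. 1) =
        wt_series UNIV (\<lambda>p. theta_exp 0 5 (fst p) + theta_exp 0 5 (snd p) + 1) (\<lambda>_. 1)"
      using wt_series_reindex[of ?g UNIV N "\<lambda>_. 1"] by simp
    then show ?thesis unfolding wt_series_shift power2_eq_square by (subst theta_mult_theta) simp_all
  qed
  moreover have "wt_series {p. ?f p mod 5 = 0} N (\<lambda>_. 1) = theta 1 1 4 * theta 1 2 3"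
  proof -
    let ?g = "\<lambda>p. (2 * fst p - snd p, 2 * snd p + fst p) :: int \<times> int"
    have "?g ` UNIV = {p. ?f p mod 5 = 0}"
    proof (intro set_eqI iffI)
      fix p assume "p \<in> ?g ` UNIV" then show "p \<in> {p. ?f p mod 5 = 0}" by clarsimp
    next
      fix p :: "int \<times> int" assume "p \<in> {p. ?f p mod 5 = 0}"
      then have "5 dvd ?f p" unfolding mem_Collect_eq by presburger
      then obtain c where "?f p = 5 * c" by (auto elim: dvdE)
      then have "p = ?g (c, 2 * c - fst p)" by (cases p) simp
      then show "p \<in> ?g ` UNIV" by blast
    qed
    moreover have "inj ?g" by (auto simp: inj_def)
    moreover have "N (?g p) = theta_exp 1 4 (fst p) + theta_exp 2 3 (snd p)" for p
    proof -
      have "2 * int (N (?g p)) = 2 * int (theta_exp 1 4 (fst p) + theta_exp 2 3 (snd p))"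
        unfolding N of_nat_add distrib_left double_theta_exp by (simp add: algebra_simps)
      then show ?thesis by simp
    qed
    ultimately have "wt_series {p. ?f p mod 5 = 0} N (\<lambda>_. 1) =
        wt_series UNIV (\<lambda>p. theta_exp 1 4 (fst p) + theta_exp 2 3 (snd p)) (\<lambda>_. 1)"
      using wt_series_reindex[of ?g UNIV N "\<lambda>_. 1"] by simp
    then show ?thesis by (subst theta_mult_theta) simp_all
  qed
  ultimately show ?thesis using * by simp
qed

theorem phi_square_dissection:
  "theta (-1) 1 1 ^ 2 = theta (-1) 5 5 ^ 2 - 4 * (fps_X * (theta (-1) 1 9 * theta (-1) 3 7))"
proof -
  define N :: "int \<times> int \<Rightarrow> nat" where "N p = theta_exp 1 1 (fst p) + theta_exp 1 1 (snd p)" for p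
  define w :: "int \<times> int \<Rightarrow> complex" where "w p = (-1) powi (fst p + snd p)" for p
  have N: "2 * int (N (a, b)) = 2 * (a * a) + 2 * (b * b)" for a b
    unfolding N_def of_nat_add distrib_left double_theta_exp by (simp add: algebra_simps)
  have w: "w p = (if even (fst p + snd p) then 1 else -1)" for p
    by (simp add: w_def power_int_minus_one_minus power_int_minus_left)
  let ?f = "\<lambda>p. fst p + 2 * snd p :: int"
  \<comment> \<open>Multiplication by \<i>. It doubles the residue of f modulo 5, so 0 is fixed and
    4, 3, 1, 2 form a cycle; the sign w depends on the parity of a + b and is preserved.\<close>
  let ?R = "\<lambda>p. (- snd p, fst p) :: int \<times> int"
  have "fin_fibres UNIV N"
    unfolding N_def using fin_fibres_Times[OF theta_fin_fibres theta_fin_fibres, of 1 1 1 1] by simp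
  moreover have "bij ?R" by (rule bij_betw_byWitness[where f' = "\<lambda>p. (snd p, - fst p)"]) auto
  moreover have "N (?R p) = N p" for p
  proof -
    have "2 * int (N (?R p)) = 2 * int (N (fst p, snd p))" unfolding N by (simp add: algebra_simps)
    then show ?thesis by simp
  qed
  moreover have "w (?R p) = w p" for p by (simp add: w)
  moreover have "(- b + 2 * a) mod 5 = 3 \<longleftrightarrow> (a + 2 * b) mod 5 = 4" "(- b + 2 * a) mod 5 = 1 \<longleftrightarrow> (a + 2 * b) mod 5 = 3"
    "(- b + 2 * a) mod 5 = 2 \<longleftrightarrow> (a + 2 * b) mod 5 = 1" for a b :: int
    by presburger+
  moreover have "distinct [0, 4, 3, 1, 2 :: int]" "{0, 4, 3, 1, 2} = {0..4 :: int}" by auto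
  ultimately have *: "wt_series UNIV N w =
      wt_series {p. ?f p mod 5 = 0} N w + 4 * wt_series {p. ?f p mod 5 = 4} N w"
    by (intro wt_series_five_classes[where R = ?R and ?c2.0 = 3 and ?c3.0 = 1 and ?c4.0 = 2])
      (simp_all only: fst_conv snd_conv)
  have th: "theta (-1) a b * theta (-1) a' b' =
      wt_series UNIV (\<lambda>p. theta_exp a b (fst p) + theta_exp a' b' (snd p)) w"
    if "a + b > 0" "a' + b' > 0" for a b a' b'
    unfolding theta_mult_theta[OF that] w_def by (simp add: power_int_add)
  have "theta (-1) 1 1 ^ 2 = wt_series UNIV N w"
    unfolding power2_eq_square by (subst th) (simp_all add: N_def[abs_def])
  moreover have "wt_series {p. ?f p mod 5 = 0} N w = theta (-1) 5 5 ^ 2"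
  proof -
    let ?g = "\<lambda>p. (2 * fst p + snd p, 2 * snd p - fst p) :: int \<times> int"
    have "?g ` UNIV = {p. ?f p mod 5 = 0}"
    proof (intro set_eqI iffI)
      fix p assume "p \<in> ?g ` UNIV" then show "p \<in> {p. ?f p mod 5 = 0}" by clarsimp
    next
      fix p :: "int \<times> int" assume "p \<in> {p. ?f p mod 5 = 0}"
      then have "5 dvd ?f p" unfolding mem_Collect_eq by presburger
      then obtain c where "?f p = 5 * c" by (auto elim: dvdE)
      then have "p = ?g (2 * c - snd p, c)"
        by (cases p) simp
      then show "p \<in> ?g ` UNIV" by blast
    qed
    moreover have "inj ?g" by (auto simp: inj_def)
    moreover have "N (?g p) = theta_exp 5 5 (fst p) + theta_exp 5 5 (snd p)" for p
    proof -
      have "2 * int (N (?g p)) = 2 * int (theta_exp 5 5 (fst p) + theta_exp 5 5 (snd p))"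
        unfolding N of_nat_add distrib_left double_theta_exp by (simp add: algebra_simps)
      then show ?thesis by simp
    qed
    moreover have "w (?g p) = w p" for p by (simp add: w)
    ultimately have "wt_series {p. ?f p mod 5 = 0} N w =
        wt_series UNIV (\<lambda>p. theta_exp 5 5 (fst p) + theta_exp 5 5 (snd p)) w"
      using wt_series_reindex[of ?g UNIV N w] by simp
    then show ?thesis unfolding power2_eq_square by (subst th) simp_all
  qed
  moreover have "wt_series {p. ?f p mod 5 = 4} N w = - (fps_X * (theta (-1) 1 9 * theta (-1) 3 7))"
  proof -
    \<comment> \<open>Multiplication by 2 - \<i> followed by the translation by -1, which changes
      the parity of a + b: this is the origin of the minus sign.\<close>
    let ?g = "\<lambda>p. (2 * fst p + snd p - 1, 2 * snd p - fst p) :: int \<times> int"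
    have "?g ` UNIV = {p. ?f p mod 5 = 4}"
    proof (intro set_eqI iffI)
      fix p assume "p \<in> ?g ` UNIV" then show "p \<in> {p. ?f p mod 5 = 4}" by clarsimp presburger
    next
      fix p :: "int \<times> int" assume "p \<in> {p. ?f p mod 5 = 4}"
      then have "5 dvd ?f p + 1" unfolding mem_Collect_eq by presburger
      then obtain c where "?f p + 1 = 5 * c" by (auto elim: dvdE)
      then have "p = ?g (2 * c - snd p, c)" by (cases p) simp
      then show "p \<in> ?g ` UNIV" by blast
    qed
    moreover have "inj ?g" by (auto simp: inj_def)
    moreover have "N (?g p) = theta_exp 1 9 (fst p) + theta_exp 3 7 (snd p) + 1" for p
    proof -
      have "2 * int (N (?g p)) = 2 * int (theta_exp 1 9 (fst p) + theta_exp 3 7 (snd p) + 1)"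
        unfolding N of_nat_add distrib_left double_theta_exp by (simp add: algebra_simps)
      then show ?thesis by simp
    qed
    moreover have "w (?g p) = -1 * w p" for p by (simp add: w)
    ultimately have "wt_series {p. ?f p mod 5 = 4} N w =
        wt_series UNIV (\<lambda>p. theta_exp 1 9 (fst p) + theta_exp 3 7 (snd p) + 1) (\<lambda>p. -1 * w p)"
      using wt_series_reindex[of ?g UNIV N w] by simp
    then show ?thesis unfolding wt_series_shift wt_series_scale by (subst th) (simp_all flip: fps_const_neg)
  qed
  ultimately show ?thesis using * by simp
qed

theorem euler_identity_1:
  "euler 2 ^ 2 * euler 5 ^ 5 = euler 1 ^ 4 * euler 5 * euler 10 ^ 2 + 4 * (fps_X * (euler 1 * euler 2 * euler 10 ^ 5))"
proof -
  have "e2 ^ 2 * e5 ^ 5 = e1 ^ 4 * e5 * e10 ^ 2 + 4 * (x * (e1 * e2 * e10 ^ 5))"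
    if "t1 * e2 = e1 ^ 2" "t5 * e10 = e5 ^ 2" "s * (e5 * e2) = e10 ^ 3 * e1" "t1 ^ 2 = t5 ^ 2 - 4 * (x * s)"
    for e1 e2 e5 e10 x t1 t5 s :: "complex fps"
    using that by algebra
  from this[OF theta_phi[of 1, simplified mult_1_right, OF zero_less_one] theta_phi[of 5, simplified] theta_19_37 phi_square_dissection]
  show ?thesis by simp
qed

theorem euler_identity_2:
  "euler 2 ^ 4 * euler 5 ^ 2 * euler 10 = euler 1 * euler 2 * euler 5 ^ 5 + fps_X * (euler 1 ^ 2 * euler 10 ^ 5)"
proof -
  \<comment> \<open>Both theta functions psi enter as 2 psi, so after squaring the whole identity
    carries a factor 4, which is cancelled.\<close>
  have "4 * (e2 ^ 4 * e5 ^ 2 * e10) = 4 * (e1 * e2 * e5 ^ 5 + x * (e1 ^ 2 * e10 ^ 5))"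
    if "t1 * e1 = 2 * e2 ^ 2" "t5 * e5 = 2 * e10 ^ 2" "s * (e10 * e1) = e5 ^ 3 * e2" "t1 ^ 2 = x * t5 ^ 2 + 4 * s"
    for e1 e2 e5 e10 x t1 t5 s :: "complex fps"
    using that by algebra
  from this[OF theta_psi[of 1, simplified mult_1_right, OF zero_less_one] theta_psi[of 5, simplified] theta_14_23 psi_square_dissection]
  show ?thesis unfolding mult_cancel_left by simp
qed

section \<open>Substitution of powers of q and the logarithmic derivative of Euler's product\<close>

lemma fps_approx_compose_X_power:
  assumes "fps_approx f g" "d > 0"
  shows "fps_approx (\<lambda>n. f n oo fps_X ^ d) (g oo fps_X ^ d)"
  unfolding fps_approx_def fps_X_power_dvd_iff
proof (intro allI impI)
  fix n k :: nat assume "k < n"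
  moreover have "k div d \<le> k" by simp
  ultimately have "fps_nth (f n - g) (k div d) = 0"
    using assms(1) unfolding fps_approx_def fps_X_power_dvd_iff by (meson le_less_trans)
  then show "fps_nth ((f n oo fps_X ^ d) - (g oo fps_X ^ d)) k = 0"
    by (simp add: fps_nth_compose_X_power)
qed

lemma euler_compose_X_power:
  assumes "k > 0" "d > 0"
  shows "euler k oo fps_X ^ d = euler (d * k)"
proof -
  have X: "(fps_X ^ j :: complex fps) oo fps_X ^ d = fps_X ^ (d * j)" for j
    using assms by (simp add: power_mult flip: fps_compose_power)
  have "(\<Prod>m<n. 1 - fps_X ^ (k * Suc m) :: complex fps) oo fps_X ^ d = (\<Prod>m<n. 1 - fps_X ^ (d * k * Suc m))" for n
    using assms by (induction n) (simp_all only: prod.lessThan_Suc lessThan_0 prod.empty fps_compose_1 fps_compose_mult_distrib fps_X_power_nth power_0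
      fps_compose_sub_distrib X mult.assoc, simp_all add: fps_compose_mult_distrib fps_compose_sub_distrib X)
  then have "fps_approx (\<lambda>n. \<Prod>m<n. 1 - fps_X ^ (d * k * Suc m)) (euler k oo fps_X ^ d)"
    using fps_approx_compose_X_power[OF euler_approx[OF assms(1)] assms(2)] by simp
  moreover have "fps_approx (\<lambda>n. \<Prod>m<n. 1 - fps_X ^ (d * k * Suc m)) (euler (d * k))"
    using assms by (intro euler_approx) simp
  ultimately show ?thesis by (rule fps_approx_unique)
qed

text \<open>The factor X compensates the order that differentiation loses, so the rate of
  approximation is unchanged.\<close>

lemma fps_approx_deriv:
  assumes "fps_approx f g"
  shows "fps_approx (\<lambda>n. fps_X * fps_deriv (f n)) (fps_X * fps_deriv g)"
  unfolding fps_approx_def fps_X_power_dvd_iff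
proof (intro allI impI)
  fix n k :: nat assume "k < n"
  then have "fps_nth (f n) k = fps_nth g k"
    using assms unfolding fps_approx_def fps_X_power_dvd_iff by auto
  then show "fps_nth (fps_X * fps_deriv (f n) - fps_X * fps_deriv g) k = 0"
    by (cases k) simp_all
qed

text \<open>The logarithmic derivative of the product of 1 - q^n is minus the sum of n q^n / (1 -
  q^n). It is proved for the partial products by induction with the product rule, so no logarithm of
  a series occurs.\<close>

lemma euler_deriv: "24 * (fps_X * fps_deriv (euler 1)) = euler 1 * (E2 - 1)"
proof -
  define t where "t n = of_nat (Suc n) * fps_X ^ Suc n / (1 - fps_X ^ Suc n :: complex fps)" for n
  have unit: "fps_nth (1 - fps_X ^ Suc n :: complex fps) 0 \<noteq> 0" for n by simp
  have t: "t n * (1 - fps_X ^ Suc n) = of_nat (Suc n) * fps_X ^ Suc n" for n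
    unfolding t_def using unit[of n] by (simp add: fps_divide_unit mult.assoc inverse_mult_eq_1)
  have dvd: "fps_X ^ Suc n dvd t n" for n
    unfolding t_def fps_divide_unit[OF unit] by (intro dvd_mult2 dvd_mult dvd_refl)
  have "fps_approx (\<lambda>n. \<Sum>m<n. t m) (suminf t)"
    unfolding fps_approx_def fps_X_power_dvd_iff
  proof (intro allI impI)
    fix n k :: nat assume k: "k < n"
    have "(\<lambda>N. \<Sum>m<N. t m) \<longlonglongrightarrow> suminf t"
      using summable_sums[OF E2_summable] unfolding t_def sums_def .
    then have "\<forall>\<^sub>F N in sequentially. fps_nth (\<Sum>m<N. t m) k = fps_nth (suminf t) k"
      by (simp add: tendsto_fps_iff)
    then obtain N where N: "N \<ge> n" "fps_nth (\<Sum>m<N. t m) k = fps_nth (suminf t) k"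
      unfolding eventually_sequentially by (metis nle_le)
    have "fps_nth (t m) k = 0" if "n \<le> m" for m
      using dvd[of m] that k unfolding fps_X_power_dvd_iff by simp
    then have "(\<Sum>m<n. fps_nth (t m) k) = (\<Sum>m<N. fps_nth (t m) k)"
      using N(1) by (intro sum.mono_neutral_left) auto
    then show "fps_nth ((\<Sum>m<n. t m) - suminf t) k = 0" using N(2) by (simp add: fps_sum_nth)
  qed
  moreover define P where "P n = (\<Prod>m<n. 1 - fps_X ^ (1 * Suc m) :: complex fps)" for n
  have "fps_approx P (euler 1)" unfolding P_def by (rule euler_approx) simp
  ultimately have "fps_approx (\<lambda>n. - (P n * (\<Sum>m<n. t m))) (- (euler 1 * suminf t))"
    using fps_approx_mult[OF fps_approx_const[of "-1"] fps_approx_mult] by force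
  moreover have "fps_X * fps_deriv (P n) = - (P n * (\<Sum>m<n. t m))" for n
  proof (induction n)
    case (Suc n)
    have "fps_X * fps_deriv (1 - fps_X ^ Suc n :: complex fps) = - (of_nat (Suc n) * fps_X ^ Suc n)"
    proof -
      have "fps_deriv (fps_X ^ Suc n :: complex fps) = of_nat (Suc n) * fps_X ^ n"
        by (simp add: fps_deriv_power fps_of_nat del: of_nat_Suc power_Suc)
      then have "fps_X * fps_deriv (1 - fps_X ^ Suc n :: complex fps) = - (fps_X * (of_nat (Suc n) * fps_X ^ n))"
        by (simp del: power_Suc of_nat_Suc)
      then show ?thesis by (simp only: power_Suc ac_simps)
    qed
    also have "\<dots> = - (t n * (1 - fps_X ^ Suc n))" by (simp only: t)
    finally have d: "fps_X * fps_deriv (1 - fps_X ^ Suc n :: complex fps) = - (t n * (1 - fps_X ^ Suc n))" .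
    have P: "P (Suc n) = P n * (1 - fps_X ^ Suc n)" by (simp add: P_def)
    have "fps_X * fps_deriv (P (Suc n)) = fps_X * fps_deriv (P n) * (1 - fps_X ^ Suc n)
        + P n * (fps_X * fps_deriv (1 - fps_X ^ Suc n))"
      unfolding P fps_deriv_mult by (simp only: distrib_left ac_simps)
    also have "\<dots> = - (P (Suc n) * (\<Sum>m<Suc n. t m))"
      unfolding Suc d P by (simp add: algebra_simps)
    finally show ?case .
  qed (simp add: P_def)
  then have "fps_approx (\<lambda>n. - (P n * (\<Sum>m<n. t m))) (fps_X * fps_deriv (euler 1))"
    using fps_approx_deriv[OF \<open>fps_approx P (euler 1)\<close>] by simp
  ultimately have "fps_X * fps_deriv (euler 1) = - (euler 1 * suminf t)" by (rule fps_approx_unique[symmetric])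
  moreover have "E2 = 1 - 24 * suminf t" unfolding E2_def t_def[abs_def] ..
  ultimately show ?thesis by algebra
qed

section \<open>Eta quotients of level 10\<close>

abbreviation V5 :: "complex fls \<Rightarrow> complex fls" where "V5 f \<equiv> fls_compose_power f 5"

definition qderiv :: "complex fls \<Rightarrow> complex fls" where "qderiv f = fls_X * fls_deriv f"

lemma qderiv_nth: "fls_nth (qderiv f) n = of_int n * fls_nth f n"
  by (simp add: qderiv_def fls_X_times_conv_shift)

lemma qderiv_V5: "qderiv (V5 f) = 5 * V5 (qderiv f)"
proof (rule fls_eqI)
  fix n
  have "fls_nth (5 * V5 (qderiv f)) n = 5 * fls_nth (V5 (qderiv f)) n"
    using fls_mult_const_nth[of 5] by (simp add: fls_const_numeral)
  then show "fls_nth (qderiv (V5 f)) n = fls_nth (5 * V5 (qderiv f)) n"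
    by (auto simp: qderiv_nth fls_nth_compose_power elim!: dvdE)
qed

lemma qderiv_add [simp]: "qderiv (f + g) = qderiv f + qderiv g"
  and qderiv_diff [simp]: "qderiv (f - g) = qderiv f - qderiv g"
  and qderiv_mult: "qderiv (f * g) = f * qderiv g + qderiv f * g"
  and qderiv_0 [simp]: "qderiv 0 = 0" and qderiv_1 [simp]: "qderiv 1 = 0"
  and qderiv_numeral [simp]: "qderiv (numeral k) = 0"
  and qderiv_X [simp]: "qderiv fls_X = fls_X"
  by (simp_all add: qderiv_def algebra_simps)

text \<open>Dedekind's eta function of k\<tau> without its factor q^(k/24). Hence explicit powers of
  \<open>fls_X\<close> accompany the eta quotients, and \<open>qderiv_eta\<close> has E2 - 1 in
  place of E2.\<close>

definition eta :: "nat \<Rightarrow> complex fls" where "eta k = fps_to_fls (euler k)"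

definition E2f :: "nat \<Rightarrow> complex fls" where "E2f k = fps_to_fls (E2 oo fps_X ^ k)"

lemma eta_nonzero [simp]: "k > 0 \<Longrightarrow> eta k \<noteq> 0"
  by (simp add: eta_def)

lemma V5_eta: "k > 0 \<Longrightarrow> V5 (eta k) = eta (5 * k)"
  by (simp add: eta_def fls_compose_power_fps_to_fls euler_compose_X_power)

lemma qderiv_eta:
  assumes "k > 0"
  shows "24 * qderiv (eta k) = of_nat k * eta k * (E2f k - 1)"
proof -
  have "24 * (fps_X * fps_deriv (euler 1 oo fps_X ^ k)) = of_nat k * ((24 * (fps_X * fps_deriv (euler 1))) oo fps_X ^ k)"
  proof -
    have "fps_deriv (euler 1 oo fps_X ^ k) = (fps_deriv (euler 1) oo fps_X ^ k) * (of_nat k * fps_X ^ (k - 1))"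
      using assms by (simp add: fps_compose_deriv fps_deriv_power fps_of_nat)
    moreover have "(fps_X :: complex fps) * fps_X ^ (k - 1) = fps_X ^ k"
      using assms by (metis Suc_diff_1 power_Suc)
    moreover have "(24 * (fps_X * fps_deriv (euler 1))) oo fps_X ^ k = 24 * (fps_X ^ k * (fps_deriv (euler 1) oo fps_X ^ k))"
      using assms by (simp add: fps_compose_mult_distrib numeral_fps_const)
    ultimately show ?thesis by (simp add: ac_simps)
  qed
  also have "\<dots> = of_nat k * (euler k * ((E2 oo fps_X ^ k) - 1))"
    unfolding euler_deriv using assms euler_compose_X_power[of 1 k]
    by (simp add: fps_compose_mult_distrib fps_compose_sub_distrib)
  finally have "24 * (fps_X * fps_deriv (euler k)) = of_nat k * (euler k * ((E2 oo fps_X ^ k) - 1))"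
    using assms euler_compose_X_power[of 1 k] by simp
  then have "fps_to_fls (24 * (fps_X * fps_deriv (euler k))) = fps_to_fls (of_nat k * (euler k * ((E2 oo fps_X ^ k) - 1)))"
    by simp
  then show ?thesis unfolding eta_def E2f_def qderiv_def
    by (simp add: fls_deriv_fps_to_fls fls_times_fps_to_fls ac_simps)
qed

lemma fps_divide_mult_unit: "fps_nth b 0 \<noteq> 0 \<Longrightarrow> a / b * b = (a :: 'a::field fps)"
  by (subst fps_divide_unit) (simp_all add: mult.assoc inverse_mult_eq_1)

definition dlog :: "complex fls \<Rightarrow> complex fls" where "dlog f = qderiv f / f"

lemma dlog_mult: "f \<noteq> 0 \<Longrightarrow> g \<noteq> 0 \<Longrightarrow> dlog (f * g) = dlog f + dlog g"
  by (simp add: dlog_def qderiv_mult field_simps)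

lemma dlog_power: "f \<noteq> 0 \<Longrightarrow> dlog (f ^ n) = of_nat n * dlog f"
proof (induction n)
  case (Suc n)
  then show ?case by (simp add: dlog_mult algebra_simps)
qed (simp add: dlog_def)

lemma dlog_divide: "f \<noteq> 0 \<Longrightarrow> g \<noteq> 0 \<Longrightarrow> dlog (f / g) = dlog f - dlog g"
  using dlog_mult[of "f / g" g] by simp

lemma dlog_eta: "k > 0 \<Longrightarrow> 24 * dlog (eta k) = of_nat k * (E2f k - 1)"
  using qderiv_eta[of k] by (simp add: dlog_def field_simps)

text \<open>Level times exponent gives 1, 50, -2, -25, the coefficients of the E2 terms in 24 F.
  They add up to 24, which accounts for the single factor q.\<close>

definition xq :: "complex fls" where
  "xq = fls_X * (eta 1 * eta 10 ^ 5) / (eta 2 * eta 5 ^ 5)"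

lemma yq_eq: "yq = fls_X * (eta 2 * eta 10 ^ 3) / (eta 1 ^ 3 * eta 5)"
proof -
  define f where "f m = ((1 - fps_X ^ (2 * Suc m)) * (1 - fps_X ^ (10 * Suc m)) ^ 3) /
          ((1 - fps_X ^ Suc m) ^ 3 * (1 - fps_X ^ (5 * Suc m)) :: complex fps)" for m
  have "fps_X ^ Suc m dvd f m - 1" for m
    unfolding f_def
    by (intro dvd1_divide dvd1_mult dvd1_power dvd1) (auto simp: fps_mult_nth_0 fps_power_zeroth)
  then have ap: "fps_approx (\<lambda>n. \<Prod>m<n. f m) (prodinf f)" by (rule prodinf_approx)
  have "f m * ((1 - fps_X ^ (1 * Suc m)) ^ 3 * (1 - fps_X ^ (5 * Suc m))) =
      (1 - fps_X ^ (2 * Suc m)) * (1 - fps_X ^ (10 * Suc m)) ^ 3" for m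
  proof -
    have "fps_nth ((1 - fps_X ^ Suc m) ^ 3 * (1 - fps_X ^ (5 * Suc m)) :: complex fps) 0 \<noteq> 0"
      by (auto simp: fps_mult_nth_0 fps_power_zeroth power_0_left)
    then show ?thesis unfolding f_def mult_1 by (rule fps_divide_mult_unit)
  qed
  then have "(\<Prod>m<n. f m) * ((\<Prod>m<n. 1 - fps_X ^ (1 * Suc m)) ^ 3 * (\<Prod>m<n. 1 - fps_X ^ (5 * Suc m))) =
     (\<Prod>m<n. 1 - fps_X ^ (2 * Suc m)) * (\<Prod>m<n. 1 - fps_X ^ (10 * Suc m)) ^ 3" for n
    unfolding prod_power_distrib prod.distrib[symmetric] by (intro prod.cong refl)
  moreover have "fps_approx (\<lambda>n. (\<Prod>m<n. f m) * ((\<Prod>m<n. 1 - fps_X ^ (1 * Suc m)) ^ 3 * (\<Prod>m<n. 1 - fps_X ^ (5 * Suc m))))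
      (prodinf f * (euler 1 ^ 3 * euler 5))"
    by (intro fps_approx_mult fps_approx_power ap euler_approx) simp_all
  moreover have "fps_approx (\<lambda>n. (\<Prod>m<n. 1 - fps_X ^ (2 * Suc m)) * (\<Prod>m<n. 1 - fps_X ^ (10 * Suc m)) ^ 3)
      (euler 2 * euler 10 ^ 3)"
    by (intro fps_approx_mult fps_approx_power euler_approx) simp_all
  ultimately have "prodinf f * (euler 1 ^ 3 * euler 5) = euler 2 * euler 10 ^ 3"
    using fps_approx_unique by simp
  then have "fps_to_fls (prodinf f) * (eta 1 ^ 3 * eta 5) = eta 2 * eta 10 ^ 3"
    unfolding eta_def fps_to_fls_power[symmetric] fls_times_fps_to_fls[symmetric] by simp
  moreover have "yq = fls_X * fps_to_fls (prodinf f)"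
    unfolding yq_def f_def[symmetric] by (simp add: fls_times_fps_to_fls)
  ultimately have "yq * (eta 1 ^ 3 * eta 5) = fls_X * (eta 2 * eta 10 ^ 3)" by algebra
  then show ?thesis by (simp add: eq_divide_eq)
qed

lemma Zq_eq: "Zq = fls_X ^ 2 * eta 50 / eta 2"
proof -
  define f where "f m = ((1 - fps_X ^ (50 * Suc m)) / (1 - fps_X ^ (2 * Suc m)) :: complex fps)" for m
  have "fps_X ^ Suc m dvd f m - 1" for m
    unfolding f_def by (intro dvd1_divide dvd1) auto
  then have ap: "fps_approx (\<lambda>n. \<Prod>m<n. f m) (prodinf f)" by (rule prodinf_approx)
  have "f m * (1 - fps_X ^ (2 * Suc m)) = 1 - fps_X ^ (50 * Suc m)" for m
  proof -
    have "fps_nth (1 - fps_X ^ (2 * Suc m) :: complex fps) 0 \<noteq> 0" by auto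
    then show ?thesis unfolding f_def mult_1 by (rule fps_divide_mult_unit)
  qed
  then have "(\<Prod>m<n. f m) * (\<Prod>m<n. 1 - fps_X ^ (2 * Suc m)) = (\<Prod>m<n. 1 - fps_X ^ (50 * Suc m))" for n
    unfolding prod.distrib[symmetric] by (intro prod.cong refl)
  moreover have "fps_approx (\<lambda>n. (\<Prod>m<n. f m) * (\<Prod>m<n. 1 - fps_X ^ (2 * Suc m))) (prodinf f * euler 2)"
    by (intro fps_approx_mult ap euler_approx) simp_all
  moreover have "fps_approx (\<lambda>n. (\<Prod>m<n. 1 - fps_X ^ (50 * Suc m))) (euler 50)"
    by (rule euler_approx) simp
  ultimately have "prodinf f * euler 2 = euler 50"
    using fps_approx_unique by simp
  then have e1: "fps_to_fls (prodinf f) * eta 2 = eta 50"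
    unfolding eta_def fls_times_fps_to_fls[symmetric] by simp
  have e2: "Zq = fls_X ^ 2 * fps_to_fls (prodinf f)"
    unfolding Zq_def f_def[symmetric] by (simp add: fls_times_fps_to_fls fps_to_fls_power)
  have "Zq * eta 2 = fls_X ^ 2 * eta 50" unfolding e2 mult.assoc e1 ..
  then show ?thesis by (simp add: eq_divide_eq)
qed

lemma xq_nonzero [simp]: "xq \<noteq> 0" and yq_nonzero [simp]: "yq \<noteq> 0" and Zq_nonzero [simp]: "Zq \<noteq> 0"
  by (simp_all add: xq_def yq_eq Zq_eq)

lemma Fq_eq: "Fq = dlog xq"
proof -
  have "24 * dlog xq = 24 * dlog fls_X + (24 * dlog (eta 1) + 5 * (24 * dlog (eta 10))) - (24 * dlog (eta 2) + 5 * (24 * dlog (eta 5)))"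
    unfolding xq_def by (simp add: dlog_mult dlog_divide dlog_power algebra_simps)
  also have "\<dots> = 50 * E2f 10 - 25 * E2f 5 - 2 * E2f 2 + E2f 1"
    unfolding dlog_eta[OF zero_less_numeral] dlog_eta[OF zero_less_one] by (simp add: dlog_def algebra_simps)
  also have "\<dots> = 24 * Fq"
  proof -
    have "24 * (fps_const (1 / 24) * f) = f" for f :: "complex fps"
    proof -
      have "24 * (fps_const (1 / 24) * f) = (fps_const 24 * fps_const (1 / 24)) * f"
        by (simp only: numeral_fps_const mult.assoc)
      then show ?thesis by simp
    qed
    then have "24 * Fq = fps_to_fls (50 * (E2 oo fps_X ^ 10) - 25 * (E2 oo fps_X ^ 5) - 2 * (E2 oo fps_X ^ 2) + E2)"
      unfolding Fq_def fps_to_fls_numeral[symmetric] fls_times_fps_to_fls[symmetric] by (simp only:)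
    then show ?thesis
      by (simp add: E2f_def fls_times_fps_to_fls)
  qed
  finally show ?thesis by simp
qed

lemma eta_identity_1:
  "eta 2 ^ 2 * eta 5 ^ 5 = eta 1 ^ 4 * eta 5 * eta 10 ^ 2 + 4 * (fls_X * (eta 1 * eta 2 * eta 10 ^ 5))"
  using arg_cong[OF euler_identity_1, of fps_to_fls] fps_to_fls_of_nat[of 4]
  by (simp add: eta_def fls_times_fps_to_fls fps_to_fls_power)

lemma eta_identity_2:
  "eta 2 ^ 4 * eta 5 ^ 2 * eta 10 = eta 1 * eta 2 * eta 5 ^ 5 + fls_X * (eta 1 ^ 2 * eta 10 ^ 5)"
  using arg_cong[OF euler_identity_2, of fps_to_fls]
  by (simp add: eta_def fls_times_fps_to_fls fps_to_fls_power)

text \<open>In terms of x the two eta identities say that 1 - 4 x = x / y and, in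
  \<open>one_plus_xq\<close>, 1 + x are eta quotients too. The relation also reads x = y / (1 + 4
  y).\<close>

lemma xq_yq: "xq = yq * (1 - 4 * xq)"
proof -
  have "(x - y * (1 - 4 * x)) * (e2 * e5 ^ 5 * (e1 ^ 3 * e5)) = 0"
    if "e2 ^ 2 * e5 ^ 5 = e1 ^ 4 * e5 * e10 ^ 2 + 4 * (q * (e1 * e2 * e10 ^ 5))"
      "x * (e2 * e5 ^ 5) = q * (e1 * e10 ^ 5)" "y * (e1 ^ 3 * e5) = q * (e2 * e10 ^ 3)"
    for x y q e1 e2 e5 e10 :: "complex fls"
    using that by algebra
  moreover have "xq * (eta 2 * eta 5 ^ 5) = fls_X * (eta 1 * eta 10 ^ 5)" by (simp add: xq_def)
  moreover have "yq * (eta 1 ^ 3 * eta 5) = fls_X * (eta 2 * eta 10 ^ 3)" by (simp add: yq_eq)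
  ultimately have "(xq - yq * (1 - 4 * xq)) * (eta 2 * eta 5 ^ 5 * (eta 1 ^ 3 * eta 5)) = 0"
    using eta_identity_1 by blast
  moreover have "eta 2 * eta 5 ^ 5 * (eta 1 ^ 3 * eta 5) \<noteq> 0" by simp
  ultimately show ?thesis by (metis mult_eq_0_iff right_minus_eq)
qed

lemma one_plus_xq: "(1 + xq) * (eta 1 * eta 5 ^ 3) = eta 2 ^ 3 * eta 10"
proof -
  have "(e2 * e5 ^ 5 + x * (e1 * e10 ^ 5)) * (e1 * e5 ^ 3) = e2 ^ 3 * e10 * (e2 * e5 ^ 5)"
    if "e2 ^ 4 * e5 ^ 2 * e10 = e1 * e2 * e5 ^ 5 + x * (e1 ^ 2 * e10 ^ 5)"
    for x e1 e2 e5 e10 :: "complex fls"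
    using that by algebra
  from this[OF eta_identity_2] show ?thesis unfolding xq_def by (simp add: field_simps)
qed

section \<open>Euler's trace formula\<close>

text \<open>Lagrange interpolation at the points of S reproduces the monomial of degree k < card S;
  the sum is the coefficient of degree card S - 1 of the interpolation polynomial.\<close>

lemma sum_lagrange_coeffs:
  fixes S :: "'a::field set"
  assumes "finite S" "k < card S"
  shows "(\<Sum>r\<in>S. r ^ k / (\<Prod>s\<in>S - {r}. r - s)) = (if Suc k = card S then 1 else 0)"
proof -
  define L where "L r = (\<Prod>s\<in>S - {r}. [:- s, 1:])" for r
  have degL: "degree (L r) = card S - 1" "lead_coeff (L r) = 1" if "r \<in> S" for r
  proof -
    show "degree (L r) = card S - 1"
      using that assms(1) unfolding L_def by (simp add: degree_prod_eq_sum_degree)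
    show "lead_coeff (L r) = 1" unfolding L_def lead_coeff_prod by simp
  qed
  define p where "p = (\<Sum>r\<in>S. smult (r ^ k / (\<Prod>s\<in>S - {r}. r - s)) (L r))"
  have "degree p \<le> card S - 1"
    unfolding p_def by (intro degree_sum_le) (use assms degL in \<open>auto intro: order_trans[OF degree_smult_le]\<close>)
  moreover have "poly p r = r ^ k" if "r \<in> S" for r
  proof -
    have "poly (L r') r = (if r' = r then (\<Prod>s\<in>S - {r}. r - s) else 0)" if "r' \<in> S" for r'
      using that \<open>r \<in> S\<close> assms(1) by (auto simp: L_def poly_prod intro!: prod.cong)
    then have "poly p r = (\<Sum>r'\<in>S. if r' = r then r ^ k / (\<Prod>s\<in>S - {r}. r - s) * (\<Prod>s\<in>S - {r}. r - s) else 0)"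
      unfolding p_def poly_sum poly_smult by (intro sum.cong) auto
    also have "\<dots> = r ^ k" using assms(1) that by (simp add: prod_zero_iff)
    finally show ?thesis .
  qed
  ultimately have "p = monom 1 k"
    using assms by (intro poly_eqI_degree[where A = S]) (auto simp: poly_monom degree_monom_eq)
  then have "coeff p (card S - 1) = (if Suc k = card S then 1 else 0)" using assms(2) by auto
  moreover have "coeff p (card S - 1) = (\<Sum>r\<in>S. r ^ k / (\<Prod>s\<in>S - {r}. r - s))"
    unfolding p_def coeff_sum coeff_smult using degL by (intro sum.cong) simp_all
  ultimately show ?thesis by simp
qed

lemma U5_nth: "fls_nth (U5 f) n = fls_nth f (5 * n)"
  by (simp add: U5.rep_eq)

definition conj_q :: "complex \<Rightarrow> complex fls \<Rightarrow> complex fls" where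
  "conj_q z f = fls_compose_fps f (fps_const z * fps_X)"

lemma conj_q_nth: "z \<noteq> 0 \<Longrightarrow> fls_nth (conj_q z f) n = fls_nth f n * z powi n"
  unfolding conj_q_def by (rule fls_nth_fls_compose_fps_linear)

lemma conj_q_0 [simp]: "conj_q z 0 = 0"
  by (simp add: conj_q_def)

lemma
  assumes "z \<noteq> 0"
  shows conj_q_add: "conj_q z (f + g) = conj_q z f + conj_q z g"
    and conj_q_mult: "conj_q z (f * g) = conj_q z f * conj_q z g"
    and conj_q_divide: "conj_q z (f / g) = conj_q z f / conj_q z g"
    and conj_q_power: "conj_q z (f ^ n) = conj_q z f ^ n"
  using assms by (simp_all add: conj_q_def fls_compose_fps_add fls_compose_fps_mult fls_compose_fps_divide fls_compose_fps_power)

lemma conj_q_sum: "z \<noteq> 0 \<Longrightarrow> conj_q z (sum f A) = (\<Sum>x\<in>A. conj_q z (f x))"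
  by (induction A rule: infinite_finite_induct) (auto simp: conj_q_add)

lemma conj_q_V5:
  assumes "z ^ 5 = 1"
  shows "conj_q z (V5 f) = V5 f"
proof (rule fls_eqI)
  fix n
  have "z \<noteq> 0" using assms by auto
  moreover have "z powi n = 1" if "5 dvd n"
    using that assms by (auto elim!: dvdE simp: power_int_mult)
  ultimately show "fls_nth (conj_q z (V5 f)) n = fls_nth (V5 f) n"
    by (auto simp: conj_q_nth fls_nth_compose_power)
qed

definition zeta5 :: complex where "zeta5 = cis (2 * pi / 5)"

lemma zeta5_power: "zeta5 ^ 5 = 1"
  unfolding zeta5_def Complex.DeMoivre by simp

lemma zeta5_nonzero [simp]: "zeta5 \<noteq> 0"
  by (simp add: zeta5_def)

lemma zeta5_neq_1: "zeta5 \<noteq> 1"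
proof
  assume "zeta5 = 1"
  then have "sin (2 * pi / 5) = 0" by (simp add: zeta5_def complex_eq_iff)
  moreover have "sin (2 * pi / 5) > 0" by (rule sin_gt_zero) auto
  ultimately show False by simp
qed

lemma zeta5_powi_eq_1_iff: "zeta5 powi n = 1 \<longleftrightarrow> 5 dvd n"
proof
  assume 1: "zeta5 powi n = 1"
  show "5 dvd n"
  proof (rule ccontr)
    assume n: "\<not> 5 dvd n"
    have "coprime n 5" using n prime_imp_coprime[of 5 n] by (simp add: coprime_commute)
    then obtain a b where "a * n + b * 5 = 1" using bezout_int[of n 5] by (metis coprime_iff_gcd_eq_1)
    then have "zeta5 = zeta5 powi (n * a) * zeta5 powi (5 * b)"
      by (metis mult.commute power_int_1_right power_int_add zeta5_nonzero)
    also have "\<dots> = 1" using 1 zeta5_power by (simp add: power_int_mult)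
    finally show False using zeta5_neq_1 by simp
  qed
next
  assume "5 dvd n" then show "zeta5 powi n = 1" using zeta5_power by (auto elim!: dvdE simp: power_int_mult)
qed

lemma sum_conj_q: "(\<Sum>i<5. conj_q (zeta5 ^ i) f) = 5 * V5 (U5 f)"
proof (rule fls_eqI)
  fix n
  define w where "w = zeta5 powi n"
  have "fls_nth (\<Sum>i<5. conj_q (zeta5 ^ i) f) n = (\<Sum>i<5. fls_nth f n * w ^ i)"
    unfolding fls_nth_sum w_def by (intro sum.cong refl)
      (simp add: conj_q_nth power_int_power power_int_power' mult.commute flip: power_int_of_nat power_int_mult)
  also have "\<dots> = fls_nth f n * (if 5 dvd n then 5 else 0)"
  proof (cases "5 dvd n")
    case True
    then have "w = 1" by (simp add: w_def zeta5_powi_eq_1_iff)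
    then show ?thesis using True by simp
  next
    case False
    then have "w \<noteq> 1" by (simp add: w_def zeta5_powi_eq_1_iff)
    moreover have "w ^ 5 = 1"
      unfolding w_def by (metis power_int_1_left power_int_mult power_int_of_nat mult.commute zeta5_power of_nat_numeral)
    ultimately show ?thesis using False geometric_sum[of w 5] by (simp add: sum_distrib_left[symmetric])
  qed
  also have "\<dots> = fls_nth (5 * V5 (U5 f)) n"
    by (auto simp: fls_nth_compose_power U5_nth elim!: dvdE)
  finally show "fls_nth (\<Sum>i<5. conj_q (zeta5 ^ i) f) n = fls_nth (5 * V5 (U5 f)) n" .
qed

lemma V5_numeral [simp]: "V5 (numeral k) = numeral k"
  and V5_of_nat [simp]: "V5 (of_nat n) = of_nat n"
  and V5_of_int [simp]: "V5 (of_int i) = of_int i"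
  using fls_compose_power_const_left[of 5 "numeral k :: complex"] fls_compose_power_const_left[of 5 "of_nat n :: complex"]
    fls_compose_power_const_left[of 5 "of_int i :: complex"]
  by (simp_all add: fls_of_nat fls_of_int)

lemma V5_inject: "V5 f = V5 g \<longleftrightarrow> f = g"
proof
  assume *: "V5 f = V5 g"
  show "f = g"
  proof (rule fls_eqI)
    fix n
    have "fls_nth (V5 f) (5 * n) = fls_nth (V5 g) (5 * n)" using * by simp
    then show "fls_nth f n = fls_nth g n" by (simp add: fls_nth_compose_power)
  qed
qed simp

lemma U5_add: "U5 (f + g) = U5 f + U5 g" and U5_0 [simp]: "U5 0 = (0 :: complex fls)"
  by (auto intro!: fls_eqI simp: U5_nth)

text \<open>Series in q^5 are fixed by every substitution q \<mapsto> \<zeta> q, so they pass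
  through the sum over the five conjugates.\<close>

lemma U5_V5_mult: "U5 (V5 f * g) = f * U5 g"
proof -
  have z: "zeta5 ^ i \<noteq> 0" "(zeta5 ^ i) ^ 5 = 1" for i
    by (simp, metis power_one power_mult mult.commute zeta5_power)
  have "5 * V5 (U5 (V5 f * g)) = V5 f * (5 * V5 (U5 g))"
    unfolding sum_conj_q[symmetric] sum_distrib_left
    by (intro sum.cong refl) (simp add: conj_q_mult[OF z(1)] conj_q_V5[OF z(2)])
  then have "V5 (U5 (V5 f * g)) = V5 (f * U5 g)" by simp
  then show ?thesis by (simp only: V5_inject)
qed

text \<open>Euler's trace formula for the extension generated by \<open>y\<close> over the series in \<open>q\<^sup>5\<close>: the conjugates
  of \<open>y\<close> are its images under \<open>q \<mapsto> \<zeta> q\<close>, and \<open>U5\<close> is a fifth of the trace.\<close>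

theorem U5_euler_trace:
  assumes P: "degree P = 5" "lead_coeff P = 1" "\<And>i. coeff P i \<in> range V5"
    and y: "poly P y = 0" "fls_subdegree y = 1" and k: "k < 5"
  shows "poly (pderiv P) y \<noteq> 0"
    "U5 (5 * (y ^ k / poly (pderiv P) y)) = (if k = 4 then 1 else 0)"
proof -
  have z: "zeta5 ^ i \<noteq> 0" "(zeta5 ^ i) ^ 5 = 1" for i
    by (simp, metis power_one power_mult mult.commute zeta5_power)
  have fix_poly: "conj_q (zeta5 ^ i) (poly Q y) = poly Q (conj_q (zeta5 ^ i) y)"
    if "\<And>j. coeff Q j \<in> range V5" for Q i
  proof -
    have "conj_q (zeta5 ^ i) (coeff Q j) = coeff Q j" for j
      using that[of j] conj_q_V5[OF z(2)] by auto
    then show ?thesis unfolding poly_altdef by (simp add: conj_q_sum[OF z(1)] conj_q_mult[OF z(1)] conj_q_power[OF z(1)])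
  qed
  define S where "S = (\<lambda>i. conj_q (zeta5 ^ i) y) ` {..<5}"
  \<comment> \<open>Because y starts with q^1, the coefficients of q in the conjugates are distinct
    multiples of a nonzero number. So P has five different roots and splits into linear
    factors.\<close>
  have inj: "inj_on (\<lambda>i. conj_q (zeta5 ^ i) y) {..<5}"
  proof (rule inj_onI)
    fix i j :: nat assume ij: "i \<in> {..<5}" "j \<in> {..<5}" "conj_q (zeta5 ^ i) y = conj_q (zeta5 ^ j) y"
    have "y \<noteq> 0" using y(2) by auto
    then have "fls_nth y 1 \<noteq> 0" using nth_fls_subdegree_nonzero[of y] y(2) by simp
    moreover have "fls_nth (conj_q (zeta5 ^ i) y) 1 = fls_nth (conj_q (zeta5 ^ j) y) 1" using ij by simp
    ultimately have "zeta5 ^ i = zeta5 ^ j" by (simp add: conj_q_nth z)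
    then have "zeta5 powi (int i - int j) = 1" by (simp add: power_int_diff)
    then have "5 dvd int i - int j" by (simp only: zeta5_powi_eq_1_iff)
    then show "i = j" using ij(1,2) unfolding lessThan_iff by presburger
  qed
  then have card: "card S = 5" "finite S" by (simp_all add: S_def card_image)
  have root: "poly P r = 0" if "r \<in> S" for r
    using that fix_poly[OF P(3), symmetric] y(1) by (auto simp: S_def)
  have "P = (\<Prod>r\<in>S. [:- r, 1:])"
  proof (rule poly_eqI_degree_lead_coeff[where A = S and n = 5])
    show "poly P x = poly (\<Prod>r\<in>S. [:- r, 1:]) x" if "x \<in> S" for x
      using that root card by (auto simp: poly_prod prod_zero_iff)
    show deg: "degree (\<Prod>r\<in>S. [:- r, 1:]) \<le> 5" using card by (simp add: degree_prod_eq_sum_degree)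
    have "lead_coeff (\<Prod>r\<in>S. [:- r, 1:]) = 1" unfolding lead_coeff_prod by simp
    moreover have "degree (\<Prod>r\<in>S. [:- r, 1:]) = 5" using card by (simp add: degree_prod_eq_sum_degree)
    ultimately show "coeff P 5 = coeff (\<Prod>r\<in>S. [:- r, 1:]) 5" using P by simp
  qed (use P card in simp_all)
  then have deriv: "poly (pderiv P) r = (\<Prod>s\<in>S - {r}. r - s)" if "r \<in> S" for r
  proof -
    have "poly (pderiv P) r = (\<Sum>a\<in>S. \<Prod>s\<in>S - {a}. r - s)"
      unfolding \<open>P = _\<close> pderiv_prod by (simp add: poly_sum poly_prod pderiv_pCons)
    also have "\<dots> = (\<Sum>a\<in>S. if a = r then \<Prod>s\<in>S - {r}. r - s else 0)"
      using that card by (intro sum.cong refl) (auto simp: prod_zero_iff)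
    also have "\<dots> = (\<Prod>s\<in>S - {r}. r - s)" using that card by simp
    finally show ?thesis .
  qed
  have "conj_q 1 y = y" by (rule fls_eqI) (simp add: conj_q_nth)
  then have "y \<in> S" unfolding S_def by (intro image_eqI[of _ _ 0]) simp_all
  then show "poly (pderiv P) y \<noteq> 0" using card by (simp add: deriv prod_zero_iff)
  have "coeff (pderiv P) j \<in> range V5" for j
  proof -
    obtain f where "coeff P (Suc j) = V5 f" using P(3) by blast
    then have "coeff (pderiv P) j = V5 (of_nat (Suc j) * f)"
      by (simp add: coeff_pderiv del: of_nat_Suc)
    then show ?thesis by blast
  qed
  note fix' = fix_poly[OF this]
  have "5 * V5 (U5 (y ^ k / poly (pderiv P) y)) = (\<Sum>r\<in>S. r ^ k / (\<Prod>s\<in>S - {r}. r - s))"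
    unfolding sum_conj_q[symmetric] S_def sum.reindex[OF inj] o_def
  proof (intro sum.cong refl)
    fix i :: nat assume "i \<in> {..<5}"
    then have "conj_q (zeta5 ^ i) y \<in> S" unfolding S_def by (rule imageI)
    then show "conj_q (zeta5 ^ i) (y ^ k / poly (pderiv P) y) = conj_q (zeta5 ^ i) y ^ k /
       (\<Prod>s\<in>(\<lambda>i. conj_q (zeta5 ^ i) y) ` {..<5} - {conj_q (zeta5 ^ i) y}. conj_q (zeta5 ^ i) y - s)"
      using deriv unfolding S_def[symmetric] by (simp add: conj_q_divide[OF z(1)] conj_q_power[OF z(1)] fix')
  qed
  also have "\<dots> = (if k = 4 then 1 else 0)"
    using sum_lagrange_coeffs[of S k] card k by simp
  finally have "V5 (5 * U5 (y ^ k / poly (pderiv P) y)) = V5 (if k = 4 then 1 else 0)"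
    by simp
  then have "5 * U5 (y ^ k / poly (pderiv P) y) = (if k = 4 then 1 else 0)" by (simp only: V5_inject)
  moreover have "U5 (5 * f) = 5 * U5 f" for f :: "complex fls" by (rule fls_eqI) (simp add: U5_nth)
  ultimately show "U5 (5 * (y ^ k / poly (pderiv P) y)) = (if k = 4 then 1 else 0)" by (simp only:)
qed

section \<open>The modular equation\<close>

text \<open>Large polynomial identities are verified by computation over the integers and
  transported to series by evaluation. One set of homomorphism rules serves the evaluations in one
  and in two variables.\<close>

definition ring_map :: "('a::comm_ring_1 \<Rightarrow> 'b::comm_ring_1) \<Rightarrow> bool" where
  "ring_map h \<longleftrightarrow> h 1 = 1 \<and> (\<forall>x y. h (x + y) = h x + h y) \<and> (\<forall>x y. h (x * y) = h x * h y)"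

lemma ring_mapD:
  assumes "ring_map h"
  shows "h 0 = 0" "h 1 = 1" "h (x + y) = h x + h y" "h (x * y) = h x * h y" "h (- x) = - h x"
    "h (x - y) = h x - h y" "h (x ^ n) = h x ^ n" "h (numeral k) = numeral k"
proof -
  show 1: "h 1 = 1" and add: "h (x + y) = h x + h y" and mult: "h (x * y) = h x * h y" for x y
    using assms by (auto simp: ring_map_def)
  show 0: "h 0 = 0" using add[of 0 0] by simp
  show neg: "h (- x) = - h x" for x using add[of x "- x"] 0 by (simp add: eq_neg_iff_add_eq_0 add.commute)
  show "h (x - y) = h x - h y" using add[of x "- y"] neg by simp
  show "h (x ^ n) = h x ^ n" by (induction n) (simp_all add: 1 mult)
  show "h (numeral k) = numeral k" by (induction k) (simp_all only: numeral.simps 1 add)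
qed

lemma ring_map_of_int: "ring_map of_int"
  by (simp add: ring_map_def)

lemma ring_map_poly:
  assumes "ring_map h"
  shows "ring_map (\<lambda>p. poly (map_poly h p) z)"
proof -
  let ?e = "\<lambda>p. poly (map_poly h p) z"
  note h = ring_mapD[OF assms]
  have pCons: "?e (pCons a p) = h a + z * ?e p" for a p by (simp add: map_poly_pCons h)
  have add: "?e (p + q) = ?e p + ?e q" for p q
    by (induction p q rule: poly_induct2) (simp_all add: pCons h algebra_simps)
  have smult: "?e (smult c q) = h c * ?e q" for c q
    by (induction q) (simp_all add: pCons h algebra_simps)
  have mult: "?e (p * q) = ?e p * ?e q" for p q
    by (induction p) (simp_all add: pCons add smult h algebra_simps)
  show ?thesis using add mult by (simp add: ring_map_def h map_poly_1')
qed

definition ev :: "'a::comm_ring_1 \<Rightarrow> int poly \<Rightarrow> 'a" where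
  "ev z p = poly (map_poly of_int p) z"

definition ev2 :: "'a::comm_ring_1 \<Rightarrow> 'a \<Rightarrow> int poly poly \<Rightarrow> 'a" where
  "ev2 Y y R = poly (map_poly (ev Y) R) y"

lemma ring_map_ev: "ring_map (ev z)"
  unfolding ev_def[abs_def] by (intro ring_map_poly ring_map_of_int)

lemma ring_map_ev2: "ring_map (ev2 Y y)"
  unfolding ev2_def[abs_def] by (intro ring_map_poly ring_map_ev)

lemmas ev_simps [simp] = ring_mapD[OF ring_map_ev]
lemmas ev2_simps [simp] = ring_mapD[OF ring_map_ev2]

lemma ev_pCons [simp]: "ev z (pCons a p) = of_int a + z * ev z p"
  by (simp add: ev_def map_poly_pCons)

lemma ev2_pCons [simp]: "ev2 Y y (pCons a p) = ev Y a + y * ev2 Y y p"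
  by (simp add: ev2_def map_poly_pCons)

lemma V5_ev: "V5 (ev z p) = ev (V5 z) p"
  by (induction p) simp_all

lemma qderiv_ev: "qderiv (ev z p) = ev z (pderiv p) * qderiv z"
proof (induction p)
  case (pCons a p)
  have "qderiv (of_int a) = 0" for a by (simp add: qderiv_def)
  then show ?case using pCons by (simp add: qderiv_mult pderiv_pCons algebra_simps)
qed simp

text \<open>\<open>mod_poly\<close> is the minimal polynomial of \<open>y\<close> over the field generated by \<open>Y = y(5\<tau>)\<close>, as a polynomial in
  \<open>y\<close> whose coefficients are polynomials in \<open>Y\<close>.  The polynomials \<open>trace_poly1\<close> and \<open>trace_poly0\<close> represent
  \<open>y F P'(y) / (5 F(5\<tau>))\<close> and \<open>Z y F P'(y) / (5 F(5\<tau>))\<close>, where \<open>P\<close> is \<open>mod_poly\<close>.\<close>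

definition mod_poly :: "int poly poly" where
  "mod_poly = [:[:0, -1, -20, -150, -500, -625:],
     [:0, -15, -305, -2325, -7875, -10000:],
     [:0, -85, -1750, -13525, -46500, -60000:],
     [:0, -215, -4475, -35000, -122000, -160000:],
     [:0, -205, -4300, -34000, -120000, -160000:], 1:]"

definition trace_poly1 :: "int poly poly" where
  "trace_poly1 = [:[:0, 1, 40, 530, 3200, 9125, 10000:],
     [:0, 11, 450, 6075, 37300, 108000, 120000:],
     [:0, 41, 1700, 23275, 145000, 426000, 480000:],
     [:0, 51, 2150, 29800, 188000, 560000, 640000:],
     [:0, 1:]:]"

definition trace_poly0 :: "int poly poly" where
  "trace_poly0 = [:[:0, 0, -5, -95, -675, -2125, -2500:],
     [:0, 0, -60, -1140, -8100, -25500, -30000:],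
     [:0, 1, -226, -4495, -32300, -102000, -120000:],
     [:0, 5, -260, -5820, -42800, -136000, -160000:],
     [:0, 5, 20:]:]"

abbreviation Ypoly :: "int poly poly" where "Ypoly \<equiv> [:[:0, 1:]:]"
abbreviation ypoly :: "int poly poly" where "ypoly \<equiv> [:0, 1:]"

text \<open>Here \<open>u = (1 + 5 Y) (1 + 4 y) = s y\<close>.\<close>

abbreviation upoly :: "int poly poly" where "upoly \<equiv> (1 + 5 * Ypoly) * (1 + 4 * ypoly)"

lemma ev2_generators: "ev2 Y y Ypoly = Y" "ev2 Y y ypoly = y"
  by simp_all

text \<open>The left side is the quintic for s from \<open>modular_relations_algebra\<close>,
  multiplied by y^5 and rewritten with u = s y.\<close>

lemma mod_poly_identity:
  "Ypoly * upoly ^ 5 - 5 * (Ypoly * (1 + 4 * Ypoly)) * (upoly ^ 4 * ypoly - upoly ^ 3 * ypoly ^ 2 + upoly ^ 2 * ypoly ^ 3 - upoly * ypoly ^ 4)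
     - (1 + 5 * Ypoly) * (1 + 4 * Ypoly) * ypoly ^ 5 = - (1 + 5 * Ypoly) * mod_poly"
  by (simp add: mod_poly_def numeral_poly one_pCons eval_nat_numeral)

text \<open>Differentiating P(Y, y) = 0 gives y (1 + 4 y) F P_y = - 5 Y (1 + 4 Y) F(5\<tau>) P_Y.
  The multiple 4 Y P makes the right side divisible by 1 + 4 y, and the quotient is
  \<open>trace_poly1\<close>.\<close>

lemma trace_poly1_identity:
  "(1 + 4 * ypoly) * trace_poly1 = 4 * Ypoly * mod_poly - Ypoly * (1 + 4 * Ypoly) * map_poly pderiv mod_poly"
  by (simp add: mod_poly_def trace_poly1_def numeral_poly one_pCons map_poly_pCons pderiv_pCons)

text \<open>This is \<open>Zq_trace0\<close> with Z = 1 / (s A), where A is replaced by means of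
  \<open>Aq_sq\<close>, A^2 by the second of \<open>sq_relations\<close>, and s y by u. The explicit
  cofactor on the right shows that the difference is a multiple of the modular equation.\<close>

lemma trace_poly0_identity:
  "trace_poly1 * (1 + 4 * Ypoly) * ypoly ^ 2 * ((ypoly + upoly) * (ypoly ^ 2 - 3 * upoly * ypoly + upoly ^ 2))
    - trace_poly0 * upoly ^ 2 * (upoly ^ 2 * (1 + 5 * Ypoly) + 5 * ypoly ^ 3 * (1 + 4 * Ypoly)) =
   [:[:0, -5, -120, -1150, -5500, -13125, -12500:], [:0, -65, -1535, -14475, -68125, -160000, -150000:],
     [:0, -300, -6880, -63020, -288200, -658000, -600000:], [:0, -575, -12275, -104600, -444800, -944000, -800000:],
     [:0, -375, -6500, -42000, -120000, -128000:]:] * mod_poly"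
  by (simp add: mod_poly_def trace_poly1_def trace_poly0_def numeral_poly one_pCons eval_nat_numeral)

section \<open>Eta quotients of level 50\<close>

lemma V5_divide: "V5 (f / g) = V5 f / V5 g"
proof (cases "g = 0")
  case False
  then have "V5 g \<noteq> 0" using V5_inject[of g 0] by simp
  moreover have "V5 (f / g) * V5 g = V5 f" using False by (simp flip: fls_compose_power_mult)
  ultimately show ?thesis by (simp add: eq_divide_eq)
qed simp

lemma V5_X: "V5 fls_X = fls_X ^ 5"
  by (simp add: fls_X_power_conv_shift_1)

text \<open>As Dedekind eta quotients, \<open>Aq\<close> is \<eta>(\<tau>) / \<eta>(25\<tau>), and
  \<open>Bq\<close> is the same function at 2\<tau> and the reciprocal of Z.\<close>

definition Aq :: "complex fls" where "Aq = eta 1 / (fls_X * eta 25)"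
definition Bq :: "complex fls" where "Bq = eta 2 / (fls_X ^ 2 * eta 50)"

lemma Aq_Bq_nonzero [simp]: "Aq \<noteq> 0" "Bq \<noteq> 0"
  by (simp_all add: Aq_def Bq_def)

lemma Zq_Bq: "Zq = 1 / Bq"
  by (simp add: Zq_eq Bq_def)

lemma V5_xq: "V5 xq = fls_X ^ 5 * (eta 5 * eta 50 ^ 5) / (eta 10 * eta 25 ^ 5)"
  and V5_yq: "V5 yq = fls_X ^ 5 * (eta 10 * eta 50 ^ 3) / (eta 5 ^ 3 * eta 25)"
  unfolding xq_def yq_eq by (simp_all add: V5_divide V5_X V5_eta)

lemma V5_xq_yq: "V5 xq = V5 yq * (1 - 4 * V5 xq)"
  by (subst xq_yq) simp

lemma one_plus_V5_xq: "(1 + V5 xq) * (eta 5 * eta 25 ^ 3) = eta 10 ^ 3 * eta 50"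
  using arg_cong[OF one_plus_xq, of V5] by (simp add: V5_eta)

text \<open>All factors are eta quotients, with 1 + x and 1 + X from \<open>one_plus_xq\<close> and
  1 - 4 X = X / Y from \<open>xq_yq\<close>; the two sides of each relation are then the same
  quotient.\<close>

lemma level_50_relations:
  shows "yq * Aq ^ 3 = (1 + V5 xq) * Bq"
    and "xq * (1 - 4 * V5 xq) * Bq = (1 + V5 xq) * Aq"
    and "(1 + xq) * Aq = Bq ^ 3 * V5 yq"
proof -
  have X1: "1 + V5 xq = eta 10 ^ 3 * eta 50 / (eta 5 * eta 25 ^ 3)"
    using one_plus_V5_xq by (simp add: eq_divide_eq)
  have x1: "1 + xq = eta 2 ^ 3 * eta 10 / (eta 1 * eta 5 ^ 3)"
    using one_plus_xq by (simp add: eq_divide_eq)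
  have X4: "1 - 4 * V5 xq = V5 xq / V5 yq"
    using V5_xq_yq V5_inject[of yq 0] by (simp add: eq_divide_eq mult.commute)
  have "q * (e2 * e10 ^ 3) / (e1 ^ 3 * e5) * (e1 / (q * e25)) ^ 3 =
      e10 ^ 3 * e50 / (e5 * e25 ^ 3) * (e2 / (q ^ 2 * e50))"
    and "q * (e1 * e10 ^ 5) / (e2 * e5 ^ 5) * (q ^ 5 * (e5 * e50 ^ 5) / (e10 * e25 ^ 5) / (q ^ 5 * (e10 * e50 ^ 3) / (e5 ^ 3 * e25)))
       * (e2 / (q ^ 2 * e50)) = e10 ^ 3 * e50 / (e5 * e25 ^ 3) * (e1 / (q * e25))"
    and "e2 ^ 3 * e10 / (e1 * e5 ^ 3) * (e1 / (q * e25)) = (e2 / (q ^ 2 * e50)) ^ 3 * (q ^ 5 * (e10 * e50 ^ 3) / (e5 ^ 3 * e25))"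
    if "q \<noteq> 0" "e1 \<noteq> 0" "e2 \<noteq> 0" "e5 \<noteq> 0" "e10 \<noteq> 0" "e25 \<noteq> 0" "e50 \<noteq> 0"
    for q e1 e2 e5 e10 e25 e50 :: "complex fls"
    using that by (simp_all add: divide_simps) (simp_all add: eval_nat_numeral ac_simps)
  note r = this
  show "yq * Aq ^ 3 = (1 + V5 xq) * Bq"
    unfolding X1 yq_eq Aq_def Bq_def by (rule r) simp_all
  show "xq * (1 - 4 * V5 xq) * Bq = (1 + V5 xq) * Aq"
    unfolding X4 X1 unfolding V5_xq V5_yq unfolding xq_def Aq_def Bq_def by (rule r) simp_all
  show "(1 + xq) * Aq = Bq ^ 3 * V5 yq"
    unfolding x1 unfolding V5_yq unfolding Aq_def Bq_def by (rule r) simp_all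
qed

definition sq :: "complex fls" where "sq = Bq / Aq"

lemma subdegree_eta [simp]: "k > 0 \<Longrightarrow> fls_subdegree (eta k) = 0"
  by (simp add: eta_def fls_subdegree_fls_to_fps)

lemma subdegree_yq: "fls_subdegree yq = 1"
  by (simp add: yq_eq fls_divide_subdegree fls_subdegree_pow)

text \<open>The poles of \<open>Aq\<close> and \<open>Bq\<close> at q = 0 have orders 1 and 2, so
  the functions cannot cancel.\<close>

lemma one_plus_sq: "1 + sq \<noteq> 0"
proof
  assume "1 + sq = 0"
  then have "Bq = - Aq" by (simp add: sq_def add_eq_0_iff divide_eq_eq)
  then have "fls_subdegree Bq = fls_subdegree Aq" by (metis fls_uminus_subdegree)
  then show False by (simp add: Aq_def Bq_def fls_divide_subdegree)
qed

lemma modular_relations_algebra: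
  fixes x y X Y A B s w :: "'a::field"
  assumes xy: "x = y * (1 - 4 * x)" and XY: "X = Y * (1 - 4 * X)" and r1: "y * A ^ 3 = (1 + X) * B"
    and r2: "x * (1 - 4 * X) * B = (1 + X) * A" and r3: "(1 + x) * A = B ^ 3 * Y"
    and nz: "A \<noteq> 0" "X \<noteq> 0" "Y \<noteq> 0" "y \<noteq> 0" and s: "s = B / A" and w: "w = 1 + 5 * Y"
    and s1: "1 + s \<noteq> 0"
  shows "s * y = w * (1 + 4 * y)"
    and "(1 + 4 * Y) * A ^ 2 = s * (s - 4 * w)"
    and "Y * s ^ 5 - 5 * (Y * (1 + 4 * Y)) * (s ^ 4 - s ^ 3 + s ^ 2 - s) - w * (1 + 4 * Y) = 0"
proof -
  have X4: "1 - 4 * X \<noteq> 0" using XY nz by auto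
  have Y4: "(1 + 4 * Y) * (1 - 4 * X) = 1" using XY by algebra
  have wX: "1 + X = w * (1 - 4 * X)" using XY w by algebra
  have B: "B = s * A" using s nz by simp
  have "(1 - 4 * X) * (A * (x * s)) = (1 - 4 * X) * (A * w)" using r2 wX B by algebra
  then have xs: "x * s = w" using X4 nz by simp
  have xy': "x * (1 + 4 * y) = y" using xy by algebra
  have "x * (s * y) = w * (x * (1 + 4 * y))" unfolding xy' xs[symmetric] by (simp only: ac_simps)
  then have "x * (s * y) = x * (w * (1 + 4 * y))" by (simp only: ac_simps)
  moreover have "x \<noteq> 0" using xy' nz by auto
  ultimately show sy: "s * y = w * (1 + 4 * y)" by simp
  have "A * (y * A ^ 2) = A * (w * (1 - 4 * X) * s)" using r1 wX B by algebra
  then have yA: "y * A ^ 2 = w * (1 - 4 * X) * s" using nz by simp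
  have "y * ((1 + 4 * Y) * A ^ 2) = (1 + 4 * Y) * (y * A ^ 2)" by (simp only: ac_simps)
  also have "\<dots> = ((1 + 4 * Y) * (1 - 4 * X)) * (w * s)" unfolding yA by (simp only: ac_simps)
  also have "\<dots> = s * (s * y - 4 * w * y)" unfolding Y4 sy by (simp add: algebra_simps)
  also have "\<dots> = y * (s * (s - 4 * w))" by (simp add: algebra_simps)
  finally have "y * ((1 + 4 * Y) * A ^ 2) = y * (s * (s - 4 * w))" .
  then show T: "(1 + 4 * Y) * A ^ 2 = s * (s - 4 * w)" using nz by simp
  have "A * (1 + x) = A * (s ^ 3 * A ^ 2 * Y)" using r3 B by algebra
  then have x1: "1 + x = s ^ 3 * A ^ 2 * Y" using nz by simp
  have "(1 + 4 * Y) * (s + w) = (1 + 4 * Y) * s * (1 + x)" unfolding xs[symmetric] by (simp add: algebra_simps)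
  also have "\<dots> = Y * s ^ 4 * ((1 + 4 * Y) * A ^ 2)" unfolding x1 by (simp add: eval_nat_numeral ac_simps)
  also have "\<dots> = Y * s ^ 5 * (s - 4 * w)" unfolding T by (simp add: eval_nat_numeral ac_simps)
  finally have "(1 + 4 * Y) * (s + w) = Y * s ^ 5 * (s - 4 * w)" .
  \<comment> \<open>Eliminating x, X and A leaves an equation of degree 6 in s. It has the
    extraneous root s = -1, and dividing by 1 + s gives the quintic.\<close>
  then have "(1 + s) * (Y * s ^ 5 - 5 * (Y * (1 + 4 * Y)) * (s ^ 4 - s ^ 3 + s ^ 2 - s) - w * (1 + 4 * Y)) = 0"
    using w by algebra
  then show "Y * s ^ 5 - 5 * (Y * (1 + 4 * Y)) * (s ^ 4 - s ^ 3 + s ^ 2 - s) - w * (1 + 4 * Y) = 0"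
    using s1 by (metis mult_eq_0_iff)
qed

lemma V5_yq_nonzero [simp]: "V5 yq \<noteq> 0" and V5_xq_nonzero [simp]: "V5 xq \<noteq> 0"
  using V5_inject[of yq 0] V5_inject[of xq 0] by auto

lemmas sq_relations = modular_relations_algebra[OF xq_yq V5_xq_yq level_50_relations Aq_Bq_nonzero(1)
  V5_xq_nonzero V5_yq_nonzero yq_nonzero sq_def refl one_plus_sq]

theorem modular_equation: "ev2 (V5 yq) yq mod_poly = 0"
proof -
  let ?Y = "V5 yq" and ?w = "1 + 5 * V5 yq" and ?u = "(1 + 5 * V5 yq) * (1 + 4 * yq)"
  have "- ?w * ev2 ?Y yq mod_poly = ?Y * ?u ^ 5 - 5 * (?Y * (1 + 4 * ?Y)) * (?u ^ 4 * yq - ?u ^ 3 * yq ^ 2 + ?u ^ 2 * yq ^ 3 - ?u * yq ^ 4)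
     - ?w * (1 + 4 * ?Y) * yq ^ 5"
    using arg_cong[OF mod_poly_identity, of "ev2 ?Y yq"] by (simp only: ev2_simps ev2_generators)
  also have "\<dots> = yq ^ 5 * (?Y * sq ^ 5 - 5 * (?Y * (1 + 4 * ?Y)) * (sq ^ 4 - sq ^ 3 + sq ^ 2 - sq) - ?w * (1 + 4 * ?Y))"
    unfolding sq_relations(1)[symmetric] by (simp add: algebra_simps eval_nat_numeral)
  also have "\<dots> = 0" unfolding sq_relations(3) by simp
  finally have "- ?w = 0 \<or> ev2 ?Y yq mod_poly = 0" by (simp only: mult_eq_0_iff)
  moreover have "?w \<noteq> 0"
  proof
    assume "?w = 0"
    then have "fls_nth ?w 0 = 0" by simp
    then show False using subdegree_yq by (simp add: fls_nth_compose_power)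
  qed
  ultimately show ?thesis by (simp only: neg_equal_0_iff_equal simp_thms)
qed

text \<open>Squaring both sides reduces this to the relations above; the sign is read off the leading coefficients.\<close>

lemma Aq_sq: "Aq * ((1 + sq) * (1 - 3 * sq + sq ^ 2)) = Aq ^ 2 * sq ^ 2 + 5 * sq"
  and sq_factor_nonzero: "(1 + sq) * (1 - 3 * sq + sq ^ 2) \<noteq> 0"
proof -
  let ?D = "(1 + sq) * (1 - 3 * sq + sq ^ 2)" and ?E = "Aq ^ 2 * sq ^ 2 + 5 * sq"
  have "(1 + 4 * Y) ^ 2 * (A ^ 2 * D ^ 2 - E ^ 2) = 0"
    if "(1 + 4 * Y) * A ^ 2 = s * (s - 4 * w)" "w = 1 + 5 * Y"
      "Y * s ^ 5 - 5 * (Y * (1 + 4 * Y)) * (s ^ 4 - s ^ 3 + s ^ 2 - s) - w * (1 + 4 * Y) = 0"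
      "D = (1 + s) * (1 - 3 * s + s ^ 2)" "E = A ^ 2 * s ^ 2 + 5 * s"
    for A Y s w D E :: "complex fls"
  proof -
    define T where "T = s * (s - 4 * w)"
    have "(1 + 4 * Y) ^ 2 * (A ^ 2 * D ^ 2 - E ^ 2) = (1 + 4 * Y) * T * D ^ 2 - (T * s ^ 2 + 5 * s * (1 + 4 * Y)) ^ 2"
      using that(1,5) unfolding T_def by algebra
    also have "\<dots> = (4 * s + 8 * s ^ 2 + 4 * s ^ 3) * (Y * s ^ 5 - 5 * (Y * (1 + 4 * Y)) * (s ^ 4 - s ^ 3 + s ^ 2 - s) - w * (1 + 4 * Y))"
      unfolding T_def that(2,4) by algebra
    finally show ?thesis using that(3) by simp
  qed
  from this[OF sq_relations(2) refl sq_relations(3) refl refl]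
  have "(1 + 4 * V5 yq) ^ 2 * ((Aq * ?D - ?E) * (Aq * ?D + ?E)) = 0" by (simp add: algebra_simps power2_eq_square)
  moreover have "1 + 4 * V5 yq \<noteq> 0"
  proof
    assume "1 + 4 * V5 yq = 0"
    then have "fls_nth (1 + 4 * V5 yq) 0 = 0" by simp
    then show False using subdegree_yq by (simp add: fls_nth_compose_power)
  qed
  moreover have "Aq * ?D + ?E \<noteq> 0" "?D \<noteq> 0"
  proof -
    \<comment> \<open>Multiplication by q^4 a2^2 b2^3 turns the sum into a power series g. The terms
      A D and A^2 s^2 each contribute 1 to its constant coefficient, so it is 2; with the other sign
      these contributions would cancel.\<close>
    define a1 a2 where "a1 = euler 1" and "a2 = euler 25"
    define b1 b2 where "b1 = euler 2 * euler 25" and "b2 = euler 50 * euler 1"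
    have c: "fps_nth a1 0 = 1" "fps_nth a2 0 = 1" "fps_nth b1 0 = 1" "fps_nth b2 0 = 1"
      by (simp_all add: a1_def a2_def b1_def b2_def fps_mult_nth_0)
    have A: "fls_X * fps_to_fls a2 * Aq = fps_to_fls a1"
      by (simp add: Aq_def a1_def a2_def eta_def[symmetric])
    have S: "fls_X * fps_to_fls b2 * sq = fps_to_fls b1"
      by (simp add: Aq_def Bq_def sq_def b1_def b2_def eta_def[symmetric] fls_times_fps_to_fls power2_eq_square)
    let ?f = "fps_to_fls :: complex fps \<Rightarrow> complex fls"
    have X: "fls_X = ?f fps_X" by simp
    define d where "d = (fps_X * b2 + b1) * ((fps_X * b2) ^ 2 - 3 * (fps_X * b2 * b1) + b1 ^ 2)"
    have D: "(fls_X * ?f b2) ^ 3 * ?D = ?f d"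
    proof -
      have "(z * b2) ^ 3 * ((1 + s) * (1 - 3 * s + s ^ 2)) = (z * b2 + b1) * ((z * b2) ^ 2 - 3 * (z * b2 * b1) + b1 ^ 2)"
        if "z * b2 * s = b1" for z b2 b1 s :: "complex fls"
        unfolding that[symmetric] by (simp add: algebra_simps eval_nat_numeral)
      from this[OF S] show ?thesis unfolding d_def X
        by (simp add: fls_times_fps_to_fls fps_to_fls_power fps_to_fls_plus fps_to_fls_minus)
    qed
    have "fps_nth d 0 = 1" unfolding d_def using c by (simp add: fps_mult_nth_0 fps_power_zeroth)
    then have "?f d \<noteq> 0" by (metis fps_to_fls_eq_0_iff fps_zero_nth zero_neq_one)
    then show "?D \<noteq> 0" using D by auto
    define g where "g = a1 * a2 * d + a1 ^ 2 * b1 ^ 2 * b2 + 5 * (fps_X ^ 3 * a2 ^ 2 * b1 * b2 ^ 2)"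
    have "fls_X * (?f a2) ^ 2 * (fls_X * ?f b2) ^ 3 * (Aq * ?D + ?E) = ?f g"
    proof -
      have "z * a2 ^ 2 * (z * b2) ^ 3 * (A * D + (A ^ 2 * s ^ 2 + 5 * s)) = a1 * a2 * d + a1 ^ 2 * b1 ^ 2 * b2 + 5 * (z ^ 3 * a2 ^ 2 * b1 * b2 ^ 2)"
        if "z * b2 * s = b1" "z * a2 * A = a1" "(z * b2) ^ 3 * D = d" for z b2 b1 s a1 a2 A D d :: "complex fls"
      proof -
        have "z * a2 ^ 2 * (z * b2) ^ 3 * (A * D) = a1 * a2 * d"
          unfolding that[symmetric] by (simp add: eval_nat_numeral ac_simps)
        moreover have "z * a2 ^ 2 * (z * b2) ^ 3 * (A ^ 2 * s ^ 2) = a1 ^ 2 * b1 ^ 2 * b2"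
        proof -
          have "z * a2 ^ 2 * (z * b2) ^ 3 * (A ^ 2 * s ^ 2) = (z * a2 * A) ^ 2 * (z * b2 * s) ^ 2 * b2"
            by (simp add: eval_nat_numeral ac_simps)
          then show ?thesis using that by simp
        qed
        moreover have "z * a2 ^ 2 * (z * b2) ^ 3 * (5 * s) = 5 * (z ^ 3 * a2 ^ 2 * b1 * b2 ^ 2)"
          unfolding that(1)[symmetric] by (simp add: eval_nat_numeral ac_simps)
        ultimately show ?thesis by (simp add: distrib_left)
      qed
      from this[OF S A D] show ?thesis unfolding g_def X
        by (simp add: fls_times_fps_to_fls fps_to_fls_power fps_to_fls_plus fps_to_fls_minus)
    qed
    moreover have "fps_nth g 0 = 2" unfolding g_def using c \<open>fps_nth d 0 = 1\<close> by (simp add: fps_mult_nth_0 fps_power_zeroth)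
    then have "?f g \<noteq> 0" by (metis fps_to_fls_eq_0_iff fps_zero_nth zero_neq_numeral)
    ultimately show "Aq * ?D + ?E \<noteq> 0" by auto
  qed
  ultimately show "Aq * ?D = ?E" "?D \<noteq> 0" by auto
qed

section \<open>The derivative of y and the traces of its powers\<close>

lemma qderiv_yq: "qderiv yq = yq * (1 + 4 * yq) * Fq"
proof -
  have F: "qderiv xq = Fq * xq" by (simp add: Fq_eq dlog_def)
  have "qderiv xq = qderiv (yq * (1 - 4 * xq))" using xq_yq by simp
  also have "\<dots> = qderiv yq * (1 - 4 * xq) - 4 * yq * qderiv xq"
    by (simp add: qderiv_mult algebra_simps)
  finally have "Fq * xq * (1 + 4 * yq) = qderiv yq * (1 - 4 * xq)" unfolding F by (simp add: algebra_simps)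
  then have "Fq * xq * (1 + 4 * yq) * yq = qderiv yq * (yq * (1 - 4 * xq))" by (simp only: ac_simps)
  then have "xq * (yq * (1 + 4 * yq) * Fq) = xq * qderiv yq" unfolding xq_yq[symmetric] by (simp only: ac_simps)
  then show ?thesis by simp
qed

lemma qderiv_ev2:
  "qderiv (ev2 Y y R) = ev2 Y y (map_poly pderiv R) * qderiv Y + ev2 Y y (pderiv R) * qderiv y"
  by (induction R) (simp_all add: qderiv_mult qderiv_ev map_poly_pCons pderiv_pCons algebra_simps)

definition dmod :: "complex fls" where "dmod = ev2 (V5 yq) yq (pderiv mod_poly)"

lemma one_plus_4_yq_nonzero: "1 + 4 * yq \<noteq> 0" and one_plus_5_yq_nonzero [simp]: "1 + 5 * yq \<noteq> 0"
proof -
  have "fls_nth yq 0 = 0" using subdegree_yq by simp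
  then have "fls_nth (1 + 4 * yq) 0 = 1" "fls_nth (1 + 5 * yq) 0 = 1" by simp_all
  then show "1 + 4 * yq \<noteq> 0" "1 + 5 * yq \<noteq> 0" by (metis fls_zero_nth zero_neq_one)+
qed

text \<open>The 5 comes from the chain rule for q \<mapsto> q^5. It cancels the fifth in front of
  the trace, which keeps all later values integral.\<close>

lemma Fq_trace1: "yq * Fq * dmod = 5 * (V5 Fq * ev2 (V5 yq) yq trace_poly1)"
proof -
  let ?Y = "V5 yq" and ?PY = "ev2 (V5 yq) yq (map_poly pderiv mod_poly)" and ?G = "ev2 (V5 yq) yq trace_poly1"
  have DY: "qderiv ?Y = 5 * (?Y * (1 + 4 * ?Y) * V5 Fq)"
    unfolding qderiv_V5 qderiv_yq by simp
  have "?PY * qderiv ?Y + dmod * qderiv yq = 0"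
    using qderiv_ev2[of ?Y yq mod_poly] modular_equation by (simp add: dmod_def)
  then have "dmod * qderiv yq = - (?PY * qderiv ?Y)" by (metis add.commute eq_neg_iff_add_eq_0)
  then have "(1 + 4 * yq) * (yq * Fq * dmod) = - (?Y * (1 + 4 * ?Y) * ?PY) * (5 * V5 Fq)"
    unfolding DY qderiv_yq mult_minus_left by (simp only: ac_simps)
  also have "- (?Y * (1 + 4 * ?Y) * ?PY) = (1 + 4 * yq) * ?G"
    using arg_cong[OF trace_poly1_identity, of "ev2 ?Y yq"]
    by (simp only: ev2_simps ev2_generators modular_equation) simp
  finally have "(1 + 4 * yq) * (yq * Fq * dmod) = (1 + 4 * yq) * (5 * (V5 Fq * ?G))" by (simp only: ac_simps)
  then show ?thesis using one_plus_4_yq_nonzero by simp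
qed

lemma Zq_trace0: "Zq * ev2 (V5 yq) yq trace_poly1 = ev2 (V5 yq) yq trace_poly0"
proof -
  let ?Y = "V5 yq" and ?G = "ev2 (V5 yq) yq trace_poly1" and ?H = "ev2 (V5 yq) yq trace_poly0"
  have "(1 + 4 * Y) * y ^ 5 * D * G = (1 + 4 * Y) * y ^ 5 * D * (G0 * (s * A))"
    if "G * (1 + 4 * Y) * y ^ 2 * ((y + w * (1 + 4 * y)) * (y ^ 2 - 3 * (w * (1 + 4 * y)) * y + (w * (1 + 4 * y)) ^ 2))
      - G0 * (w * (1 + 4 * y)) ^ 2 * ((w * (1 + 4 * y)) ^ 2 * w + 5 * y ^ 3 * (1 + 4 * Y)) = 0"
      "D = (1 + s) * (1 - 3 * s + s ^ 2)" "s * y = w * (1 + 4 * y)" "A * D = A ^ 2 * s ^ 2 + 5 * s"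
      "(1 + 4 * Y) * A ^ 2 = s * (s - 4 * w)"
    for Y y w s D A G G0 :: "complex fls"
  proof -
    \<comment> \<open>The relation s y = w (1 + 4 y) solved for a single w; substituting it below
      supplies the missing y, so that y^5 can be taken out.\<close>
    have w: "w = (s - 4 * w) * y" using that(3) by (simp add: algebra_simps)
    have "(1 + 4 * Y) * y ^ 5 * D * G = G * (1 + 4 * Y) * y ^ 2 * ((y + s * y) * (y ^ 2 - 3 * (s * y) * y + (s * y) ^ 2))"
      unfolding that(2) by (simp add: eval_nat_numeral algebra_simps)
    also have "\<dots> = G0 * (s * y) ^ 2 * ((s * y) ^ 2 * w + 5 * y ^ 3 * (1 + 4 * Y))"
      using that(1) unfolding that(3) by simp
    also have "\<dots> = G0 * (s * y) ^ 2 * ((s * y) ^ 2 * ((s - 4 * w) * y) + 5 * y ^ 3 * (1 + 4 * Y))"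
      using w by simp
    also have "\<dots> = y ^ 5 * (G0 * s) * ((s * (s - 4 * w)) * s ^ 2 + 5 * s * (1 + 4 * Y))"
      by (simp add: eval_nat_numeral algebra_simps)
    also have "\<dots> = (1 + 4 * Y) * y ^ 5 * (G0 * s) * (A ^ 2 * s ^ 2 + 5 * s)"
      unfolding that(5)[symmetric] by (simp add: algebra_simps)
    also have "\<dots> = (1 + 4 * Y) * y ^ 5 * D * (G0 * (s * A))"
      unfolding that(4)[symmetric] by (simp only: ac_simps)
    finally show ?thesis .
  qed
  moreover have "?G * (1 + 4 * ?Y) * yq ^ 2 * ((yq + (1 + 5 * ?Y) * (1 + 4 * yq)) * (yq ^ 2 - 3 * ((1 + 5 * ?Y) * (1 + 4 * yq)) * yq + ((1 + 5 * ?Y) * (1 + 4 * yq)) ^ 2))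
      - ?H * ((1 + 5 * ?Y) * (1 + 4 * yq)) ^ 2 * (((1 + 5 * ?Y) * (1 + 4 * yq)) ^ 2 * (1 + 5 * ?Y) + 5 * yq ^ 3 * (1 + 4 * ?Y)) = 0"
    using arg_cong[OF trace_poly0_identity, of "ev2 ?Y yq"]
    by (simp only: ev2_simps ev2_generators modular_equation mult_zero_right)
  ultimately have "(1 + 4 * ?Y) * yq ^ 5 * ((1 + sq) * (1 - 3 * sq + sq ^ 2)) * ?G =
      (1 + 4 * ?Y) * yq ^ 5 * ((1 + sq) * (1 - 3 * sq + sq ^ 2)) * (?H * (sq * Aq))"
    using sq_relations(1,2) Aq_sq by blast
  moreover have "1 + 4 * ?Y \<noteq> 0" using one_plus_4_yq_nonzero V5_inject[of "1 + 4 * yq" 0] by simp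
  then have "(1 + 4 * ?Y) * yq ^ 5 * ((1 + sq) * (1 - 3 * sq + sq ^ 2)) \<noteq> 0" using sq_factor_nonzero by simp
  ultimately have "?G = ?H * (sq * Aq)" unfolding mult_cancel_left by blast
  moreover have "sq * Aq = Bq" by (simp add: sq_def)
  ultimately show ?thesis by (simp add: Zq_Bq)
qed

text \<open>The trace of y^k / P'(y): Euler's formula gives the values for k < 5, the modular
  equation the rest. Its coefficients are polynomials in Y and leave \<open>U5\<close> as the same
  polynomials in y.\<close>

fun power_trace :: "nat \<Rightarrow> int poly" where
  "power_trace 0 = 0"
| "power_trace (Suc 0) = 0"
| "power_trace (Suc (Suc 0)) = 0"
| "power_trace (Suc (Suc (Suc 0))) = 0"
| "power_trace (Suc (Suc (Suc (Suc 0)))) = 1"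
| "power_trace (Suc (Suc (Suc (Suc (Suc k))))) =
     - (coeff mod_poly 0 * power_trace k + coeff mod_poly 1 * power_trace (Suc k) +
        coeff mod_poly 2 * power_trace (Suc (Suc k)) + coeff mod_poly 3 * power_trace (Suc (Suc (Suc k))) +
        coeff mod_poly 4 * power_trace (Suc (Suc (Suc (Suc k)))))"

fun poly_trace :: "nat \<Rightarrow> int poly list \<Rightarrow> int poly" where
  "poly_trace k [] = 0"
| "poly_trace k (a # as) = a * power_trace k + poly_trace (Suc k) as"

lemma ev2_mod_poly:
  "ev2 Y y mod_poly = ev Y (coeff mod_poly 0) + ev Y (coeff mod_poly 1) * y + ev Y (coeff mod_poly 2) * y ^ 2
     + ev Y (coeff mod_poly 3) * y ^ 3 + ev Y (coeff mod_poly 4) * y ^ 4 + y ^ 5"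
proof -
  have "mod_poly = [:coeff mod_poly 0, coeff mod_poly 1, coeff mod_poly 2, coeff mod_poly 3, coeff mod_poly 4, 1:]"
    by (simp add: mod_poly_def eval_nat_numeral)
  then have "ev2 Y y mod_poly = ev2 Y y [:coeff mod_poly 0, coeff mod_poly 1, coeff mod_poly 2, coeff mod_poly 3, coeff mod_poly 4, 1:]"
    by (rule arg_cong)
  also have "\<dots> = ev Y (coeff mod_poly 0) + ev Y (coeff mod_poly 1) * y + ev Y (coeff mod_poly 2) * y ^ 2
     + ev Y (coeff mod_poly 3) * y ^ 3 + ev Y (coeff mod_poly 4) * y ^ 4 + y ^ 5"
    by (simp only: ev2_pCons ev2_simps ev_simps) (simp add: eval_nat_numeral algebra_simps)
  finally show ?thesis .
qed

lemma U5_uminus: "U5 (- f) = - U5 (f :: complex fls)"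
  by (auto intro!: fls_eqI simp: U5_nth)

lemma ring_map_of_nat: "ring_map h \<Longrightarrow> h (of_nat n) = of_nat n"
  by (induction n) (simp_all add: ring_mapD)

lemma pderiv_map_poly:
  assumes "ring_map h"
  shows "pderiv (map_poly h R) = map_poly h (pderiv R)"
  by (rule poly_eqI)
    (simp add: coeff_map_poly coeff_pderiv ring_mapD[OF assms] ring_map_of_nat[OF assms] del: of_nat_Suc)

lemma dmod_nonzero [simp]: "dmod \<noteq> 0"
  and U5_power_trace: "U5 (5 * (yq ^ k / dmod)) = ev yq (power_trace k)"
proof -
  define P where "P = map_poly (ev (V5 yq)) mod_poly"
  have P5: "coeff P 5 = 1" and deg: "degree P = 5"
  proof -
    have "P = [:ev (V5 yq) (coeff mod_poly 0), ev (V5 yq) (coeff mod_poly 1), ev (V5 yq) (coeff mod_poly 2),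
       ev (V5 yq) (coeff mod_poly 3), ev (V5 yq) (coeff mod_poly 4), 1:]"
      unfolding P_def mod_poly_def by (simp add: map_poly_pCons eval_nat_numeral del: ev_pCons)
    then show "coeff P 5 = 1" "degree P = 5" by (simp_all add: eval_nat_numeral)
  qed
  have coeffs: "coeff P i \<in> range V5" for i
    unfolding P_def by (simp add: coeff_map_poly flip: V5_ev)
  have root: "poly P yq = 0" using modular_equation by (simp add: P_def ev2_def)
  have dmod: "dmod = poly (pderiv P) yq"
    unfolding dmod_def ev2_def P_def pderiv_map_poly[OF ring_map_ev] ..
  have "lead_coeff P = 1" using P5 deg by simp
  note tr = U5_euler_trace[OF deg this coeffs root subdegree_yq, folded dmod]
  from tr(1)[of 0] show "dmod \<noteq> 0" by simp
  show "U5 (5 * (yq ^ k / dmod)) = ev yq (power_trace k)"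
  proof (induction k rule: power_trace.induct)
    case (6 k)
    let ?a = "\<lambda>i. ev (V5 yq) (coeff mod_poly i)"
    have "yq ^ 5 = - (?a 0 + ?a 1 * yq + ?a 2 * yq ^ 2 + ?a 3 * yq ^ 3 + ?a 4 * yq ^ 4)"
      using modular_equation unfolding ev2_mod_poly by (metis add.commute eq_neg_iff_add_eq_0)
    have "5 * (yq ^ (k + 5) / dmod) = 5 / dmod * yq ^ k * yq ^ 5" by (simp add: power_add)
    also have "\<dots> = - (?a 0 * (5 / dmod * yq ^ k) + ?a 1 * (5 / dmod * (yq ^ k * yq)) + ?a 2 * (5 / dmod * (yq ^ k * yq ^ 2))
         + ?a 3 * (5 / dmod * (yq ^ k * yq ^ 3)) + ?a 4 * (5 / dmod * (yq ^ k * yq ^ 4)))"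
      unfolding \<open>yq ^ 5 = _\<close> by (simp only: distrib_left mult_minus_right ac_simps)
    also have "\<dots> = - (?a 0 * (5 * (yq ^ k / dmod)) + ?a 1 * (5 * (yq ^ Suc k / dmod)) + ?a 2 * (5 * (yq ^ Suc (Suc k) / dmod))
         + ?a 3 * (5 * (yq ^ Suc (Suc (Suc k)) / dmod)) + ?a 4 * (5 * (yq ^ Suc (Suc (Suc (Suc k))) / dmod)))"
      by (simp add: eval_nat_numeral ac_simps)
    finally have "U5 (5 * (yq ^ (k + 5) / dmod)) = ev yq (power_trace (Suc (Suc (Suc (Suc (Suc k))))))"
      by (simp only: power_trace.simps U5_uminus U5_add U5_V5_mult V5_ev[symmetric] 6 ev_simps)
    moreover have "k + 5 = Suc (Suc (Suc (Suc (Suc k))))" by simp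
    ultimately show ?case by (simp only:)
  qed (use tr(2)[of 0] tr(2)[of 1] tr(2)[of 2] tr(2)[of 3] tr(2)[of 4] in \<open>simp_all add: eval_nat_numeral\<close>)
qed

lemma U5_poly_trace:
  "U5 (5 * (yq ^ k * ev2 (V5 yq) yq (Poly as) / dmod)) = ev yq (poly_trace k as)"
proof (induction as arbitrary: k)
  case (Cons a as)
  have e: "5 * (yq ^ k * ev2 (V5 yq) yq (Poly (a # as)) / dmod) =
     V5 (ev yq a) * (5 * (yq ^ k / dmod)) + 5 * (yq ^ Suc k * ev2 (V5 yq) yq (Poly as) / dmod)"
    by (simp add: V5_ev field_simps)
  show ?case by (simp only: e U5_add U5_V5_mult U5_power_trace Cons poly_trace.simps ev_simps)
qed simp

text \<open>One factor y is absorbed by the trace polynomials, whence the shift from k + 1 to k and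
  the restriction to positive powers of y.\<close>

lemma U1_yq_power: "U1 (yq ^ Suc k) = ev yq (poly_trace k (coeffs trace_poly1))"
  and U0_yq_power: "U0 (yq ^ Suc k) = ev yq (poly_trace k (coeffs trace_poly0))"
proof -
  let ?G = "ev2 (V5 yq) yq trace_poly1" and ?H = "ev2 (V5 yq) yq trace_poly0"
  have F: "Fq * yq ^ Suc k = V5 Fq * (5 * (yq ^ k * ?G / dmod))"
  proof -
    have "Fq * yq ^ Suc k = yq ^ k * (yq * Fq * dmod) / dmod" by simp
    then show ?thesis unfolding Fq_trace1 by (simp add: ac_simps)
  qed
  have "U5 (Fq * yq ^ Suc k) = Fq * ev yq (poly_trace k (coeffs trace_poly1))"
    unfolding F U5_V5_mult using U5_poly_trace[of k "coeffs trace_poly1"] by simp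
  then show "U1 (yq ^ Suc k) = ev yq (poly_trace k (coeffs trace_poly1))"
    unfolding U1_def by (simp only: nonzero_mult_div_cancel_left[OF Fq_nonzero])
  have "Fq * Zq * yq ^ Suc k = Zq * (V5 Fq * (5 * (yq ^ k * ?G / dmod)))"
    unfolding F[symmetric] by (simp only: ac_simps)
  also have "\<dots> = V5 Fq * (5 * (yq ^ k * (Zq * ?G) / dmod))" by (simp add: ac_simps)
  finally have Z: "Fq * Zq * yq ^ Suc k = V5 Fq * (5 * (yq ^ k * ?H / dmod))" unfolding Zq_trace0 .
  have "U5 (Fq * Zq * yq ^ Suc k) = Fq * ev yq (poly_trace k (coeffs trace_poly0))"
    unfolding Z U5_V5_mult using U5_poly_trace[of k "coeffs trace_poly0"] by simp
  then show "U0 (yq ^ Suc k) = ev yq (poly_trace k (coeffs trace_poly0))"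
    unfolding U0_def by (simp only: nonzero_mult_div_cancel_left[OF Fq_nonzero])
qed

section \<open>Recurrences\<close>

text \<open>The recurrences depend only on this property, so they are derived once for both
  operators.\<close>

definition V5_linear :: "(complex fls \<Rightarrow> complex fls) \<Rightarrow> bool" where
  "V5_linear U \<longleftrightarrow> (\<forall>f g. U (f + g) = U f + U g) \<and> (\<forall>f g. U (V5 f * g) = f * U g)"

lemma V5_linear_U1: "V5_linear U1"
proof -
  have c: "Fq * (V5 f * g) = V5 f * (Fq * g)" for f g by (simp only: ac_simps)
  show ?thesis
    unfolding V5_linear_def U1_def
    by (simp only: c distrib_left U5_add add_divide_distrib U5_V5_mult times_divide_eq_right simp_thms)
qed

lemma V5_linear_U0: "V5_linear U0"
proof -
  have c: "Fq * Zq * (V5 f * g) = V5 f * (Fq * Zq * g)" for f g by (simp only: ac_simps)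
  show ?thesis
    unfolding V5_linear_def U0_def
    by (simp only: c distrib_left U5_add add_divide_distrib U5_V5_mult times_divide_eq_right simp_thms)
qed

definition wq :: "complex fls" where "wq = 1 + 5 * yq"

definition wpoly :: "int poly" where "wpoly = [:1, 5:]"

lemma wq_nonzero [simp]: "wq \<noteq> 0"
  by (simp add: wq_def)

lemma ev_wpoly [simp]: "ev yq wpoly = wq"
  by (simp add: wpoly_def wq_def)

text \<open>Index k belongs to w^k in the equation of w over Y. Entry 0 is a placeholder: the
  constant coefficient -(1 + 5 Y)^5 is treated separately to keep it a fifth power.\<close>

definition wcoeff :: "nat \<Rightarrow> int poly" where
  "wcoeff k = [0, [:5, -150, -2750, -16875, -46875, -50000:], [:-10, -650, -12125, -85625, -262500, -300000:],
     [:10, -1275, -25875, -195000, -650000, -800000:], [:-5, -1025, -21500, -170000, -600000, -800000:]] ! k"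

text \<open>The constant coefficient of the minimal polynomial of \<open>w = 1 + 5 y\<close> is \<open>-w(5\<tau>)\<^sup>5\<close>; this is why negative
  powers of \<open>w\<close> only produce negative powers of \<open>w\<close>.\<close>

lemma wpoly_identity:
  "(1 + 5 * ypoly) ^ 5 + [:wcoeff 4:] * (1 + 5 * ypoly) ^ 4 + [:wcoeff 3:] * (1 + 5 * ypoly) ^ 3 +
     [:wcoeff 2:] * (1 + 5 * ypoly) ^ 2 + [:wcoeff 1:] * (1 + 5 * ypoly) - (1 + 5 * Ypoly) ^ 5 = 3125 * mod_poly"
  by (simp add: mod_poly_def wcoeff_def numeral_poly one_pCons eval_nat_numeral)

lemma wq_equation:
  "V5 wq ^ 5 = wq ^ 5 + ev (V5 yq) (wcoeff 4) * wq ^ 4 + ev (V5 yq) (wcoeff 3) * wq ^ 3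
     + ev (V5 yq) (wcoeff 2) * wq ^ 2 + ev (V5 yq) (wcoeff 1) * wq"
proof -
  have c: "ev2 (V5 yq) yq [:p:] = ev (V5 yq) p" for p by simp
  have "wq ^ 5 + ev (V5 yq) (wcoeff 4) * wq ^ 4 + ev (V5 yq) (wcoeff 3) * wq ^ 3
     + ev (V5 yq) (wcoeff 2) * wq ^ 2 + ev (V5 yq) (wcoeff 1) * wq - V5 wq ^ 5 = 0"
    using arg_cong[OF wpoly_identity, of "ev2 (V5 yq) yq"]
    by (simp only: ev2_simps ev2_generators c modular_equation mult_zero_right wq_def[symmetric])
      (simp add: wq_def)
  then show ?thesis by (simp only: right_minus_eq)
qed

definition Uval :: "(complex fls \<Rightarrow> complex fls) \<Rightarrow> nat \<Rightarrow> int \<Rightarrow> complex fls" where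
  "Uval U m n = U (yq ^ m / wq powi n)"

text \<open>The recurrence in n determines w^5 times the new value. After scaling by w^(5 n) its
  coefficients are polynomials in y, and the denominators of the final formulas become factors w^4
  and w^2.\<close>

definition Uscaled :: "(complex fls \<Rightarrow> complex fls) \<Rightarrow> nat \<Rightarrow> int \<Rightarrow> complex fls" where
  "Uscaled U m n = wq powi (5 * n) * Uval U m n"

lemma V5_linearD:
  assumes "V5_linear U"
  shows "U (f + g) = U f + U g" "U (V5 f * g) = f * U g" "U (ev (V5 yq) p * g) = ev yq p * U g"
    "U (5 * f) = 5 * U f"
proof -
  show "U (f + g) = U f + U g" and *: "U (V5 f * g) = f * U g" for f g
    using assms by (auto simp: V5_linear_def)
  show "U (ev (V5 yq) p * g) = ev yq p * U g" using *[of "ev yq p" g] by (simp add: V5_ev)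
  show "U (5 * f) = 5 * U f" using *[of 5 f] by simp
qed

lemma wq_powi_diff: "wq powi (n - int k) = wq powi n / wq ^ k"
  by (simp add: power_int_diff)

lemma wq_powi_add: "wq powi (n + int k) = wq powi n * wq ^ k"
  by (simp add: power_int_add)

lemma Uval_pred:
  assumes "V5_linear U"
  shows "Uval U m (n - 1) = Uval U m n + 5 * Uval U (Suc m) n"
proof -
  have "yq ^ m / wq powi (n - 1) = (yq ^ m * wq) / wq powi n"
    using wq_powi_diff[of n 1] by simp
  also have "yq ^ m * wq = yq ^ m + 5 * yq ^ Suc m" by (simp add: wq_def algebra_simps)
  finally have "yq ^ m / wq powi (n - 1) = yq ^ m / wq powi n + 5 * (yq ^ Suc m / wq powi n)"
    by (simp add: add_divide_distrib)
  then show ?thesis by (simp only: Uval_def V5_linearD[OF assms])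
qed

text \<open>Since 5 y = w - 1, a value at m + 1 follows from two at m. This computes the rows m = 2,
  ..., 5 of the base tables from the first row.\<close>

lemma Uscaled_rec_m:
  assumes "V5_linear U"
  shows "5 * Uscaled U (Suc m) n = wq ^ 5 * Uscaled U m (n - 1) - Uscaled U m n"
proof -
  have "wq powi (5 * n) = wq ^ 5 * wq powi (5 * (n - 1))"
    using wq_powi_diff[of "5 * n" 5] by (simp add: algebra_simps)
  then show ?thesis unfolding Uscaled_def using Uval_pred[OF assms, of m n] by (simp add: algebra_simps)
qed

lemma Uval_rec_n:
  assumes "V5_linear U"
  shows "wq ^ 5 * Uval U m n = ev yq (wcoeff 1) * Uval U m (n - 1) + ev yq (wcoeff 2) * Uval U m (n - 2)
     + ev yq (wcoeff 3) * Uval U m (n - 3) + ev yq (wcoeff 4) * Uval U m (n - 4) + Uval U m (n - 5)"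
proof -
  let ?b = "\<lambda>k. ev (V5 yq) (wcoeff k)"
  have p: "yq ^ m / wq powi (n - int k) = yq ^ m / wq powi n * wq ^ k" for k
    by (simp add: wq_powi_diff)
  have "V5 (wq ^ 5) * (yq ^ m / wq powi n) = yq ^ m / wq powi n * (V5 wq ^ 5)" by simp
  also have "\<dots> = ?b 1 * (yq ^ m / wq powi (n - int 1)) + ?b 2 * (yq ^ m / wq powi (n - int 2))
     + ?b 3 * (yq ^ m / wq powi (n - int 3)) + ?b 4 * (yq ^ m / wq powi (n - int 4)) + yq ^ m / wq powi (n - int 5)"
    unfolding wq_equation p by (simp only: distrib_left power_one_right ac_simps)
  finally show ?thesis
    unfolding Uval_def V5_linearD(2)[OF assms, symmetric] by (simp only: V5_linearD[OF assms]) simp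
qed

lemma Uscaled_rec_n:
  assumes "V5_linear U"
  shows "Uscaled U m n = ev yq (wcoeff 1) * Uscaled U m (n - 1) + wq ^ 5 * (ev yq (wcoeff 2) * Uscaled U m (n - 2)
     + wq ^ 5 * (ev yq (wcoeff 3) * Uscaled U m (n - 3) + wq ^ 5 * (ev yq (wcoeff 4) * Uscaled U m (n - 4)
     + wq ^ 5 * Uscaled U m (n - 5))))"
proof -
  \<comment> \<open>The lowest power of w that occurs; the others are z times natural
    powers.\<close>
  define z where "z = wq powi (5 * (n - 5))"
  have z: "wq powi (5 * (n - 4)) = z * wq ^ 5" "wq powi (5 * (n - 3)) = z * wq ^ 10"
    "wq powi (5 * (n - 2)) = z * wq ^ 15" "wq powi (5 * (n - 1)) = z * wq ^ 20" "wq powi (5 * n) = z * wq ^ 25"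
    unfolding z_def wq_powi_add[symmetric] by (simp_all add: algebra_simps)
  have "wq powi (5 * n) = z * wq ^ 20 * wq ^ 5" unfolding z by (simp add: mult.assoc flip: power_add)
  then have "Uscaled U m n = z * wq ^ 20 * (wq ^ 5 * Uval U m n)" by (simp only: Uscaled_def mult.assoc)
  then show ?thesis
    unfolding Uval_rec_n[OF assms] unfolding Uscaled_def z z_def[symmetric]
    by (simp add: algebra_simps eval_nat_numeral)
qed

lemma Uscaled_rec_m5:
  assumes "V5_linear U"
  shows "Uscaled U (m + 5) n = - (ev yq (coeff mod_poly 0) * Uscaled U m n + ev yq (coeff mod_poly 1) * Uscaled U (m + 1) n
     + ev yq (coeff mod_poly 2) * Uscaled U (m + 2) n + ev yq (coeff mod_poly 3) * Uscaled U (m + 3) n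
     + ev yq (coeff mod_poly 4) * Uscaled U (m + 4) n)"
proof -
  let ?a = "\<lambda>k. ev (V5 yq) (coeff mod_poly k)"
  have 0: "U 0 = 0" using V5_linearD(2)[OF assms, of 0 0] by simp
  have p: "yq ^ (m + i) / wq powi n = yq ^ i * (yq ^ m / wq powi n)" for i
    by (simp add: power_add)
  have "ev2 (V5 yq) yq mod_poly * (yq ^ m / wq powi n) = ?a 0 * (yq ^ m / wq powi n) + ?a 1 * (yq ^ (m + 1) / wq powi n)
     + ?a 2 * (yq ^ (m + 2) / wq powi n) + ?a 3 * (yq ^ (m + 3) / wq powi n) + ?a 4 * (yq ^ (m + 4) / wq powi n)
     + yq ^ (m + 5) / wq powi n"
    unfolding ev2_mod_poly p by (simp only: distrib_right distrib_left power_one_right ac_simps)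
  from arg_cong[OF this, of U] have "ev yq (coeff mod_poly 0) * Uval U m n + ev yq (coeff mod_poly 1) * Uval U (m + 1) n
     + ev yq (coeff mod_poly 2) * Uval U (m + 2) n + ev yq (coeff mod_poly 3) * Uval U (m + 3) n
     + ev yq (coeff mod_poly 4) * Uval U (m + 4) n + Uval U (m + 5) n = 0"
    unfolding modular_equation mult_zero_left 0 V5_linearD[OF assms] Uval_def by (rule sym)
  then have "wq powi (5 * n) * (ev yq (coeff mod_poly 0) * Uval U m n + ev yq (coeff mod_poly 1) * Uval U (m + 1) n
     + ev yq (coeff mod_poly 2) * Uval U (m + 2) n + ev yq (coeff mod_poly 3) * Uval U (m + 3) n
     + ev yq (coeff mod_poly 4) * Uval U (m + 4) n + Uval U (m + 5) n) = 0" by simp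
  then show ?thesis unfolding Uscaled_def
    by (simp only: eq_neg_iff_add_eq_0 distrib_left ac_simps)
qed

section \<open>Exact values for small m and n\<close>

fun wmult_val :: "(nat \<Rightarrow> int poly) \<Rightarrow> nat \<Rightarrow> nat \<Rightarrow> int poly" where
  "wmult_val u m 0 = u m"
| "wmult_val u m (Suc k) = wmult_val u m k + 5 * wmult_val u (Suc m) k"

lemma Uval_wmult:
  assumes "V5_linear U" "\<And>m. m > 0 \<Longrightarrow> U (yq ^ m) = ev yq (u m)" "m > 0"
  shows "Uval U m (- int k) = ev yq (wmult_val u m k)"
  using assms(3)
proof (induction k arbitrary: m)
  case 0
  then show ?case using assms(2) by (simp add: Uval_def)
next
  case (Suc k)
  have "- int (Suc k) = - int k - 1" by simp
  then show ?case using Suc by (simp only: Uval_pred[OF assms(1)] wmult_val.simps ev_simps zero_less_Suc)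
qed

text \<open>The entry for \<open>m, n \<in> {1..5}\<close> (stored at position \<open>(m - 1, n - 1)\<close>) lists the coefficients in \<open>y\<close> of
  \<open>w ^ (5 n - 4) * U1 (y ^ m / w ^ n)\<close>, respectively \<open>w ^ (5 n - 2) * U0 (y ^ m / w ^ n)\<close>, as computed from the
  recurrences; the \<open>wmult_val\<close> are the starting values with \<open>n \<le> 0\<close>.\<close>

definition base_table1 :: "int list list list" where
  "base_table1 = [
    [[0, 21, 80],
     [0, 191, 1180, -9625, -128750, -571875, -1200000, -1000000],
     [0, 1011, -24220, -928625, -10616875, -57787500, -116040625, 440890625, 3891015625, 13130859375, 25039062500,
      26718750000, 12500000000],
     [0, 3606, -447370, -11275750, -33817500, 1880306250, 33582275000, 296592468750, 1638346875000, 5838347656250,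
      11841210937500, 1170000000000, -78403906250000, -281019287109375, -551074218750000, -670898437500000,
      -480468750000000, -156250000000000],
     [0, 9726, -3611395, -17751000, 3086728750, 82442850000, 951264684375, 4401572093750, -26294343359375,
      -621419925781250, -5582397792968750, -32427876308593750, -134107707958984375, -400620775146484375,
      -823393750000000000, -909729431152343750, 631800506591796875, 5127471771240234375, 11727645874023437500,
      16249389648437500000, 14538574218750000000, 7836914062500000000, 1953125000000000000]],
    [[0, -4, -15],
     [0, -34, -115, 3375, 35000, 147500, 303125, 250000],
     [0, -164, 6035, 199250, 2156250, 10732500, 12121875, -160437500, -1072656250, -3414062500, -6365234375,
      -6718750000, -3125000000],
     [0, -519, 89685, 1998875, -961250, -492557500, -7806106250, -65949640625, -352151562500, -1195306640625,
      -2101449218750, 1728867187500, 23058984375000, 74500732421875, 141375732421875, 169653320312500,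
      120605468750000, 39062500000000],
     [0, -1224, 650835, -761500, -701955000, -16954972500, -178922115625, -574850562500, 9190507421875,
      158022636718750, 1326269113281250, 7452878632812500, 30072695361328125, 87367668457031250, 170585467529296875,
      153536401367187500, -275890411376953125, -1423880920410156250, -3058116912841796875, -4141540527343750000,
      -3666381835937500000, -1965332031250000000, -488281250000000000]],
    [[0, 11, 525, 9175, 78500, 358000, 840000, 800000],
     [0, 6, 0, -950, -8750, -35750, -72500, -59375],
     [0, 26, -1400, -41450, -421625, -1823250, 874375, 51815625, 291796875, 885156250, 1617187500, 1689453125,
      781250000],
     [0, 71, -17550, -337950, 1880500, 122808000, 1778602500, 14422440625, 74175000000, 236079296875, 322488281250,
      -910507812500, -6588476562500, -19647216796875, -36223144531250, -42889404296875, -30273437500000,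
      -9765625000000],
     [0, 141, -114825, 974550, 154547625, 3409717375, 32267799375, 39186815625, -2751076171875, -39161804296875,
      -310932298828125, -1694637763671875, -6666495312500000, -18749418945312500, -34191621093750000,
      -20709552001953125, 97236846923828125, 390188446044921875, 795185089111328125, 1054805755615234375,
      924453735351562500, 492858886718750000, 122070312500000000]],
    [[0, 6, 2410, 156500, 4520325, 74735000, 787670000, 5565600000, 26836000000, 87520000000, 185280000000,
      230400000000, 128000000000],
     [0, 1, 160, 5200, 92325, 1068125, 8526250, 47959375, 190296875, 522812500, 948750000, 1025000000, 500000000],
     [0, -4, 310, 8400, 79325, 270000, -1039375, -15306250, -77281250, -225937500, -405937500, -420312500,
      -193359375],
     [0, -9, 3360, 53600, -731175, -29440625, -396964375, -3093103125, -15219078125, -44173515625, -32797734375,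
      340663671875, 1843205078125, 5157714843750, 9270019531250, 10839843750000, 7598876953125, 2441406250000],
     [0, -14, 19810, -346700, -33082925, -669220000, -5485186250, 10328475000, 757758656250, 9494154687500,
      71934095625000, 380831259375000, 1457946466796875, 3942017578125000, 6524897460937500, 955224609375000,
      -31077697753906250, -105788574218750000, -206240844726562500, -268463134765625000, -233058929443359375,
      -123596191406250000, -30517578125000000]],
    [[0, 1, 3510, 679510, 47331475, 1759804375, 41184117500, 661422700000, 7663904000000, 65994908000000,
      429232560000000, 2120873600000000, 7930560000000000, 22112640000000000, 44620800000000000, 61644800000000000,
      52224000000000000, 20480000000000000],
     [0, 1, 480, 42610, 1790100, 45766250, 796155000, 10008028125, 94147406250, 676311515625, 3746669375000,
      16028068750000, 52572500000000, 129952500000000, 234500000000000, 291800000000000, 224000000000000,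
      80000000000000],
     [0, 1, -25, 210, 36850, 921875, 13270625, 135121875, 1047609375, 6356046875, 30386171875, 114051171875,
      332314453125, 736630859375, 1200976562500, 1358593750000, 953125000000, 312500000000],
     [0, 1, -630, -7690, 218600, 6833750, 86792500, 649137500, 3022187500, 7596281250, -2822812500, -111079687500,
      -505429687500, -1344521484375, -2363671875000, -2732714843750, -1903320312500, -609130859375],
     [0, 1, -3335, 96410, 6904100, 127814375, 849376875, -6288362500, -197692921875, -2256514656250,
      -16414979062500, -84456845312500, -313645712890625, -806442568359375, -1148117773437500, 768576367187500,
      9389106201171875, 28431269531250000, 53367614746093750, 68283081054687500, 58746337890625000,
      30994415283203125, 7629394531250000]]]"

definition base_table0 :: "int list list list" where
  "base_table0 = [
    [[0, 5, -5, -225, -500],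
     [0, 30, -880, -21500, -167500, -577500, -500000, 2484375, 7500000, 6250000],
     [0, 80, -15780, -309900, -605125, 36663750, 506359375, 3444890625, 14298515625, 36975000000, 52609375000,
      10986328125, -95507812500, -152343750000, -78125000000],
     [0, 155, -114080, 178950, 98864750, 2143786250, 21487843750, 97580890625, -201279687500, -6287708984375,
      -48799105468750, -231994042968750, -760476464843750, -1750454833984375, -2715097656250000, -2394891357421875,
      -111083984375000, 2426757812500000, 2636718750000000, 976562500000000],
     [0, 255, -546405, 29998800, 1484092125, 17384024375, -144521984375, -6882994046875, -101521331015625,
      -890486694140625, -5015291912109375, -15785857763671875, 8094912304687500, 415212644531250000,
      2710150063476562500, 11033208001708984375, 32290785369873046875, 70156598052978515625, 111956224822998046875,
      123952457427978515625, 78749771118164062500, -961303710937500000, -51086425781250000000,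
      -42114257812500000000, -12207031250000000000]],
    [[0, 0, 20, 180, 525, 500],
     [0, -5, 200, 4480, 33275, 103625, 18750, -765625, -1953125, -1562500],
     [0, -10, 3130, 54780, -56475, -9562000, -118540625, -775718750, -3133281250, -7822656250, -10167968750,
      1230468750, 26904296875, 39062500000, 19531250000],
     [0, -15, 20060, -172670, -22212475, -443840125, -4130521875, -14817046875, 94252109375, 1657800390625,
      11870755859375, 54556962890625, 175094970703125, 395330566406250, 596203613281250, 486840820312500,
      -72601318359375, -659790039062500, -671386718750000, -244140625000000],
     [0, -20, 87240, -6526620, -281815975, -2573199500, 48837668750, 1635500250000, 22424155781250,
      187486060937500, 990961023437500, 2576489804687500, -7007742236328125, -115050098632812500,
      -681776899414062500, -2673833642578125000, -7663816406250000000, -16399240722656250000, -25773831176757812500,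
      -27877288818359375000, -16572780609130859375, 2347564697265625000, 13626098632812500000, 10681152343750000000,
      3051757812500000000]],
    [[0, 1, 164, 6290, 113475, 1184125, 7732500, 32250000, 83800000, 124000000, 80000000],
     [0, 1, -36, -760, -4650, -4000, 82500, 434375, 956250, 953125, 312500],
     [0, 1, -611, -9310, 49100, 2370375, 27135625, 171509375, 672878125, 1606421875, 1813203125, -1279296875,
      -7470703125, -10009765625, -4882812500],
     [0, 1, -3436, 60640, 4859100, 90088500, 767407500, 1759537500, -31674262500, -423223656250, -2845955937500,
      -12695351562500, -39914648437500, -88251708984375, -128632812500000, -94177246093750, 42846679687500,
      178070068359375, 170898437500000, 61035156250000],
     [0, 1, -13511, 1370340, 52056600, 311181625, -13954101875, -378556575000, -4871542809375, -38759157250000,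
      -189379684062500, -350421972656250, 2766987060546875, 30755130615234375, 169300610351562500,
      642902709960937500, 1807358245849609375, 3809262084960937500, 5889122009277343750, 6197814941406250000,
      3373718261718750000, -1107311248779296875, -3618240356445312500, -2708435058593750000, -762939453125000000]],
    [[0, 0, 345, 44480, 2156275, 57373000, 973303125, 11352525000, 94836250000, 579140000000, 2599700000000,
      8506000000000, 19776000000000, 31008000000000, 29440000000000, 12800000000000],
     [0, 0, 45, 2280, 63525, 1161125, 14800000, 136634375, 935328125, 4800234375, 18461328125, 52539062500,
      107531250000, 149875000000, 127500000000, 50000000000],
     [0, 0, 120, 1580, -16100, -544500, -5875000, -35662500, -132468750, -279375000, -152343750, 867187500,
      2617187500, 3273437500, 1767578125, 195312500],
     [0, 0, 570, -16995, -1038850, -17915750, -136456250, -57334375, 9301218750, 105201953125, 672548437500,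
      2920574218750, 8995046875000, 19424884765625, 27119443359375, 16776562500000, -16784667968750,
      -47760009765625, -43487548828125, -15258789062500],
     [0, 0, 2020, -279070, -9307850, -17749500, 3650712500, 85655212500, 1040738734375, 7847986406250,
      34582733593750, 25815136718750, -891657513671875, -7998817468750000, -41539914736328125, -153347106250000000,
      -423309783935546875, -878573608398437500, -1333854675292968750, -1358337402343750000, -653457641601562500,
      405311584472656250, 957012176513671875, 686645507812500000, 190734863281250000]],
    [[0, 0, 260, 112965, 12775575, 704015250, 23593652500, 536679115625, 8826891562500, 109175002500000,
      1041144750000000, 7774381300000000, 45830035600000000, 213721616000000000, 785253440000000000,
      2248438400000000000, 4917568000000000000, 7941120000000000000, 8929280000000000000, 6246400000000000000,
      2048000000000000000],
     [0, 0, 60, 10165, 658200, 24334000, 597715000, 10545428125, 139926687500, 1437207031250, 11636064062500,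
      75058897265625, 387601678125000, 1601511781250000, 5262977500000000, 13585212500000000, 26964250000000000,
      39740000000000000, 40980000000000000, 26400000000000000, 8000000000000000],
     [0, 0, -15, 365, 29575, 784000, 13715000, 183850000, 1968140625, 16989687500, 118624609375, 671131250000,
      3076779687500, 11393988281250, 33824326171875, 79399267578125, 144137695312500, 195253906250000,
      185859375000000, 110937500000000, 31250000000000],
     [0, 0, -90, 4315, 218450, 3502750, 23058750, -55228125, -2504000000, -25360859375, -155488281250,
      -657750000000, -1976692968750, -4123365234375, -5329335937500, -2081689453125, 6442382812500, 13685302734375,
      11896972656250, 4278564453125, 122070312500],
     [0, 0, -290, 55265, 1597325, -5934750, -902847500, -18990556250, -218535828125, -1550878203125,
      -5901782421875, 6248112890625, 260438721093750, 2034354007812500, 10076521152343750, 36274081396484375,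
      98401939208984375, 201002392578125000, 298968549804687500, 292297827148437500, 116495788574218750,
      -133037567138671875, -252246856689453125, -174045562744140625, -47683715820312500]]]"

text \<open>The first row comes from the recurrence in n, started at n = 0, -1, ..., -4, where y w^k
  is a polynomial in y. The other rows follow by \<open>Uscaled_rec_m\<close>. The hypotheses are
  polynomial identities to be verified on the tables by expansion.\<close>

lemma base_values:
  assumes lin: "V5_linear U" and u: "\<And>m. m > 0 \<Longrightarrow> U (yq ^ m) = ev yq (u m)"
    and q: "\<And>k. q k = wmult_val u 1 k"
    and r1: "wpoly ^ e * B 1 1 = wcoeff 1 * q 0 + wcoeff 2 * q 1 + wcoeff 3 * q 2 + wcoeff 4 * q 3 + q 4"
    and r2: "wpoly ^ e * B 1 2 = wcoeff 1 * (wpoly ^ e * B 1 1) + wpoly ^ 5 * (wcoeff 2 * q 0 + wcoeff 3 * q 1 + wcoeff 4 * q 2 + q 3)"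
    and r3: "wpoly ^ e * B 1 3 = wcoeff 1 * (wpoly ^ e * B 1 2) + wpoly ^ 5 * (wcoeff 2 * (wpoly ^ e * B 1 1)
        + wpoly ^ 5 * (wcoeff 3 * q 0 + wcoeff 4 * q 1 + q 2))"
    and r4: "wpoly ^ e * B 1 4 = wcoeff 1 * (wpoly ^ e * B 1 3) + wpoly ^ 5 * (wcoeff 2 * (wpoly ^ e * B 1 2)
        + wpoly ^ 5 * (wcoeff 3 * (wpoly ^ e * B 1 1) + wpoly ^ 5 * (wcoeff 4 * q 0 + q 1)))"
    and r5: "wpoly ^ e * B 1 5 = wcoeff 1 * (wpoly ^ e * B 1 4) + wpoly ^ 5 * (wcoeff 2 * (wpoly ^ e * B 1 3)
        + wpoly ^ 5 * (wcoeff 3 * (wpoly ^ e * B 1 2) + wpoly ^ 5 * (wcoeff 4 * (wpoly ^ e * B 1 1) + wpoly ^ 5 * q 0)))"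
    and c1: "\<And>m. m \<in> {1..4} \<Longrightarrow> wpoly ^ e * (5 * B (Suc m) 1 + B m 1) = wpoly ^ 5 * u m"
    and c: "\<And>m n. m \<in> {1..4} \<Longrightarrow> n \<in> {1..4} \<Longrightarrow> 5 * B (Suc m) (Suc n) + B m (Suc n) = wpoly ^ 5 * B m n"
    and mn: "m \<in> {1..5}" "n \<in> {1..5}"
  shows "Uscaled U m (int n) = ev yq (wpoly ^ e * B m n)"
proof -
  let ?S = "Uscaled U 1"
  \<comment> \<open>At a negative index the scaling is itself a negative power of w; multiplying by
    w^(5 k) restores the polynomial.\<close>
  have S: "wq ^ (5 * k) * ?S (- int k) = ev yq (q k)" for k
  proof -
    have "wq powi (5 * (- int k)) * wq ^ (5 * k) = 1"
      using wq_powi_add[of "5 * (- int k)" "5 * k"] by simp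
    then have "wq ^ (5 * k) * ?S (- int k) = Uval U 1 (- int k)"
      by (simp add: Uscaled_def ac_simps)
    then show ?thesis unfolding q using Uval_wmult[OF lin u, of 1 k] by simp
  qed
  have S0: "?S 0 = ev yq (q 0)" "wq ^ 5 * ?S (- 1) = ev yq (q 1)" "wq ^ 10 * ?S (- 2) = ev yq (q 2)"
    "wq ^ 15 * ?S (- 3) = ev yq (q 3)" "wq ^ 20 * ?S (- 4) = ev yq (q 4)"
    using S[of 0] S[of 1] S[of 2] S[of 3] S[of 4] by simp_all
  let ?b = "\<lambda>k. ev yq (wcoeff k)"
  note rec = Uscaled_rec_n[OF lin, of 1]
  have 1: "?S 1 = ev yq (wpoly ^ e * B 1 1)"
  proof -
    have "?S 1 = ?b 1 * ?S 0 + ?b 2 * (wq ^ 5 * ?S (- 1)) + ?b 3 * (wq ^ 10 * ?S (- 2)) + ?b 4 * (wq ^ 15 * ?S (- 3)) + wq ^ 20 * ?S (- 4)"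
      using rec[of 1] by (simp add: algebra_simps flip: power_add)
    then show ?thesis unfolding S0 r1 by simp
  qed
  have 2: "?S 2 = ev yq (wpoly ^ e * B 1 2)"
  proof -
    have "?S 2 = ?b 1 * ?S 1 + wq ^ 5 * (?b 2 * ?S 0 + ?b 3 * (wq ^ 5 * ?S (- 1)) + ?b 4 * (wq ^ 10 * ?S (- 2)) + wq ^ 15 * ?S (- 3))"
      using rec[of 2] by (simp add: algebra_simps flip: power_add)
    then show ?thesis unfolding S0 r2 1 by simp
  qed
  have 3: "?S 3 = ev yq (wpoly ^ e * B 1 3)"
  proof -
    have "?S 3 = ?b 1 * ?S 2 + wq ^ 5 * (?b 2 * ?S 1 + wq ^ 5 * (?b 3 * ?S 0 + ?b 4 * (wq ^ 5 * ?S (- 1)) + wq ^ 10 * ?S (- 2)))"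
      using rec[of 3] by (simp add: algebra_simps flip: power_add)
    then show ?thesis unfolding S0 r3 1 2 by simp
  qed
  have 4: "?S 4 = ev yq (wpoly ^ e * B 1 4)"
  proof -
    have "?S 4 = ?b 1 * ?S 3 + wq ^ 5 * (?b 2 * ?S 2 + wq ^ 5 * (?b 3 * ?S 1 + wq ^ 5 * (?b 4 * ?S 0 + wq ^ 5 * ?S (- 1))))"
      using rec[of 4] by simp
    then show ?thesis unfolding S0 r4 1 2 3 by simp
  qed
  have 5: "?S 5 = ev yq (wpoly ^ e * B 1 5)"
  proof -
    have "?S 5 = ?b 1 * ?S 4 + wq ^ 5 * (?b 2 * ?S 3 + wq ^ 5 * (?b 3 * ?S 2 + wq ^ 5 * (?b 4 * ?S 1 + wq ^ 5 * ?S 0)))"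
      using rec[of 5] by simp
    then show ?thesis unfolding S0 r5 1 2 3 4 by simp
  qed
  have row1: "?S (int n) = ev yq (wpoly ^ e * B 1 n)" if "n \<in> {1..5}" for n
  proof -
    have "n = 1 \<or> n = 2 \<or> n = 3 \<or> n = 4 \<or> n = 5" using that by auto
    then show ?thesis using 1 2 3 4 5 by fastforce
  qed
  have "\<forall>n\<in>{1..5}. Uscaled U m (int n) = ev yq (wpoly ^ e * B m n)"
    using mn(1)
  proof (induction m)
    case 0 then show ?case by simp
  next
    case (Suc m)
    show ?case
    proof (cases "m = 0")
      case True then show ?thesis using row1 by simp
    next
    case False
    then have m: "m \<in> {1..4}" and IH: "\<And>n. n \<in> {1..5} \<Longrightarrow> Uscaled U m (int n) = ev yq (wpoly ^ e * B m n)"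
      using Suc by auto
    show ?thesis
    proof
      fix n :: nat assume n: "n \<in> {1..5}"
      have *: "5 * Uscaled U (Suc m) (int n) = wq ^ 5 * Uscaled U m (int n - 1) - ev yq (wpoly ^ e * B m n)"
        unfolding Uscaled_rec_m[OF lin] IH[OF n] ..
      have "5 * Uscaled U (Suc m) (int n) = 5 * ev yq (wpoly ^ e * B (Suc m) n)"
      proof (cases "n = 1")
        case True
        have "Uscaled U m 0 = ev yq (u m)" using u[of m] m by (simp add: Uscaled_def Uval_def)
        then have "5 * Uscaled U (Suc m) (int n) = ev yq (wpoly ^ 5 * u m) - ev yq (wpoly ^ e * B m n)"
          using * True by simp
        also have "\<dots> = 5 * ev yq (wpoly ^ e * B (Suc m) n)"
          unfolding c1[OF m, symmetric] True by (simp add: algebra_simps)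
        finally show ?thesis .
      next
        case False
        then obtain k where k: "n = Suc k" "k \<in> {1..4}" "k \<in> {1..5}" using n by (cases n) auto
        have "5 * Uscaled U (Suc m) (int n) = ev yq (wpoly ^ e * (wpoly ^ 5 * B m k)) - ev yq (wpoly ^ e * B m n)"
          using * IH[OF k(3)] k(1) by (simp add: ac_simps)
        also have "\<dots> = 5 * ev yq (wpoly ^ e * B (Suc m) n)"
          unfolding c[OF m k(2), symmetric] k(1) by (simp add: algebra_simps)
        finally show ?thesis .
      qed
      then show "Uscaled U (Suc m) (int n) = ev yq (wpoly ^ e * B (Suc m) n)" by simp
    qed
    qed
  qed
  then show ?thesis using mn(2) by blast
qed

definition trace_val1 :: "nat \<Rightarrow> int poly" where "trace_val1 m = poly_trace (m - 1) (coeffs trace_poly1)"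
definition trace_val0 :: "nat \<Rightarrow> int poly" where "trace_val0 m = poly_trace (m - 1) (coeffs trace_poly0)"

lemma trace_val:
  assumes "m > 0"
  shows "U1 (yq ^ m) = ev yq (trace_val1 m)" "U0 (yq ^ m) = ev yq (trace_val0 m)"
  using U1_yq_power[of "m - 1"] U0_yq_power[of "m - 1"] assms by (simp_all add: trace_val1_def trace_val0_def)

definition base1 :: "nat \<Rightarrow> nat \<Rightarrow> int poly" where "base1 m n = Poly (base_table1 ! (m - 1) ! (n - 1))"
definition base0 :: "nat \<Rightarrow> nat \<Rightarrow> int poly" where "base0 m n = Poly (base_table0 ! (m - 1) ! (n - 1))"

lemma power_trace_small: "power_trace 0 = 0" "power_trace 1 = 0" "power_trace 2 = 0" "power_trace 3 = 0" "power_trace 4 = 1"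
  by (simp_all add: eval_nat_numeral)

lemma power_trace_rec:
  "power_trace (k + 5) = - (coeff mod_poly 0 * power_trace k + coeff mod_poly 1 * power_trace (k + 1) +
     coeff mod_poly 2 * power_trace (k + 2) + coeff mod_poly 3 * power_trace (k + 3) + coeff mod_poly 4 * power_trace (k + 4))"
  by (simp add: eval_nat_numeral)

lemma mod_poly_coeffs:
  "coeff mod_poly 0 = [:0, -1, -20, -150, -500, -625:]" "coeff mod_poly 1 = [:0, -15, -305, -2325, -7875, -10000:]"
  "coeff mod_poly 2 = [:0, -85, -1750, -13525, -46500, -60000:]" "coeff mod_poly 3 = [:0, -215, -4475, -35000, -122000, -160000:]"
  "coeff mod_poly 4 = [:0, -205, -4300, -34000, -120000, -160000:]"
  by (simp_all add: mod_poly_def eval_nat_numeral)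

text \<open>The trace polynomials have degree 4 in y and m goes up to 5, so indices up to (5 - 1) +
  4 = 8 occur.\<close>

lemma power_trace_eval:
  shows "power_trace 5 =
      [:0, 205, 4300, 34000, 120000, 160000:]"
    and "power_trace 6 =
      [:0, 215, 46500, 1798000, 32552000, 341760000, 2253600000, 9536000000, 25280000000, 38400000000, 25600000000:]"
    and "power_trace 7 =
      [:0, 85, 89900, 12312400, 609624000, 16364880000, 279099600000, 3271276000000, 27484800000000, 169067840000000,
      765939200000000, 2534784000000000, 5975040000000000, 9523200000000000, 9216000000000000, 4096000000000000:]"
    and "power_trace 8 =
      [:0, 15, 81380, 30481200, 3528880000, 197818900000, 6694288500000, 153187248000000, 2530636152000000,
      31425485120000000, 300962038400000000, 2258287616000000000, 13389124480000000000, 62861721600000000000,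
      232800409600000000000, 672718848000000000000, 1486827520000000000000, 2429747200000000000000,
      2768896000000000000000, 1966080000000000000000, 655360000000000000000:]"
proof -
  show 5: "power_trace 5 =
      [:0, 205, 4300, 34000, 120000, 160000:]"
    using power_trace_rec[of 0] by (simp add: power_trace_small[simplified] mod_poly_coeffs[simplified])
  show 6: "power_trace 6 =
      [:0, 215, 46500, 1798000, 32552000, 341760000, 2253600000, 9536000000, 25280000000, 38400000000, 25600000000:]"
    using power_trace_rec[of 1] by (simp add: power_trace_small[simplified] mod_poly_coeffs[simplified] 5)
  show 7: "power_trace 7 =
      [:0, 85, 89900, 12312400, 609624000, 16364880000, 279099600000, 3271276000000, 27484800000000, 169067840000000,
      765939200000000, 2534784000000000, 5975040000000000, 9523200000000000, 9216000000000000, 4096000000000000:]"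
    using power_trace_rec[of 2] by (simp add: power_trace_small[simplified] mod_poly_coeffs[simplified] 5 6)
  show 8: "power_trace 8 =
      [:0, 15, 81380, 30481200, 3528880000, 197818900000, 6694288500000, 153187248000000, 2530636152000000,
      31425485120000000, 300962038400000000, 2258287616000000000, 13389124480000000000, 62861721600000000000,
      232800409600000000000, 672718848000000000000, 1486827520000000000000, 2429747200000000000000,
      2768896000000000000000, 1966080000000000000000, 655360000000000000000:]"
    using power_trace_rec[of 3] by (simp add: power_trace_small[simplified] mod_poly_coeffs[simplified] 5 6 7)
qed

lemma wpoly_powers:
  "wpoly ^ 2 = [:1, 10, 25:]" "wpoly ^ 4 = [:1, 20, 150, 500, 625:]" "wpoly ^ 5 = [:1, 25, 250, 1250, 3125, 3125:]"
  by (simp_all add: wpoly_def eval_nat_numeral)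

lemma wmult_val_eval:
  "wmult_val u m 0 = u m" "wmult_val u m 1 = u m + 5 * u (m + 1)"
  "wmult_val u m 2 = u m + 10 * u (m + 1) + 25 * u (m + 2)"
  "wmult_val u m 3 = u m + 15 * u (m + 1) + 75 * u (m + 2) + 125 * u (m + 3)"
  "wmult_val u m 4 = u m + 20 * u (m + 1) + 150 * u (m + 2) + 500 * u (m + 3) + 625 * u (m + 4)"
  by (simp_all add: eval_nat_numeral)

lemmas base1_unfold =
  base1_def[of 1 1] base1_def[of 1 2] base1_def[of 1 3] base1_def[of 1 4] base1_def[of 1 5]
  base1_def[of 2 1] base1_def[of 2 2] base1_def[of 2 3] base1_def[of 2 4] base1_def[of 2 5]
  base1_def[of 3 1] base1_def[of 3 2] base1_def[of 3 3] base1_def[of 3 4] base1_def[of 3 5]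
  base1_def[of 4 1] base1_def[of 4 2] base1_def[of 4 3] base1_def[of 4 4] base1_def[of 4 5]
  base1_def[of 5 1] base1_def[of 5 2] base1_def[of 5 3] base1_def[of 5 4] base1_def[of 5 5]

lemmas base1_vals = base1_unfold[unfolded base_table1_def, simplified]

lemmas base0_unfold =
  base0_def[of 1 1] base0_def[of 1 2] base0_def[of 1 3] base0_def[of 1 4] base0_def[of 1 5]
  base0_def[of 2 1] base0_def[of 2 2] base0_def[of 2 3] base0_def[of 2 4] base0_def[of 2 5]
  base0_def[of 3 1] base0_def[of 3 2] base0_def[of 3 3] base0_def[of 3 4] base0_def[of 3 5]
  base0_def[of 4 1] base0_def[of 4 2] base0_def[of 4 3] base0_def[of 4 4] base0_def[of 4 5]
  base0_def[of 5 1] base0_def[of 5 2] base0_def[of 5 3] base0_def[of 5 4] base0_def[of 5 5]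

lemmas base0_vals = base0_unfold[unfolded base_table0_def, simplified]

lemma trace_val1_eval:
  "trace_val1 1 =
      [:0, 1:]"
  "trace_val1 2 =
      [:0, 51, 2355, 34100, 222000, 680000, 800000:]"
  "trace_val1 3 =
      [:0, 41, 12370, 729825, 19031000, 278878000, 2544800000, 15104800000, 58656000000, 144320000000, 204800000000,
      128000000000:]"
  "trace_val1 4 =
      [:0, 11, 19905, 3454525, 223905075, 7754231500, 167937100000, 2472993600000, 25981388000000, 200155120000000,
      1145572480000000, 4876736000000000, 15269248000000000, 34216960000000000, 52019200000000000, 48128000000000000,
      20480000000000000:]"
  "trace_val1 5 =
      [:0, 1, 15460, 7261110, 1015561300, 69341456625, 2845455650000, 78359002700000, 1547016184000000,
      22842647868000000, 259404025920000000, 2307498560000000000, 16259980160000000000, 91259994240000000000,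
      408027340800000000000, 1445499596800000000000, 4009533440000000000000, 8528916480000000000000,
      13441433600000000000000, 14794752000000000000000, 10158080000000000000000, 3276800000000000000000:]"
  by (simp_all add: trace_val1_def trace_poly1_def power_trace_eval power_trace_small[simplified] mod_poly_coeffs[simplified])

lemma trace_val0_eval:
  "trace_val0 1 =
      [:0, 5, 20:]"
  "trace_val0 2 =
      [:0, 5, 765, 19780, 213200, 1144000, 3040000, 3200000:]"
  "trace_val0 3 =
      [:0, 1, 1874, 200505, 7746600, 156578000, 1919520000, 15290400000, 81372800000, 288512000000, 656640000000,
      870400000000, 512000000000:]"
  "trace_val0 4 =
      [:0, 0, 1645, 584630, 57141325, 2676276500, 74438740000, 1370303600000, 17757300000000, 168017040000000,
      1184982400000000, 6284736000000000, 25023104000000000, 73814528000000000, 156753920000000000,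
      226918400000000000, 200704000000000000, 81920000000000000:]"
  "trace_val0 5 =
      [:0, 0, 710, 820115, 181557100, 16975701375, 890769910000, 30196540100000, 717309570000000, 12567322500000000,
      167971883200000000, 1751942694400000000, 14472096793600000000, 95521921152000000000, 505651991040000000000,
      2144317235200000000000, 7238786048000000000000, 19208048640000000000000, 39215841280000000000000,
      59487027200000000000000, 63176704000000000000000, 41943040000000000000000, 13107200000000000000000:]"
  by (simp_all add: trace_val0_def trace_poly0_def power_trace_eval power_trace_small[simplified] mod_poly_coeffs[simplified])

lemma base_values1:
  assumes "m \<in> {1..5}" "n \<in> {1..5}"
  shows "Uscaled U1 m (int n) = ev yq (wpoly ^ 4 * base1 m n)"
proof (rule base_values[OF V5_linear_U1 trace_val(1) refl _ _ _ _ _ _ _ assms])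
  have S: "{1..4 :: nat} = {1, 2, 3, 4}" by auto
  have "\<forall>m\<in>{1, 2, 3, 4}. wpoly ^ 4 * (5 * base1 (Suc m) 1 + base1 m 1) = wpoly ^ 5 * trace_val1 m"
    by (simp add: base1_vals wpoly_powers trace_val1_eval[simplified] numeral_poly flip: numeral_2_eq_2)
  then show "wpoly ^ 4 * (5 * base1 (Suc m) 1 + base1 m 1) = wpoly ^ 5 * trace_val1 m" if "m \<in> {1..4}" for m
    using that unfolding S by blast
  have "\<forall>m\<in>{1, 2, 3, 4}. \<forall>n\<in>{1, 2, 3, 4}. 5 * base1 (Suc m) (Suc n) + base1 m (Suc n) = wpoly ^ 5 * base1 m n"
    by (simp add: base1_vals wpoly_powers numeral_poly flip: numeral_2_eq_2)
  then show "5 * base1 (Suc m) (Suc n) + base1 m (Suc n) = wpoly ^ 5 * base1 m n"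
    if "m \<in> {1..4}" "n \<in> {1..4}" for m n using that unfolding S by blast
qed (simp_all add: base1_vals wpoly_powers wcoeff_def wmult_val_eval trace_val1_eval[simplified] numeral_poly flip: numeral_2_eq_2)

lemma base_values0:
  assumes "m \<in> {1..5}" "n \<in> {1..5}"
  shows "Uscaled U0 m (int n) = ev yq (wpoly ^ 2 * base0 m n)"
proof (rule base_values[OF V5_linear_U0 trace_val(2) refl _ _ _ _ _ _ _ assms])
  have S: "{1..4 :: nat} = {1, 2, 3, 4}" by auto
  have "\<forall>m\<in>{1, 2, 3, 4}. wpoly ^ 2 * (5 * base0 (Suc m) 1 + base0 m 1) = wpoly ^ 5 * trace_val0 m"
    by (simp add: base0_vals wpoly_powers trace_val0_eval[simplified] numeral_poly flip: numeral_2_eq_2)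
  then show "wpoly ^ 2 * (5 * base0 (Suc m) 1 + base0 m 1) = wpoly ^ 5 * trace_val0 m" if "m \<in> {1..4}" for m
    using that unfolding S by blast
  have "\<forall>m\<in>{1, 2, 3, 4}. \<forall>n\<in>{1, 2, 3, 4}. 5 * base0 (Suc m) (Suc n) + base0 m (Suc n) = wpoly ^ 5 * base0 m n"
    by (simp add: base0_vals wpoly_powers numeral_poly flip: numeral_2_eq_2)
  then show "5 * base0 (Suc m) (Suc n) + base0 m (Suc n) = wpoly ^ 5 * base0 m n"
    if "m \<in> {1..4}" "n \<in> {1..4}" for m n using that unfolding S by blast
qed (simp_all add: base0_vals wpoly_powers wcoeff_def wmult_val_eval trace_val0_eval[simplified] numeral_poly flip: numeral_2_eq_2)

section \<open>Divisibility by powers of 5\<close>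

text \<open>The coefficients below \<open>l\<close> vanish, and the \<open>r\<close>-th coefficient is divisible by \<open>5 ^ v r\<close>.\<close>

definition val_bound :: "(nat \<Rightarrow> nat) \<Rightarrow> nat \<Rightarrow> int poly \<Rightarrow> bool" where
  "val_bound v l p \<longleftrightarrow> (\<forall>r. (r < l \<longrightarrow> coeff p r = 0) \<and> 5 ^ v r dvd coeff p r)"

lemma val_bound_add: "val_bound v l p \<Longrightarrow> val_bound v l q \<Longrightarrow> val_bound v l (p + q)"
  by (auto simp: val_bound_def)

lemma val_bound_uminus: "val_bound v l p \<Longrightarrow> val_bound v l (- p)"
  by (auto simp: val_bound_def)

lemma val_bound_mult:
  assumes p: "val_bound v l p" and q: "val_bound v' l' q" and l: "l'' \<le> l + l'"
    and v: "\<And>i r. l \<le> i \<Longrightarrow> l' \<le> r \<Longrightarrow> v'' (i + r) \<le> v i + v' r"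
  shows "val_bound v'' l'' (p * q)"
  unfolding val_bound_def
proof (intro allI conjI impI)
  fix r
  show "5 ^ v'' r dvd coeff (p * q) r"
    unfolding coeff_mult
  proof (rule dvd_sum)
    fix i assume "i \<in> {..r}"
    then have i: "i + (r - i) = r" by simp
    show "5 ^ v'' r dvd coeff p i * coeff q (r - i)"
    proof (cases "l \<le> i \<and> l' \<le> r - i")
      case True
      then have "v'' r \<le> v i + v' (r - i)" using v[of i "r - i"] i by simp
      then have "(5 :: int) ^ v'' r dvd 5 ^ v i * 5 ^ v' (r - i)"
        unfolding power_add[symmetric] by (rule le_imp_power_dvd)
      moreover have "5 ^ v i * 5 ^ v' (r - i) dvd coeff p i * coeff q (r - i)"
        using p q by (intro mult_dvd_mono) (auto simp: val_bound_def)
      ultimately show ?thesis by (rule dvd_trans)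
    next
      case False
      then have "coeff p i = 0 \<or> coeff q (r - i) = 0" using p q by (auto simp: val_bound_def not_le)
      then show ?thesis by auto
    qed
  qed
  assume r: "r < l''"
  show "coeff (p * q) r = 0"
    unfolding coeff_mult
  proof (rule sum.neutral, rule ballI)
    fix i assume "i \<in> {..r}"
    then have "i < l \<or> r - i < l'" using r l by auto
    then show "coeff p i * coeff q (r - i) = 0" using p q by (auto simp: val_bound_def)
  qed
qed

text \<open>A recursive form of the bound that evaluates on explicit coefficient lists; k is the
  position of the head of the list.\<close>

fun val_bound_list :: "(nat \<Rightarrow> nat) \<Rightarrow> nat \<Rightarrow> nat \<Rightarrow> int list \<Rightarrow> bool" where
  "val_bound_list v l k [] = True"
| "val_bound_list v l k (x # xs) = ((k < l \<longrightarrow> x = 0) \<and> 5 ^ v k dvd x \<and> val_bound_list v l (Suc k) xs)"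

lemma val_bound_Poly:
  assumes "val_bound_list v l 0 xs"
  shows "val_bound v l (Poly xs)"
proof -
  have "val_bound_list v l k xs \<Longrightarrow> i < length xs \<Longrightarrow> (k + i < l \<longrightarrow> xs ! i = 0) \<and> 5 ^ v (k + i) dvd xs ! i" for i k
  proof (induction xs arbitrary: i k)
    case (Cons x xs)
    show ?case
    proof (cases i)
      case (Suc j)
      then show ?thesis using Cons.IH[of "Suc k" j] Cons.prems by simp
    qed (use Cons.prems in simp)
  qed simp
  from this[OF assms] show ?thesis by (auto simp: val_bound_def nth_default_def)
qed

text \<open>The extra 5 for 1 \<le> i \<le> 4 pays for the irregular exponents. For instance
  \<open>pi1 1 r\<close> rises by 3 from r = 1 to r = 3, and \<open>pi0 2 r\<close> by 4 from r = 3
  to r = 6. For i \<ge> 5 the slope 5/6 leaves enough room.\<close>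

definition step_val :: "nat \<Rightarrow> nat" where "step_val i = (if 1 \<le> i \<and> i \<le> 4 then i + 1 else i)"

lemma val_bound_wcoeff:
  "val_bound step_val 0 (wcoeff 1)" "val_bound step_val 0 (wcoeff 2 * wpoly ^ 5)"
  "val_bound step_val 0 (wcoeff 3 * wpoly ^ 10)" "val_bound step_val 0 (wcoeff 4 * wpoly ^ 15)"
  "val_bound step_val 0 (wpoly ^ 20)"
proof -
  have w10: "wpoly ^ 10 = wpoly ^ 5 * wpoly ^ 5" and w15: "wpoly ^ 15 = wpoly ^ 5 * wpoly ^ 5 * wpoly ^ 5"
    and w20: "wpoly ^ 20 = wpoly ^ 5 * wpoly ^ 5 * wpoly ^ 5 * wpoly ^ 5"
    by (simp_all flip: power_add)
  have "wcoeff 1 = Poly [5, -150, -2750, -16875, -46875, -50000]"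
    by (simp add: wcoeff_def w10 w15 w20 wpoly_powers)
  then show "val_bound step_val 0 (wcoeff 1)"
    by (simp only:) (rule val_bound_Poly, simp add: step_val_def)
  have "wcoeff 2 * wpoly ^ 5 = Poly [-10, -900, -30875, -563750, -6278125, -45487500, -220078125, -708593750, -1462890625, -1757812500, -937500000]"
    by (simp add: wcoeff_def w10 w15 w20 wpoly_powers)
  then show "val_bound step_val 0 (wcoeff 2 * wpoly ^ 5)"
    by (simp only:) (rule val_bound_Poly, simp add: step_val_def)
  have "wcoeff 3 * wpoly ^ 10 = Poly [10, -775, -78375, -2773125, -57321875, -800268750, -8063593750, -60710156250, -347554687500, -1521513671875,
      -5070576171875, -12664306640625, -22987060546875, -28662109375000, -21972656250000, -7812500000000]"
    by (simp add: wcoeff_def w10 w15 w20 wpoly_powers)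
  then show "val_bound step_val 0 (wcoeff 3 * wpoly ^ 10)"
    by (simp only:) (rule val_bound_Poly, simp add: step_val_def)
  have "wcoeff 4 * wpoly ^ 15 = Poly [-5, -1400, -111500, -4757500, -132350000, -2636237500, -39655937500, -465692187500, -4361957031250,
      -33041835937500, -204104570312500, -1032090820312500, -4271591796875000, -14409106445312500, -39266723632812500,
      -85185180664062500, -143759918212890625, -181991577148437500, -162658691406250000, -91552734375000000,
      -24414062500000000]"
    by (simp add: wcoeff_def w10 w15 w20 wpoly_powers)
  then show "val_bound step_val 0 (wcoeff 4 * wpoly ^ 15)"
    by (simp only:) (rule val_bound_Poly, simp add: step_val_def)
  have "wpoly ^ 20 = Poly [1, 100, 4750, 142500, 3028125, 48450000, 605625000, 6056250000, 49207031250, 328046875000, 1804257812500,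
      8201171875000, 30754394531250, 94628906250000, 236572265625000, 473144531250000, 739288330078125,
      869750976562500, 724792480468750, 381469726562500, 95367431640625]"
    by (simp add: wcoeff_def w10 w15 w20 wpoly_powers)
  then show "val_bound step_val 0 (wpoly ^ 20)"
    by (simp only:) (rule val_bound_Poly, simp add: step_val_def)
qed

text \<open>The lower bound 1 records that these coefficients are divisible by Y. It makes the least
  power of y rise by one whenever m rises by 5.\<close>

lemma val_bound_mod_coeff:
  assumes "j < 5"
  shows "val_bound (\<lambda>i. (5 * i + j) div 6) 1 (coeff mod_poly j)"
proof -
  have "coeff mod_poly 0 = Poly [0, -1, -20, -150, -500, -625]"
    "coeff mod_poly 1 = Poly [0, -15, -305, -2325, -7875, -10000]"
    "coeff mod_poly 2 = Poly [0, -85, -1750, -13525, -46500, -60000]"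
    "coeff mod_poly 3 = Poly [0, -215, -4475, -35000, -122000, -160000]"
    "coeff mod_poly 4 = Poly [0, -205, -4300, -34000, -120000, -160000]"
    by (simp_all add: mod_poly_coeffs[simplified])
  moreover have "j = 0 \<or> j = 1 \<or> j = 2 \<or> j = 3 \<or> j = 4" using assms by auto
  ultimately show ?thesis
    by (elim disjE) (simp_all only:, (rule val_bound_Poly, simp)+)
qed

text \<open>Two nested inductions: for m \<le> 5 the recurrence in n keeps m fixed, and for m \<ge>
  6 the recurrence in m keeps n fixed. The conditions on v and l are exactly what
  \<open>val_bound_mult\<close> asks of each product in the two recurrences.\<close>

lemma val_bound_induction:
  assumes lin: "V5_linear U"
    and base: "\<And>m n. m \<in> {1..5} \<Longrightarrow> n \<in> {1..5} \<Longrightarrow> \<exists>p. Uscaled U m (int n) = wq ^ e * ev yq p \<and> val_bound (v m) (l m) p"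
    and nstep: "\<And>m i r. m \<in> {1..5} \<Longrightarrow> l m \<le> r \<Longrightarrow> v m (i + r) \<le> step_val i + v m r"
    and mstep: "\<And>m j i r. j < 5 \<Longrightarrow> m \<ge> 1 \<Longrightarrow> i \<ge> 1 \<Longrightarrow> l (m + j) \<le> r \<Longrightarrow> v (m + 5) (i + r) \<le> (5 * i + j) div 6 + v (m + j) r"
    and lstep: "\<And>m j. j < 5 \<Longrightarrow> l (m + 5) \<le> 1 + l (m + j)"
    and mn: "m \<ge> 1" "n \<ge> 1"
  shows "\<exists>p. Uscaled U m (int n) = wq ^ e * ev yq p \<and> val_bound (v m) (l m) p"
  using mn(1)
proof (induction m rule: less_induct)
  case (less m)
  show ?case
  proof (cases "m \<le> 5")
    case True
    then have m: "m \<in> {1..5}" using less.prems by simp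
    show ?thesis using mn(2)
    proof (induction n rule: less_induct)
      case (less n)
      show ?case
      proof (cases "n \<le> 5")
        case True then show ?thesis using base[OF m] less.prems by simp
      next
        case False
        have "\<exists>p. Uscaled U m (int n - int k) = wq ^ e * ev yq p \<and> val_bound (v m) (l m) p" if "k \<in> {1..5}" for k
        proof -
          have "n - k < n" "1 \<le> n - k" "int (n - k) = int n - int k" using that False by auto
          then show ?thesis using less.IH[of "n - k"] by (simp only:)
        qed
        then have "\<forall>k. \<exists>p. k \<in> {1..5} \<longrightarrow> Uscaled U m (int n - int k) = wq ^ e * ev yq p \<and> val_bound (v m) (l m) p" by blast
        then obtain p where "\<forall>k. k \<in> {1..5} \<longrightarrow> Uscaled U m (int n - int k) = wq ^ e * ev yq (p k) \<and> val_bound (v m) (l m) (p k)"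
          by metis
        then have p: "Uscaled U m (int n - int k) = wq ^ e * ev yq (p k)" "val_bound (v m) (l m) (p k)" if "k \<in> {1..5}" for k
          using that by blast+
        let ?p = "wcoeff 1 * p 1 + wcoeff 2 * wpoly ^ 5 * p 2 + wcoeff 3 * wpoly ^ 10 * p 3 + wcoeff 4 * wpoly ^ 15 * p 4 + wpoly ^ 20 * p 5"
        have "Uscaled U m (int n) = wq ^ e * ev yq ?p"
          using Uscaled_rec_n[OF lin, of m "int n"] p(1)[of 1] p(1)[of 2] p(1)[of 3] p(1)[of 4] p(1)[of 5]
          by (simp add: algebra_simps flip: power_add)
        moreover have "val_bound (v m) (l m) ?p"
          by (intro val_bound_add; rule val_bound_mult[OF _ p(2)]) (use val_bound_wcoeff nstep[OF m] in auto)
        ultimately show ?thesis by blast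
      qed
    qed
  next
    case False
    define m' where "m' = m - 5"
    have m': "m = m' + 5" "m' \<ge> 1" using False by (simp_all add: m'_def)
    have "\<exists>p. Uscaled U (m' + j) (int n) = wq ^ e * ev yq p \<and> val_bound (v (m' + j)) (l (m' + j)) p" if "j < 5" for j
      using less.IH[of "m' + j"] that m' by simp
    then have "\<forall>j. \<exists>p. j < 5 \<longrightarrow> Uscaled U (m' + j) (int n) = wq ^ e * ev yq p \<and> val_bound (v (m' + j)) (l (m' + j)) p" by blast
    then obtain p where "\<forall>j. j < 5 \<longrightarrow> Uscaled U (m' + j) (int n) = wq ^ e * ev yq (p j) \<and> val_bound (v (m' + j)) (l (m' + j)) (p j)"
      by metis
    then have p: "Uscaled U (m' + j) (int n) = wq ^ e * ev yq (p j)" "val_bound (v (m' + j)) (l (m' + j)) (p j)" if "j < 5" for j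
      using that by blast+
    let ?a = "coeff mod_poly"
    let ?p = "- (?a 0 * p 0 + ?a 1 * p 1 + ?a 2 * p 2 + ?a 3 * p 3 + ?a 4 * p 4)"
    have "Uscaled U m (int n) = wq ^ e * ev yq ?p"
      unfolding m' Uscaled_rec_m5[OF lin] using p(1)[of 0] p(1)[of 1] p(1)[of 2] p(1)[of 3] p(1)[of 4]
      by (simp add: algebra_simps)
    moreover have "val_bound (v m) (l m) (?a j * p j)" if "j < 5" for j
      unfolding m' by (rule val_bound_mult[OF val_bound_mod_coeff[OF that] p(2)[OF that]])
        (use that lstep mstep m' in auto)
    then have "val_bound (v m) (l m) ?p" by (intro val_bound_uminus val_bound_add) simp_all
    ultimately show ?thesis by blast
  qed
qed

section \<open>Growth of the exponents \<open>pi1\<close> and \<open>pi0\<close>\<close>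

lemma floor_div_6: "\<lfloor>real_of_int a / 6\<rfloor> = a div 6"
  using floor_divide_of_int_eq[of a 6, where 'a = real] by simp

lemma pi1_div:
  "pi1 m r = (if m \<in> {1, 2} then if r = 1 then 0 else if r = 3 then 3 else (5 * r + 1) div 6
     else if m = 3 then if r = 2 then 2 else (5 * r - 2) div 6 else (5 * r - m + 1) div 6)"
  unfolding pi1_def floor_div_6 ..

lemma pi0_div:
  "pi0 m r = (if m = 1 \<or> m = 2 \<and> r \<notin> {3, 4, 5} then (5 * r + 1) div 6
     else if m = 2 then (5 * r - 5) div 6 else (5 * r - m - 2) div 6)"
  unfolding pi0_def floor_div_6 ..

text \<open>The exponents can be negative when r is small compared with m, and \<open>nat\<close>
  cuts them off. From the lower limits \<open>low1\<close> and \<open>low0\<close> on, which are the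
  ceilings of m / 5 and (m + 2) / 5, they are nonnegative and nothing is lost.\<close>

definition val1 :: "nat \<Rightarrow> nat \<Rightarrow> nat" where "val1 m r = nat (pi1 (int m) (int r))"
definition val0 :: "nat \<Rightarrow> nat \<Rightarrow> nat" where "val0 m r = nat (pi0 (int m) (int r))"
definition low1 :: "nat \<Rightarrow> nat" where "low1 m = (m + 4) div 5"
definition low0 :: "nat \<Rightarrow> nat" where "low0 m = (m + 6) div 5"

lemma base_table1_val:
  "list_all2 (\<lambda>m row. length row = 5 \<and> list_all (val_bound_list (val1 m) (low1 m) 0) row) [1, 2, 3, 4, 5] base_table1"
  by (simp add: base_table1_def val1_def low1_def pi1_div)

lemma base_table0_val:
  "list_all2 (\<lambda>m row. length row = 5 \<and> list_all (val_bound_list (val0 m) (low0 m) 0) row) [1, 2, 3, 4, 5] base_table0"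
  by (simp add: base_table0_def val0_def low0_def pi0_div)

lemma table_nth:
  assumes "list_all2 (\<lambda>m row. length row = 5 \<and> list_all (P m) row) [1, 2, 3, 4, 5 :: nat] T"
    and "m \<in> {1..5}" "n \<in> {1..5}"
  shows "P m (T ! (m - 1) ! (n - 1))"
proof -
  have m: "m - 1 < length [1, 2, 3, 4, 5 :: nat]" and n: "n - 1 < 5" using assms(2,3) by auto
  have "[1, 2, 3, 4, 5 :: nat] ! (m - 1) = m"
  proof -
    have "m = 1 \<or> m = 2 \<or> m = 3 \<or> m = 4 \<or> m = 5" using assms(2) by auto
    then show ?thesis by auto
  qed
  then show ?thesis using list_all2_nthD[OF assms(1) m] n by (simp add: list_all_length)
qed

lemma nat_le_add_nat: "a \<le> int s + b \<Longrightarrow> nat a \<le> s + nat b"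
  by linarith

lemma div_6_shift: "(a + 5 * i) div 6 \<le> i + a div (6 :: int)" if "i \<ge> 0"
  using that by presburger

text \<open>Here s stands for \<open>step_val i\<close>. A floor of slope 5/6 rises by at most i
  over i steps, which settles the regular arguments; only jumps from or to the exceptional ones need
  the strict inequality for i \<le> 4.\<close>

lemma pi1_n_step:
  assumes m: "m \<in> {1..5}" and r: "r \<ge> 1" and i: "i \<ge> 1" and s: "i \<le> s" "i \<le> 4 \<Longrightarrow> i < s"
  shows "pi1 m (i + r) \<le> s + pi1 m r"
proof -
  consider (a) "m = 1 \<or> m = 2" | (b) "m = 3" | (c) "m = 4 \<or> m = 5" using m by fastforce
  then show ?thesis
  proof cases
    case a
    consider "r = 1" "i = 2" | "r = 1" "i \<noteq> 2" | "r = 2" "i = 1" | "r = 3" | "r \<noteq> 1" "r \<noteq> 3" "i + r \<noteq> 3"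
      using r i by fastforce
    then show ?thesis
    proof cases
      case 2
      have "(6 + 5 * i) div 6 \<le> s" using i s by presburger
      then show ?thesis using 2 a i by (auto simp: pi1_div algebra_simps)
    next
      case 4
      have "(16 + 5 * i) div 6 \<le> s + 3" using i s by presburger
      then show ?thesis using 4 a i by (auto simp: pi1_div algebra_simps)
    next
      case 5
      then show ?thesis using a r i s div_6_shift[of i "5 * r + 1"] by (auto simp: pi1_div algebra_simps)
    qed (use a s in \<open>auto simp: pi1_div\<close>)
  next
    case b
    consider "r = 1" "i = 1" | "r = 2" | "r \<noteq> 2" "i + r \<noteq> 2" using r i by fastforce
    then show ?thesis
    proof cases
      case 2
      have "(8 + 5 * i) div 6 \<le> s + 2" using i s by presburger
      then show ?thesis using 2 b i by (auto simp: pi1_div algebra_simps)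
    next
      case 3
      then show ?thesis using b i s div_6_shift[of i "5 * r - 2"] by (auto simp: pi1_div algebra_simps)
    qed (use b s in \<open>auto simp: pi1_div\<close>)
  next
    case c
    then show ?thesis using i s div_6_shift[of i "5 * r - m + 1"] by (auto simp: pi1_div algebra_simps)
  qed
qed

lemma pi0_n_step:
  assumes m: "m \<in> {1..5}" and r: "r \<ge> 1" and i: "i \<ge> 1" and s: "i \<le> s" "i \<le> 4 \<Longrightarrow> i < s"
  shows "pi0 m (i + r) \<le> s + pi0 m r"
proof (cases "m = 2")
  case True
  \<comment> \<open>For m = 2 the exceptional values lie below the regular formula, so they are
    harmless as targets and matter only as starting points r = 3, 4, 5.\<close>
  have le: "pi0 m x \<le> (5 * x + 1) div 6" for x
    using True zdiv_mono1[of "5 * x - 5" "5 * x + 1" 6] by (auto simp: pi0_div)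
  show ?thesis
  proof (cases "r \<in> {3, 4, 5}")
    case r: True
    have "(5 * (i + r) + 1) div 6 \<le> s + (5 * r - 5) div 6"
    proof -
      have "(16 + 5 * i) div 6 \<le> s + 1" "(21 + 5 * i) div 6 \<le> s + 2" "(26 + 5 * i) div 6 \<le> s + 3"
        using i s by presburger+
      then show ?thesis using r by (auto simp: algebra_simps)
    qed
    then show ?thesis using le[of "i + r"] r True by (auto simp: pi0_div)
  next
    case False
    then show ?thesis using le[of "i + r"] True i s div_6_shift[of i "5 * r + 1"]
      by (auto simp: pi0_div algebra_simps)
  qed
next
  case False
  then have "m = 1 \<or> m \<ge> 3" using m by auto
  then show ?thesis using i s div_6_shift[of i "5 * r + 1"] div_6_shift[of i "5 * r - m - 2"]
    by (auto simp: pi0_div algebra_simps)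
qed

lemma val1_n_step:
  assumes "m \<in> {1..5}" "low1 m \<le> r"
  shows "val1 m (i + r) \<le> step_val i + val1 m r"
proof (cases "i = 0")
  case False
  have "r \<ge> 1" using assms unfolding low1_def by simp linarith
  then show ?thesis unfolding val1_def
    using nat_le_add_nat[OF pi1_n_step[of "int m" "int r" "int i" "int (step_val i)"]] False assms(1)
    by (simp add: step_val_def)
qed simp

lemma val0_n_step:
  assumes "m \<in> {1..5}" "low0 m \<le> r"
  shows "val0 m (i + r) \<le> step_val i + val0 m r"
proof (cases "i = 0")
  case False
  have "r \<ge> 1" using assms unfolding low0_def by simp
  then show ?thesis unfolding val0_def
    using nat_le_add_nat[OF pi0_n_step[of "int m" "int r" "int i" "int (step_val i)"]] False assms(1)
    by (simp add: step_val_def)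
qed simp

text \<open>The recurrence in m ends at m \<ge> 6, where equality holds. At its starting points,
  which may be irregular, a lower bound is enough.\<close>

lemma pi1_ge:
  assumes "m \<ge> 1" "r \<ge> 1"
  shows "(5 * r - m + 1) div 6 \<le> pi1 m r"
proof -
  consider (a) "m = 1 \<or> m = 2" | (b) "m = 3" | (c) "m \<ge> 4" using assms(1) by fastforce
  then show ?thesis
  proof cases
    case a
    then show ?thesis using zdiv_mono1[of "5 * r - m + 1" "5 * r + 1" 6] by (auto simp: pi1_div)
  qed (auto simp: pi1_div)
qed

lemma pi0_ge:
  assumes "m \<ge> 1" "r \<ge> 1"
  shows "(5 * r - m - 2) div 6 \<le> pi0 m r"
proof -
  consider (a) "m = 1 \<or> m = 2" | (b) "m \<ge> 3" using assms(1) by fastforce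
  then show ?thesis
  proof cases
    case a
    then show ?thesis using zdiv_mono1[of "5 * r - m - 2" "5 * r + 1" 6] by (auto simp: pi0_div)
  qed (auto simp: pi0_div)
qed

text \<open>Splitting a floor of sixths into two loses at most 5/6. This is precisely what the
  exponent gives up when m increases by 5.\<close>

lemma div_6_step: "(x + y - 5) div 6 \<le> x div 6 + y div (6 :: int)"
  by presburger

lemma val1_m_step:
  assumes "m \<ge> 1" "low1 (m + j) \<le> r"
  shows "val1 (m + 5) (i + r) \<le> (5 * i + j) div 6 + val1 (m + j) r"
  unfolding val1_def
proof (rule nat_le_add_nat)
  have r: "r \<ge> 1" using assms by (simp add: low1_def)
  have "pi1 (int (m + 5)) (int (i + r)) = ((5 * int i + int j) + (5 * int r - int (m + j) + 1) - 5) div 6"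
    unfolding pi1_div using assms(1) by (simp add: algebra_simps)
  also have "\<dots> \<le> (5 * int i + int j) div 6 + (5 * int r - int (m + j) + 1) div 6" by (rule div_6_step)
  also have "\<dots> \<le> int ((5 * i + j) div 6) + pi1 (int (m + j)) (int r)"
    using pi1_ge[of "int (m + j)" "int r"] assms(1) r by (simp add: zdiv_int)
  finally show "pi1 (int (m + 5)) (int (i + r)) \<le> int ((5 * i + j) div 6) + pi1 (int (m + j)) (int r)" .
qed

lemma val0_m_step:
  assumes "m \<ge> 1" "low0 (m + j) \<le> r"
  shows "val0 (m + 5) (i + r) \<le> (5 * i + j) div 6 + val0 (m + j) r"
  unfolding val0_def
proof (rule nat_le_add_nat)
  have r: "r \<ge> 1" using assms by (simp add: low0_def)
  have "pi0 (int (m + 5)) (int (i + r)) = ((5 * int i + int j) + (5 * int r - int (m + j) - 2) - 5) div 6"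
    unfolding pi0_div using assms(1) by (simp add: algebra_simps)
  also have "\<dots> \<le> (5 * int i + int j) div 6 + (5 * int r - int (m + j) - 2) div 6" by (rule div_6_step)
  also have "\<dots> \<le> int ((5 * i + j) div 6) + pi0 (int (m + j)) (int r)"
    using pi0_ge[of "int (m + j)" "int r"] assms(1) r by (simp add: zdiv_int)
  finally show "pi0 (int (m + 5)) (int (i + r)) \<le> int ((5 * i + j) div 6) + pi0 (int (m + j)) (int r)" .
qed

lemma U1_val_bound:
  assumes "m \<ge> 1" "n \<ge> 1"
  shows "\<exists>p. Uscaled U1 m (int n) = wq ^ 4 * ev yq p \<and> val_bound (val1 m) (low1 m) p"
proof (rule val_bound_induction[OF V5_linear_U1 _ val1_n_step val1_m_step _ assms])
  show "\<exists>p. Uscaled U1 m (int n) = wq ^ 4 * ev yq p \<and> val_bound (val1 m) (low1 m) p"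
    if "m \<in> {1..5}" "n \<in> {1..5}" for m n
    using base_values1[OF that] val_bound_Poly[OF table_nth[OF base_table1_val that]]
    by (intro exI[of _ "base1 m n"]) (simp add: base1_def)
qed (assumption+ | (simp add: low1_def; fail) | (unfold low1_def, linarith))+

lemma U0_val_bound:
  assumes "m \<ge> 1" "n \<ge> 1"
  shows "\<exists>p. Uscaled U0 m (int n) = wq ^ 2 * ev yq p \<and> val_bound (val0 m) (low0 m) p"
proof (rule val_bound_induction[OF V5_linear_U0 _ val0_n_step val0_m_step _ assms])
  show "\<exists>p. Uscaled U0 m (int n) = wq ^ 2 * ev yq p \<and> val_bound (val0 m) (low0 m) p"
    if "m \<in> {1..5}" "n \<in> {1..5}" for m n
    using base_values0[OF that] val_bound_Poly[OF table_nth[OF base_table0_val that]]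
    by (intro exI[of _ "base0 m n"]) (simp add: base0_def)
qed (assumption+ | (simp add: low0_def; fail) | (unfold low0_def, linarith))+

section \<open>From polynomials to discrete arrays\<close>

lemma ev_altdef: "degree p \<le> N \<Longrightarrow> ev z p = (\<Sum>i\<le>N. of_int (coeff p i) * z ^ i)"
proof (induction p arbitrary: N)
  case (pCons a p)
  show ?case
  proof (cases "p = 0")
    case True
    have "(\<Sum>i\<le>N. of_int (coeff [:a:] i) * z ^ i) = (\<Sum>i\<in>{0}. of_int (coeff [:a:] i) * z ^ i)"
      by (rule sum.mono_neutral_right) (auto simp: coeff_pCons split: nat.splits)
    then show ?thesis using True by simp
  next
    case False
    then obtain N' where N: "N = Suc N'" "degree p \<le> N'" using pCons.prems by (cases N) auto
    then show ?thesis unfolding N(1) sum.atMost_Suc_shift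
      by (simp add: pCons.IH[OF N(2)] sum_distrib_left algebra_simps)
  qed
qed simp

text \<open>Under \<open>val_bound\<close> the division is exact. The value 0 at negative r only
  extends the function to all integers.\<close>

definition quot_coeff :: "(nat \<Rightarrow> nat) \<Rightarrow> int poly \<Rightarrow> int \<Rightarrow> int" where
  "quot_coeff v p r = (if r < 0 then 0 else coeff p (nat r) div 5 ^ v (nat r))"

lemma discrete_quot_coeff: "discrete (quot_coeff v p)"
  unfolding discrete_def
proof (intro exI allI impI)
  fix r assume "r \<ge> int (Suc (degree p))"
  then have "degree p < nat r" by linarith
  then show "quot_coeff v p r = 0" by (simp add: quot_coeff_def coeff_eq_0)
qed

lemma ev_eq_sum_quot_coeff:
  assumes "val_bound v l p"
  shows "ev z p = (\<Sum>r | r \<ge> int l \<and> quot_coeff v p r \<noteq> 0. of_int (quot_coeff v p r) * 5 ^ v (nat r) * z powi r)"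
proof -
  let ?A = "{i. l \<le> i \<and> quot_coeff v p (int i) \<noteq> 0}"
  have c: "coeff p i = quot_coeff v p (int i) * 5 ^ v i" for i
    using assms by (simp add: quot_coeff_def val_bound_def)
  have sub: "?A \<subseteq> {..degree p}" using c by (force intro: le_degree)
  have "ev z p = (\<Sum>i\<le>degree p. of_int (coeff p i) * z ^ i)" by (rule ev_altdef) simp
  also have "\<dots> = (\<Sum>i\<in>?A. of_int (coeff p i) * z ^ i)"
  proof (rule sum.mono_neutral_right)
    show "\<forall>i\<in>{..degree p} - ?A. of_int (coeff p i) * z ^ i = 0"
    proof
      fix i assume "i \<in> {..degree p} - ?A"
      then have "coeff p i = 0" using assms c[of i] by (auto simp: val_bound_def not_le)
      then show "of_int (coeff p i) * z ^ i = 0" by simp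
    qed
  qed (use sub in simp_all)
  also have "\<dots> = (\<Sum>r\<in>int ` ?A. of_int (quot_coeff v p r) * 5 ^ v (nat r) * z powi r)"
    by (subst sum.reindex) (simp_all add: c)
  also have "int ` ?A = {r. r \<ge> int l \<and> quot_coeff v p r \<noteq> 0}"
    by (auto simp: image_iff) (metis int_nat_eq nat_le_iff of_nat_0_le_iff order_trans zle_int)
  finally show ?thesis .
qed

lemma ceiling_div_5: "\<lceil>real_of_int a / 5\<rceil> = (a + 4) div 5"
proof -
  have "\<lceil>real_of_int a / real_of_int 5\<rceil> = - (- a div 5)" by (rule ceiling_divide_eq_div)
  also have "\<dots> = (a + 4) div 5" by presburger
  finally show ?thesis by simp
qed

lemma Uscaled_imp_value:
  assumes "m \<ge> 1" "n \<ge> 1" "Uscaled U (nat m) n = wq ^ e * ev yq p" "val_bound v l p"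
    and "\<And>r. r \<ge> int l \<Longrightarrow> int (v (nat r)) = \<pi> r"
  shows "U (yq powi m / (1 + 5 * yq) powi n) = 1 / (1 + 5 * yq) powi (5 * n - int e) *
    (\<Sum>r | r \<ge> int l \<and> quot_coeff v p r \<noteq> 0. of_int (quot_coeff v p r) * 5 powi \<pi> r * yq powi r)"
proof -
  have "yq powi m = yq ^ nat m" using assms(1) by (simp add: power_int_def)
  then have "U (yq powi m / (1 + 5 * yq) powi n) = Uval U (nat m) n" by (simp add: Uval_def wq_def)
  also have "\<dots> = wq ^ e * ev yq p / wq powi (5 * n)"
    using assms(3) by (simp add: Uscaled_def eq_divide_eq mult.commute)
  also have "\<dots> = 1 / (1 + 5 * yq) powi (5 * n - int e) * ev yq p"
    using wq_powi_diff[of "5 * n" e] by (simp add: wq_def)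
  also have "ev yq p = (\<Sum>r | r \<ge> int l \<and> quot_coeff v p r \<noteq> 0. of_int (quot_coeff v p r) * 5 powi \<pi> r * yq powi r)"
    unfolding ev_eq_sum_quot_coeff[OF assms(4)]
  proof (rule sum.cong[OF refl])
    fix r assume "r \<in> {r. r \<ge> int l \<and> quot_coeff v p r \<noteq> 0}"
    then have "\<pi> r = int (v (nat r))" using assms(5) by simp
    then show "of_int (quot_coeff v p r) * 5 ^ v (nat r) * yq powi r = of_int (quot_coeff v p r) * 5 powi \<pi> r * yq powi r"
      by simp
  qed
  finally show ?thesis .
qed

theorem theorem3p3:
  shows "\<exists>h1 h0 :: int \<Rightarrow> int \<Rightarrow> int \<Rightarrow> int.
    discrete_array h1 \<and> discrete_array h0 \<and>
    (\<forall>m n :: int. m \<ge> 1 \<longrightarrow> n \<ge> 1 \<longrightarrow>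
      U1 (yq powi m / (1 + 5 * yq) powi n) =
        1 / (1 + 5 * yq) powi (5 * n - 4) *
        (\<Sum>r | r \<ge> \<lceil>real_of_int m / 5\<rceil> \<and> h1 m n r \<noteq> 0.
           of_int (h1 m n r) * 5 powi pi1 m r * yq powi r) \<and>
      U0 (yq powi m / (1 + 5 * yq) powi n) =
        1 / (1 + 5 * yq) powi (5 * n - 2) *
        (\<Sum>r | r \<ge> \<lceil>real_of_int (m + 2) / 5\<rceil> \<and> h0 m n r \<noteq> 0.
           of_int (h0 m n r) * 5 powi pi0 m r * yq powi r))"
proof -
  obtain P1 where P1: "\<And>m n. m \<ge> 1 \<Longrightarrow> n \<ge> 1 \<Longrightarrow>
      Uscaled U1 m (int n) = wq ^ 4 * ev yq (P1 m n) \<and> val_bound (val1 m) (low1 m) (P1 m n)"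
    using U1_val_bound by metis
  obtain P0 where P0: "\<And>m n. m \<ge> 1 \<Longrightarrow> n \<ge> 1 \<Longrightarrow>
      Uscaled U0 m (int n) = wq ^ 2 * ev yq (P0 m n) \<and> val_bound (val0 m) (low0 m) (P0 m n)"
    using U0_val_bound by metis
  define h1 where "h1 m n = quot_coeff (val1 (nat m)) (P1 (nat m) (nat n))" for m n
  define h0 where "h0 m n = quot_coeff (val0 (nat m)) (P0 (nat m) (nat n))" for m n
  have "U1 (yq powi m / (1 + 5 * yq) powi n) =
        1 / (1 + 5 * yq) powi (5 * n - 4) *
        (\<Sum>r | r \<ge> \<lceil>real_of_int m / 5\<rceil> \<and> h1 m n r \<noteq> 0.
           of_int (h1 m n r) * 5 powi pi1 m r * yq powi r)"
    if mn: "m \<ge> 1" "n \<ge> 1" for m n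
  proof -
    have l: "\<lceil>real_of_int m / 5\<rceil> = int (low1 (nat m))"
      using mn by (simp add: ceiling_div_5 low1_def zdiv_int)
    have "int (val1 (nat m) (nat r)) = pi1 m r" if "r \<ge> int (low1 (nat m))" for r
    proof -
      \<comment> \<open>From r \<ge> \<lceil>m / 5\<rceil> the numerator 5 r - m + 1 is positive, so
        the exponent is not truncated by \<open>nat\<close>.\<close>
      have r: "m \<le> 5 * r" using that mn unfolding low1_def by linarith
      then have "0 \<le> pi1 m r" using pi1_ge[of m r] mn by (smt (verit) div_pos_pos_trivial pos_imp_zdiv_nonneg_iff)
      then show ?thesis using r mn by (simp add: val1_def)
    qed
    with P1[of "nat m" "nat n"] mn show ?thesis
      unfolding l h1_def using Uscaled_imp_value[of m n U1 4 "P1 (nat m) (nat n)" "val1 (nat m)" "low1 (nat m)" "pi1 m"] by simp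
  qed
  moreover have "U0 (yq powi m / (1 + 5 * yq) powi n) =
        1 / (1 + 5 * yq) powi (5 * n - 2) *
        (\<Sum>r | r \<ge> \<lceil>real_of_int (m + 2) / 5\<rceil> \<and> h0 m n r \<noteq> 0.
           of_int (h0 m n r) * 5 powi pi0 m r * yq powi r)"
    if mn: "m \<ge> 1" "n \<ge> 1" for m n
  proof -
    have l: "\<lceil>real_of_int (m + 2) / 5\<rceil> = int (low0 (nat m))"
      unfolding ceiling_div_5 using mn by (simp add: low0_def zdiv_int)
    have "int (val0 (nat m) (nat r)) = pi0 m r" if "r \<ge> int (low0 (nat m))" for r
    proof -
      have r: "m + 2 \<le> 5 * r" using that mn unfolding low0_def by linarith
      then have "0 \<le> pi0 m r" using pi0_ge[of m r] mn by (smt (verit) div_pos_pos_trivial pos_imp_zdiv_nonneg_iff)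
      then show ?thesis using r mn by (simp add: val0_def)
    qed
    with P0[of "nat m" "nat n"] mn show ?thesis
      unfolding l h0_def using Uscaled_imp_value[of m n U0 2 "P0 (nat m) (nat n)" "val0 (nat m)" "low0 (nat m)" "pi0 m"] by simp
  qed
  moreover have "discrete_array h1" "discrete_array h0"
    by (simp_all add: discrete_array_def h1_def h0_def discrete_quot_coeff)
  ultimately show ?thesis by blast
qed

end
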